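(* Let $m\ge 3$ and let $\alpha=(\alpha_1,\dots,\alpha_m)$ be a generic length vector with $\alpha_1\le\alpha_2\le\dots\le\alpha_{m-1}$ and $\alpha_m<\sum_{i=1}^{m-1}\alpha_i$. Then the chain space $\mathrm{Ch}(\alpha)$ is aspherical if and only if the short code of $\alpha$ is one of the following: (1) $<\{1,2,\dots,m-3,m\}>$; (2) $<\{1,2,\dots,m-2,m\}>$; (3) $<\{1,2,\dots,m-4,m-2,m\}>$; (4) $<\{1,2,\dots,m-4,m-1,m\}>$.
   Context: A length vector is an $m$-tuple $\alpha=(\alpha_1,\dots,\alpha_m)$ of positive reals; it is generic if $\sum_{i=1}^m\varepsilon_i\alpha_i\neq 0$ for every choice of signs $\varepsilon_i\in\{\pm1\}$. Write $[m]=\{1,\dots,m\}$. A subset $I\subseteq[m]$ is $\alpha$-short if $\sum_{i\in I}\alpha_i<\sum_{j\notin I}\alpha_j$, and $\alpha$-long otherwise. The chain space is $\mathrm{Ch}(\alpha)=\{(v_1,\dots,v_{m-1})\in(S^1)^{m-1}:\sum_{i=1}^{m-1}\alpha_i x_i=\alpha_m\}/\mathbb{Z}_2$, where $v_i=(x_i,y_i)\in S^1\subset\mathbb{R}^2$ and the generator of $\mathbb{Z}_2$ acts diagonally by $(x,y)\mapsto(x,-y)$ (for generic $\alpha$ it is a smooth closed $(m-2)$-manifold). Short code: let $S_m(\alpha)=\{J\subseteq[m]: m\in J,\ J\text{ is }\alpha\text{-short}\}$, partially ordered by $I\le J$ iff, writing $I=\{i_1<\dots<i_t\}$, there are elements $j_1,\dots,j_t$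 of $J$ (distinct) with $i_s\le j_s$ for $1\le s\le t$. The short code of $\alpha$ is the set of maximal elements $A_1,\dots,A_k$ of $S_m(\alpha)$, written $<A_1,\dots,A_k>$. *)

theory Defs
  imports "HOL-Analysis.Analysis"
begin

text \<open>A length vector with \<open>m\<close> entries is a function \<open>\<alpha> :: nat \<Rightarrow> real\<close> of which only the values
  at the indices \<open>{1..m}\<close> matter.\<close>

definition length_vector :: "nat \<Rightarrow> (nat \<Rightarrow> real) \<Rightarrow> bool" where
  "length_vector m \<alpha> \<longleftrightarrow> (\<forall>i\<in>{1..m}. 0 < \<alpha> i)"

definition generic :: "nat \<Rightarrow> (nat \<Rightarrow> real) \<Rightarrow> bool" where
  "generic m \<alpha> \<longleftrightarrow>
     (\<forall>\<epsilon> :: nat \<Rightarrow> real. (\<forall>i\<in>{1..m}. \<epsilon> i \<in> {-1, 1}) \<longrightarrow> (\<Sum>i=1..m. \<epsilon> i * \<alpha> i) \<noteq> 0)"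

definition short :: "nat \<Rightarrow> (nat \<Rightarrow> real) \<Rightarrow> nat set \<Rightarrow> bool" where
  "short m \<alpha> I \<longleftrightarrow> I \<subseteq> {1..m} \<and> (\<Sum>i\<in>I. \<alpha> i) < (\<Sum>j\<in>{1..m} - I. \<alpha> j)"

definition short_sets :: "nat \<Rightarrow> (nat \<Rightarrow> real) \<Rightarrow> nat set set" where
  "short_sets m \<alpha> = {J. J \<subseteq> {1..m} \<and> m \<in> J \<and> short m \<alpha> J}"

text \<open>The assignment \<open>i\<^sub>s \<mapsto> j\<^sub>s\<close> to distinct elements of \<open>J\<close> is the injection \<open>f\<close>.\<close>

definition set_le :: "nat set \<Rightarrow> nat set \<Rightarrow> bool" where
  "set_le I J \<longleftrightarrow> (\<exists>f. inj_on f I \<and> f ` I \<subseteq> J \<and> (\<forall>i\<in>I. i \<le> f i))"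

definition short_code :: "nat \<Rightarrow> (nat \<Rightarrow> real) \<Rightarrow> nat set set" where
  "short_code m \<alpha> =
     {A \<in> short_sets m \<alpha>. \<forall>B\<in>short_sets m \<alpha>. set_le A B \<longrightarrow> B = A}"

definition quotient_topology :: "'a topology \<Rightarrow> ('a \<Rightarrow> 'b) \<Rightarrow> 'b topology" where
  "quotient_topology X q =
     topology (\<lambda>U. U \<subseteq> q ` topspace X \<and> openin X {x \<in> topspace X. q x \<in> U})"

lemma openin_quotient_topology:
  "openin (quotient_topology X q) U \<longleftrightarrow>
     U \<subseteq> q ` topspace X \<and> openin X {x \<in> topspace X. q x \<in> U}"
proof -
  let ?P = "\<lambda>U. U \<subseteq> q ` topspace X \<and> openin X {x \<in> topspace X. q x \<in> U}"
  have "istopology ?P"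
    unfolding istopology_def
  proof (intro conjI allI impI)
    fix S T assume "?P S" "?P T"
    moreover have "{x \<in> topspace X. q x \<in> S \<inter> T} =
        {x \<in> topspace X. q x \<in> S} \<inter> {x \<in> topspace X. q x \<in> T}" by auto
    ultimately show "S \<inter> T \<subseteq> q ` topspace X" "openin X {x \<in> topspace X. q x \<in> S \<inter> T}"
      by auto
  next
    fix K assume *: "\<forall>S\<in>K. ?P S"
    then show "\<Union>K \<subseteq> q ` topspace X" by blast
    have "{x \<in> topspace X. q x \<in> \<Union>K} = \<Union>((\<lambda>S. {x \<in> topspace X. q x \<in> S}) ` K)" by auto
    then show "openin X {x \<in> topspace X. q x \<in> \<Union>K}"
      using * by auto
  qed
  then show ?thesis
    by (simp add: quotient_topology_def)
qed

lemma topspace_quotient_topology [simp]: "topspace (quotient_topology X q) = q ` topspace X"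
proof -
  have "{x \<in> topspace X. q x \<in> q ` topspace X} = topspace X" by auto
  then have "openin (quotient_topology X q) (q ` topspace X)"
    by (simp add: openin_quotient_topology)
  then show ?thesis
    by (metis openin_quotient_topology openin_subset openin_topspace subset_antisym)
qed

lemma quotient_map_quotient_topology: "quotient_map X (quotient_topology X q) q"
  by (auto simp: quotient_map_def openin_quotient_topology)

text \<open>The circle is \<open>sphere 0 1\<close> in \<open>\<real> \<times> \<real>\<close>, whose norm is the Euclidean one; a tuple
  \<open>(v\<^sub>1, \<dots>, v\<^bsub>m-1\<^esub>)\<close> is a point of the product topology over \<open>{1..m-1}\<close>, that is, a function that
  is \<open>undefined\<close> outside \<open>{1..m-1}\<close>.\<close>

definition chains :: "nat \<Rightarrow> (nat \<Rightarrow> real) \<Rightarrow> (nat \<Rightarrow> real \<times> real) topology" where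
  "chains m \<alpha> =
     subtopology (product_topology (\<lambda>_. top_of_set (sphere 0 1)) {1..m-1})
       {v. (\<Sum>i=1..m-1. \<alpha> i * fst (v i)) = \<alpha> m}"

definition reflect :: "nat \<Rightarrow> (nat \<Rightarrow> real \<times> real) \<Rightarrow> (nat \<Rightarrow> real \<times> real)" where
  "reflect m v = (\<lambda>i\<in>{1..m-1}. (fst (v i), - snd (v i)))"

definition chain_space :: "nat \<Rightarrow> (nat \<Rightarrow> real) \<Rightarrow> (nat \<Rightarrow> real \<times> real) set topology" where
  "chain_space m \<alpha> = quotient_topology (chains m \<alpha>) (\<lambda>v. {v, reflect m v})"

lemma sphere_prod_iff: "v \<in> sphere (0 :: real \<times> real) 1 \<longleftrightarrow> (fst v)\<^sup>2 + (snd v)\<^sup>2 = 1"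
  by (simp add: norm_prod_def)

lemma reflect_chains:
  assumes "v \<in> topspace (chains m \<alpha>)"
  shows "reflect m v \<in> topspace (chains m \<alpha>)" and "reflect m (reflect m v) = v"
proof -
  have v: "v \<in> (\<Pi>\<^sub>E i\<in>{1..m-1}. sphere 0 1)" "(\<Sum>i=1..m-1. \<alpha> i * fst (v i)) = \<alpha> m"
    using assms by (auto simp: chains_def topspace_product_topology)
  have "reflect m v \<in> (\<Pi>\<^sub>E i\<in>{1..m-1}. sphere 0 1)"
    using v(1) by (auto simp: reflect_def PiE_iff sphere_prod_iff simp del: mem_sphere mem_sphere_0)
  moreover have "(\<Sum>i=1..m-1. \<alpha> i * fst (reflect m v i)) = \<alpha> m"
    using v(2) by (simp add: reflect_def)
  ultimately show "reflect m v \<in> topspace (chains m \<alpha>)"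
    by (auto simp: chains_def topspace_product_topology)
  show "reflect m (reflect m v) = v"
    using v(1) by (auto simp: reflect_def fun_eq_iff PiE_iff extensional_def)
qed

text \<open>The underlying set of \<open>\<pi>\<^sub>n(X, x)\<close>: pointed maps from the \<open>n\<close>-sphere up to pointed homotopy.
  Values of a map outside the sphere are irrelevant, and \<open>homotopic_with\<close> identifies maps that
  agree on the sphere.\<close>

definition sphere_base :: "nat \<Rightarrow> real" where
  "sphere_base = (\<lambda>i. if i = 0 then 1 else 0)"

definition pointed_sphere_maps :: "nat \<Rightarrow> 'a topology \<Rightarrow> 'a \<Rightarrow> ((nat \<Rightarrow> real) \<Rightarrow> 'a) set" where
  "pointed_sphere_maps n X x = {f. continuous_map (nsphere n) X f \<and> f sphere_base = x}"

definition pointed_homotopy ::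
    "nat \<Rightarrow> 'a topology \<Rightarrow> 'a \<Rightarrow> (((nat \<Rightarrow> real) \<Rightarrow> 'a) \<times> ((nat \<Rightarrow> real) \<Rightarrow> 'a)) set" where
  "pointed_homotopy n X x =
     {(f, g). homotopic_with (\<lambda>h. h sphere_base = x) (nsphere n) X f g}"

definition homotopy_group_set :: "nat \<Rightarrow> 'a topology \<Rightarrow> 'a \<Rightarrow> ((nat \<Rightarrow> real) \<Rightarrow> 'a) set set" where
  "homotopy_group_set n X x = pointed_sphere_maps n X x // pointed_homotopy n X x"

lemma equiv_pointed_homotopy: "equiv (pointed_sphere_maps n X x) (pointed_homotopy n X x)"
  by (rule equivI)
    (auto simp: pointed_sphere_maps_def pointed_homotopy_def refl_on_def sym_def trans_def
       dest: homotopic_with_imp_continuous_maps homotopic_with_imp_property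
       intro: homotopic_with_symD homotopic_with_trans)

text \<open>A group is trivial iff its underlying set is a singleton, so the group structure on
  \<open>\<pi>\<^sub>n(X, x)\<close> is not needed.\<close>

definition aspherical :: "'a topology \<Rightarrow> bool" where
  "aspherical X \<longleftrightarrow>
     path_connected_space X \<and>
     (\<forall>n\<ge>2. \<forall>x\<in>topspace X. is_singleton (homotopy_group_set n X x))"

end

theory Submission
  imports Defs "HOL-Homology.Homology"
begin

text \<open>
  The double cover of the chain space glues copies of the simple polytope
  \<open>P = {x \<in> [-1,1]\<^sup>m\<^sup>-\<^sup>1. \<Sum> \<alpha>\<^sub>i x\<^sub>i = \<alpha>\<^sub>m}\<close> along its facets \<open>x\<^sub>i = \<plusminus>1\<close>, which act as mirrors.
  It is covered by Davis' complex \<open>U\<close> of the right-angled Coxeter group generated by the nonempty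
  facets. If pairwise intersecting facets of \<open>P\<close> always have a common point, then \<open>U\<close> is built by
  adding chambers one at a time along unions of faces, so \<open>U\<close> is an absolute extensor for compact
  metrizable spaces; since spheres of dimension at least two lift to \<open>U\<close>, all higher homotopy groups
  vanish. Otherwise a minimal set of \<open>k \<ge> 3\<close> pairwise intersecting facets without a common point
  yields a \<open>(k-1)\<close>-sphere of chains around a point missing from a \<open>k\<close>-torus, and this sphere is not
  null-homotopic. Finally, the flag condition on \<open>P\<close> says that the minimal long subsets of
  \<open>{1..m-1}\<close>, and the minimal \<open>J\<close> with \<open>J \<union> {m}\<close> long, have at most two elements; for ordered
  lengths this holds exactly for the four short codes.
\<close>

section \<open>Covering maps and lifting of homotopies\<close>

text \<open>Why extensors: the extension property for closed subsets survives gluing along closed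
  pieces whose intersection has it, and paths as well as null homotopies relative to a base point
  are extension problems. Connectedness and the vanishing of all higher homotopy groups therefore
  come from one statement about \<open>U\<close>. On the topological side the flag condition enters
  only to show that a face of \<open>P\<close> cut out by pairwise meeting facets is nonempty.
  Facets \<open>x\<^sub>i = 1\<close> and \<open>x\<^sub>i = -1\<close> can be treated separately
  there, because two independent shortness conditions decide whether a face is empty. In the other
  direction \<open>k \<ge> 3\<close> makes the dimension \<open>k-1\<close> of the sphere at least
  two, so that asphericity speaks about it. A null homotopy lifts to the double cover, and its
  coordinates lift further to real angles; there the sphere winds once around the origin of
  \<open>k\<close>-dimensional space, which the missing corner keeps out of reach.\<close>

definition cover_map :: "'e topology \<Rightarrow> 'x topology \<Rightarrow> ('e \<Rightarrow> 'x) \<Rightarrow> bool" where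
  "cover_map E X p \<longleftrightarrow>
     continuous_map E X p \<and> Hausdorff_space E \<and>
     (\<forall>e\<in>topspace E. \<exists>N. openin E N \<and> e \<in> N \<and> inj_on p N) \<and>
     (\<forall>x\<in>topspace X. \<exists>V. openin X V \<and> x \<in> V \<and>
        (\<forall>e\<in>topspace E. p e \<in> V \<longrightarrow>
           (\<exists>\<sigma>. continuous_map (subtopology X V) E \<sigma> \<and> (\<forall>z\<in>V. p (\<sigma> z) = z) \<and> \<sigma> (p e) = e)))"

text \<open>The set where two lifts agree is closed because \<open>E\<close> is Hausdorff and open
  because \<open>p\<close> is locally injective. Those clauses of \<open>cover_map\<close> serve
  uniqueness of lifts; the sections through every point above \<open>V\<close> serve
  existence.\<close>

lemma cover_map_lift_unique:
  assumes p: "cover_map E X p" and Z: "connected_space Z"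
    and g: "continuous_map Z E g" and h: "continuous_map Z E h"
    and eq: "\<And>z. z \<in> topspace Z \<Longrightarrow> p (g z) = p (h z)"
    and z0: "z0 \<in> topspace Z" "g z0 = h z0" and z: "z \<in> topspace Z"
  shows "g z = h z"
proof -
  let ?S = "{z \<in> topspace Z. g z = h z}"
  have HE: "Hausdorff_space E" using p by (simp add: cover_map_def)
  have cl: "closedin Z ?S"
  proof -
    have "openin Z (topspace Z - ?S)"
    proof (subst openin_subopen, intro ballI)
      fix y assume "y \<in> topspace Z - ?S"
      then have y: "y \<in> topspace Z" "g y \<noteq> h y" by auto
      then have "g y \<in> topspace E" "h y \<in> topspace E"
        using g h y by (auto simp: continuous_map_def)
      then obtain A B where AB: "openin E A" "openin E B" "g y \<in> A" "h y \<in> B" "disjnt A B"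
        using HE y unfolding Hausdorff_space_def by metis
      let ?T = "{z \<in> topspace Z. g z \<in> A} \<inter> {z \<in> topspace Z. h z \<in> B}"
      have "openin Z ?T"
        using AB g h by (intro openin_Int openin_continuous_map_preimage) auto
      then show "\<exists>T. openin Z T \<and> y \<in> T \<and> T \<subseteq> topspace Z - ?S"
        using AB y by (intro exI[of _ ?T]) (auto simp: disjnt_iff)
    qed
    then show ?thesis by (simp add: closedin_def)
  qed
  have op: "openin Z ?S"
  proof (subst openin_subopen, intro ballI)
    fix y assume "y \<in> ?S"
    then have y: "y \<in> topspace Z" "g y = h y" by auto
    from y(1) have "g y \<in> topspace E" using g by (auto simp: continuous_map_def)
    then obtain N where N: "openin E N" "g y \<in> N" "inj_on p N"
      using p unfolding cover_map_def by blast
    let ?T = "{z \<in> topspace Z. g z \<in> N} \<inter> {z \<in> topspace Z. h z \<in> N}"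
    have "openin Z ?T"
      using N g h by (intro openin_Int openin_continuous_map_preimage) auto
    then show "\<exists>T. openin Z T \<and> y \<in> T \<and> T \<subseteq> ?S"
      using N y eq by (intro exI[of _ ?T]) (auto simp: inj_on_def)
  qed
  have "?S = topspace Z"
    using Z cl op z0 unfolding connected_space_clopen_in by blast
  with z show ?thesis by blast
qed

text \<open>Lifts of a homotopy over short time intervals and small open sets are given by local
  sections; they are composed along the time interval with \<open>Bolzano\<close>.\<close>

lemma cover_map_lift_homotopy_local:
  assumes p: "cover_map E X p"
    and H: "continuous_map (prod_topology (top_of_set {0..1::real}) Z) X H"
    and g: "continuous_map Z E g" "\<And>z. z \<in> topspace Z \<Longrightarrow> p (g z) = H (0, z)"
    and z: "z \<in> topspace Z"
  shows "\<exists>N G. openin Z N \<and> z \<in> N \<and>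
           continuous_map (prod_topology (top_of_set {0..1}) (subtopology Z N)) E G \<and>
           (\<forall>t\<in>{0..1}. \<forall>y\<in>N. p (G (t, y)) = H (t, y)) \<and> (\<forall>y\<in>N. G (0, y) = g y)"
proof -
  \<comment> \<open>\<open>L a b\<close> speaks about all partial lifts at time \<open>a\<close> and
    lets the neighbourhood shrink; in this generality the end of one lift can be the start of the
    next.\<close>
  define L where "L a b \<longleftrightarrow> (0 \<le> a \<and> a \<le> b \<and> b \<le> 1 \<longrightarrow>
     (\<forall>N g. openin Z N \<and> z \<in> N \<and> continuous_map (subtopology Z N) E g \<and> (\<forall>y\<in>N. p (g y) = H (a, y)) \<longrightarrow>
       (\<exists>N' G. openin Z N' \<and> z \<in> N' \<and> N' \<subseteq> N \<and>
           continuous_map (prod_topology (top_of_set {a..b}) (subtopology Z N')) E G \<and>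
           (\<forall>t\<in>{a..b}. \<forall>y\<in>N'. p (G (t, y)) = H (t, y)) \<and> (\<forall>y\<in>N'. G (a, y) = g y))))"
    for a b :: real
  have "L 0 1"
  proof (rule Bolzano)
    fix a b c :: real assume ab: "L a b" and bc: "L b c" and le: "a \<le> b" "b \<le> c"
    show "L a c"
      unfolding L_def
    proof (intro impI allI)
      fix N g
      assume ac: "0 \<le> a \<and> a \<le> c \<and> c \<le> 1"
        and Ng: "openin Z N \<and> z \<in> N \<and> continuous_map (subtopology Z N) E g \<and> (\<forall>y\<in>N. p (g y) = H (a, y))"
      have "0 \<le> a \<and> a \<le> b \<and> b \<le> 1" "0 \<le> b \<and> b \<le> c \<and> c \<le> 1" using ac le by auto
      obtain N1 G1 where 1: "openin Z N1" "z \<in> N1" "N1 \<subseteq> N"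
        and G1: "continuous_map (prod_topology (top_of_set {a..b}) (subtopology Z N1)) E G1"
           "\<And>t y. t\<in>{a..b} \<Longrightarrow> y\<in>N1 \<Longrightarrow> p (G1 (t, y)) = H (t, y)" "\<And>y. y\<in>N1 \<Longrightarrow> G1 (a, y) = g y"
        using ab[unfolded L_def, rule_format, OF _ Ng] ac le by (smt (verit, best))
      have cb: "continuous_map (subtopology Z N1) E (\<lambda>y. G1 (b, y))"
      proof -
        have "continuous_map (subtopology Z N1) (prod_topology (top_of_set {a..b}) (subtopology Z N1)) (\<lambda>y. (b, y))"
          using le by (simp add: continuous_map_pairwise o_def)
        from continuous_map_compose[OF this G1(1)] show ?thesis by (simp add: o_def)
      qed
      have N1: "openin Z N1 \<and> z \<in> N1 \<and> continuous_map (subtopology Z N1) E (\<lambda>y. G1 (b, y))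
        \<and> (\<forall>y\<in>N1. p (G1 (b, y)) = H (b, y))"
        using 1 cb G1(2) le by auto
      then obtain N2 G2 where 2: "openin Z N2" "z \<in> N2" "N2 \<subseteq> N1"
        and G2: "continuous_map (prod_topology (top_of_set {b..c}) (subtopology Z N2)) E G2"
           "\<And>t y. t\<in>{b..c} \<Longrightarrow> y\<in>N2 \<Longrightarrow> p (G2 (t, y)) = H (t, y)" "\<And>y. y\<in>N2 \<Longrightarrow> G2 (b, y) = G1 (b, y)"
        using bc[unfolded L_def, rule_format, OF _ N1] ac le by (smt (verit, best))
      let ?P = "prod_topology (top_of_set {a..c}) (subtopology Z N2)"
      define G where "G x = (if fst x \<le> b then G1 x else G2 x)" for x
      have "continuous_map ?P E (\<lambda>x. if fst x \<le> b then G1 x else G2 x)"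
      proof (rule continuous_map_cases_le)
        show "continuous_map ?P euclideanreal fst"
          using continuous_map_fst continuous_map_into_fulltopology by blast
        show "continuous_map ?P euclideanreal (\<lambda>x. b)" by simp
        have fs: "continuous_map (subtopology ?P S) euclidean fst" "continuous_map (subtopology ?P S) Z snd" for S
          by (rule continuous_map_from_subtopology,
              rule continuous_map_into_fulltopology, rule continuous_map_fst)
             (rule continuous_map_from_subtopology,
              rule continuous_map_into_fulltopology, rule continuous_map_snd)
        have c1: "continuous_map (subtopology ?P {x \<in> topspace ?P. fst x \<le> b}) (prod_topology (top_of_set {a..b}) (subtopology Z N1)) (\<lambda>x. x)"
          using 2(3) fs by (auto simp: continuous_map_pairwise o_def continuous_map_in_subtopology)
        show "continuous_map (subtopology ?P {x \<in> topspace ?P. fst x \<le> b}) E G1"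
          using continuous_map_compose[OF c1 G1(1)] by (simp add: o_def)
        have c2: "continuous_map (subtopology ?P {x \<in> topspace ?P. b \<le> fst x}) (prod_topology (top_of_set {b..c}) (subtopology Z N2)) (\<lambda>x. x)"
          using fs by (auto simp: continuous_map_pairwise o_def continuous_map_in_subtopology)
        show "continuous_map (subtopology ?P {x \<in> topspace ?P. b \<le> fst x}) E G2"
          using continuous_map_compose[OF c2 G2(1)] by (simp add: o_def)
        show "\<And>x. x \<in> topspace ?P \<Longrightarrow> fst x = b \<Longrightarrow> G1 x = G2 x"
          using G2(3) by auto
      qed
      then have "continuous_map ?P E G" by (simp add: G_def[abs_def])
      moreover have "p (G (t, y)) = H (t, y)" if "t \<in> {a..c}" "y \<in> N2" for t y
        using that 2 G1(2) G2(2) by (auto simp: G_def)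
      moreover have "G (a, y) = g y" if "y \<in> N2" for y
        using that 2 G1(3) le by (auto simp: G_def)
      ultimately show "\<exists>N' G. openin Z N' \<and> z \<in> N' \<and> N' \<subseteq> N \<and>
           continuous_map (prod_topology (top_of_set {a..c}) (subtopology Z N')) E G \<and>
           (\<forall>t\<in>{a..c}. \<forall>y\<in>N'. p (G (t, y)) = H (t, y)) \<and> (\<forall>y\<in>N'. G (a, y) = g y)"
        using 1 2 by (intro exI[of _ N2] exI[of _ G]) auto
    qed
  next
    fix x :: real assume x: "0 \<le> x" "x \<le> 1"
    have "H (x, z) \<in> topspace X"
      using H x z by (auto simp: continuous_map_def)
    then obtain V where V: "openin X V" "H (x, z) \<in> V"
      and sec: "\<And>e. e \<in> topspace E \<Longrightarrow> p e \<in> V \<Longrightarrow>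
           \<exists>\<sigma>. continuous_map (subtopology X V) E \<sigma> \<and> (\<forall>z\<in>V. p (\<sigma> z) = z) \<and> \<sigma> (p e) = e"
      using p unfolding cover_map_def by meson
    have "openin (prod_topology (top_of_set {0..1}) Z) {w \<in> topspace (prod_topology (top_of_set {0..1}) Z). H w \<in> V}"
      using H V(1) by (rule openin_continuous_map_preimage)
    moreover have "(x, z) \<in> {w \<in> topspace (prod_topology (top_of_set {0..1}) Z). H w \<in> V}"
      using x z V by auto
    ultimately obtain T M where TM: "openin (top_of_set {0..1}) T" "openin Z M" "x \<in> T" "z \<in> M"
      "T \<times> M \<subseteq> {w \<in> topspace (prod_topology (top_of_set {0..1}) Z). H w \<in> V}"
      unfolding openin_prod_topology_alt by meson
    obtain d where d: "d > 0" "\<And>t. t \<in> {0..1} \<Longrightarrow> dist t x < d \<Longrightarrow> t \<in> T"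
      using TM(1,3) unfolding openin_euclidean_subtopology_iff by meson
    show "\<exists>d>0. \<forall>a b. a \<le> x \<and> x \<le> b \<and> b - a < d \<longrightarrow> L a b"
    proof (intro exI[of _ d] conjI d(1) allI impI)
      fix a b assume ab: "a \<le> x \<and> x \<le> b \<and> b - a < d"
      show "L a b"
        unfolding L_def
      proof (intro impI allI)
        fix N g
        assume ab1: "0 \<le> a \<and> a \<le> b \<and> b \<le> 1"
          and Ng: "openin Z N \<and> z \<in> N \<and> continuous_map (subtopology Z N) E g \<and> (\<forall>y\<in>N. p (g y) = H (a, y))"
        have inT: "t \<in> T" if "t \<in> {a..b}" for t
          using that ab ab1 by (intro d(2)) (auto simp: dist_real_def)
        have HV: "H (t, y) \<in> V" if "t \<in> {a..b}" "y \<in> M" for t y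
          using TM(5) inT that by blast
        have gz: "g z \<in> topspace E"
          using Ng z by (auto simp: continuous_map_def)
        have "p (g z) \<in> V" using HV[of a z] TM Ng ab1 by auto
        then obtain \<sigma> where \<sigma>: "continuous_map (subtopology X V) E \<sigma>" "\<And>z. z\<in>V \<Longrightarrow> p (\<sigma> z) = z" "\<sigma> (p (g z)) = g z"
          using sec[OF gz] by metis
        obtain N0 where N0: "openin E N0" "g z \<in> N0" "inj_on p N0"
          using p gz unfolding cover_map_def by meson
        have MN: "openin Z (M \<inter> N)" using TM Ng by auto
        have Hm: "continuous_map (prod_topology (top_of_set {a..b}) (subtopology Z W)) (subtopology X V) H" if "W \<subseteq> M" for W
        proof -
          have "continuous_map (prod_topology (top_of_set {a..b}) (subtopology Z W)) (prod_topology (top_of_set {0..1}) Z) (\<lambda>x. x)"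
            using ab1 by (auto simp: continuous_map_pairwise o_def continuous_map_in_subtopology
               intro: continuous_map_into_fulltopology[OF continuous_map_fst] continuous_map_into_fulltopology[OF continuous_map_snd])
          from continuous_map_compose[OF this H] show ?thesis
            using HV that by (auto simp: o_def continuous_map_in_subtopology)
        qed
        have cW: "continuous_map (subtopology Z W) (prod_topology (top_of_set {a..b}) (subtopology Z W)) (\<lambda>y. (a, y))" for W
          using ab1 by (simp add: continuous_map_pairwise o_def)
        have \<sigma>H: "continuous_map (prod_topology (top_of_set {a..b}) (subtopology Z W)) E (\<sigma> \<circ> H)" if "W \<subseteq> M" for W
          using continuous_map_compose[OF Hm[OF that] \<sigma>(1)] .
        have c1: "continuous_map (subtopology Z (M \<inter> N)) E (\<lambda>y. \<sigma> (H (a, y)))"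
          using continuous_map_compose[OF cW \<sigma>H[of "M \<inter> N"]] by (simp add: o_def)
        have c2: "continuous_map (subtopology Z (M \<inter> N)) E g"
          using Ng continuous_map_from_subtopology_mono by blast
        \<comment> \<open>On \<open>N'\<close> the section and the given lift at time
          \<open>a\<close> both take values in \<open>N0\<close>, where \<open>p\<close> is
          injective, so they coincide.\<close>
        define N' where "N' = {y \<in> M \<inter> N. \<sigma> (H (a, y)) \<in> N0} \<inter> {y \<in> M \<inter> N. g y \<in> N0}"
        have "openin (subtopology Z (M \<inter> N)) N'"
          unfolding N'_def using openin_continuous_map_preimage[OF c1 N0(1)] openin_continuous_map_preimage[OF c2 N0(1)]
            openin_subset[OF MN] by (simp add: inf.absorb2 inf.absorb1 openin_Int)
        then have oN': "openin Z N'" using MN openin_trans_full by blast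
        have "H (a, z) = p (g z)" using Ng by auto
        then have zN': "z \<in> N'"
          using TM Ng N0 \<sigma>(3) by (auto simp: N'_def)
        have agree: "\<sigma> (H (a, y)) = g y" if "y \<in> N'" for y
          using that N0(3) \<sigma>(2) HV[of a y] Ng ab1 by (auto simp: N'_def inj_on_def)
        show "\<exists>N' G. openin Z N' \<and> z \<in> N' \<and> N' \<subseteq> N \<and>
           continuous_map (prod_topology (top_of_set {a..b}) (subtopology Z N')) E G \<and>
           (\<forall>t\<in>{a..b}. \<forall>y\<in>N'. p (G (t, y)) = H (t, y)) \<and> (\<forall>y\<in>N'. G (a, y) = g y)"
        proof (intro exI[of _ N'] exI[of _ "\<sigma> \<circ> H"] conjI ballI)
          have "N' \<subseteq> M" and NN: "N' \<subseteq> N" by (auto simp: N'_def)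
          then show "continuous_map (prod_topology (top_of_set {a..b}) (subtopology Z N')) E (\<sigma> \<circ> H)"
            by (intro \<sigma>H)
          show "N' \<subseteq> N" by (fact NN)
          show "(\<sigma> \<circ> H) (a, y) = g y" if "y \<in> N'" for y
            using agree[OF that] by simp
          show "p ((\<sigma> \<circ> H) (t, y)) = H (t, y)" if "t \<in> {a..b}" "y \<in> N'" for t y
            using \<sigma>(2)[OF HV[of t y]] that \<open>N' \<subseteq> M\<close> by auto
        qed (fact oN' zN')+
      qed
    qed
  qed simp
  have Z: "openin Z (topspace Z) \<and> z \<in> topspace Z \<and> continuous_map (subtopology Z (topspace Z)) E g \<and> (\<forall>y\<in>topspace Z. p (g y) = H (0, y))"
    using g z by simp
  have "0 \<le> (0::real) \<and> 0 \<le> (1::real) \<and> 1 \<le> (1::real)" by simp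
  note ex = \<open>L 0 1\<close>[unfolded L_def, rule_format, OF this Z]
  obtain N where "\<exists>G. openin Z N \<and> z \<in> N \<and> N \<subseteq> topspace Z \<and>
           continuous_map (prod_topology (top_of_set {0..1}) (subtopology Z N)) E G \<and>
           (\<forall>t\<in>{0..1}. \<forall>y\<in>N. p (G (t, y)) = H (t, y)) \<and> (\<forall>y\<in>N. G (0, y) = g y)"
    by (rule exE[OF ex])
  then show ?thesis
    by (elim exE conjE, intro exI conjI)
qed

text \<open>The local lifts glue because, above a fixed \<open>y\<close>, two of them are lifts of
  one path with the same start, and the interval is connected.\<close>

lemma cover_map_lift_homotopy:
  assumes p: "cover_map E X p"
    and H: "continuous_map (prod_topology (top_of_set {0..1::real}) Z) X H"
    and g: "continuous_map Z E g" "\<And>z. z \<in> topspace Z \<Longrightarrow> p (g z) = H (0, z)"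
  obtains G where "continuous_map (prod_topology (top_of_set {0..1}) Z) E G"
    "\<And>t z. t \<in> {0..1} \<Longrightarrow> z \<in> topspace Z \<Longrightarrow> p (G (t, z)) = H (t, z)"
    "\<And>z. z \<in> topspace Z \<Longrightarrow> G (0, z) = g z"
proof -
  let ?I = "top_of_set {0..1::real}"
  define loc where "loc z N G \<longleftrightarrow> openin Z N \<and> z \<in> N \<and>
           continuous_map (prod_topology ?I (subtopology Z N)) E G \<and>
           (\<forall>t\<in>{0..1}. \<forall>y\<in>N. p (G (t, y)) = H (t, y)) \<and> (\<forall>y\<in>N. G (0, y) = g y)" for z N G
  have "\<forall>z\<in>topspace Z. \<exists>N G. loc z N G"
    unfolding loc_def using cover_map_lift_homotopy_local[OF p H g] by simp
  then obtain N F where "\<And>z. z \<in> topspace Z \<Longrightarrow> loc z (N z) (F z)"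
    by metis
  then have NF: "\<And>z. z \<in> topspace Z \<Longrightarrow> openin Z (N z)" "\<And>z. z \<in> topspace Z \<Longrightarrow> z \<in> N z"
       "\<And>z. z \<in> topspace Z \<Longrightarrow> continuous_map (prod_topology ?I (subtopology Z (N z))) E (F z)"
       "\<And>z t y. z \<in> topspace Z \<Longrightarrow> t\<in>{0..1} \<Longrightarrow> y\<in>N z \<Longrightarrow> p (F z (t, y)) = H (t, y)"
       "\<And>z y. z \<in> topspace Z \<Longrightarrow> y\<in>N z \<Longrightarrow> F z (0, y) = g y"
    unfolding loc_def by simp_all
  have agree: "F z (t, y) = F z' (t, y)"
    if "z \<in> topspace Z" "z' \<in> topspace Z" "y \<in> N z" "y \<in> N z'" "t \<in> {0..1}" for z z' t y
  proof (rule cover_map_lift_unique[OF p, of ?I "\<lambda>t. F z (t, y)" "\<lambda>t. F z' (t, y)" 0 t])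
    show "connected_space ?I" by (simp add: connected_space_subtopology)
    have y: "y \<in> topspace Z" using NF(1) that openin_subset by blast
    have c: "continuous_map ?I (prod_topology ?I (subtopology Z W)) (\<lambda>t. (t, y))" if "y \<in> W" for W
      using that y by (simp add: continuous_map_pairwise o_def)
    show "continuous_map ?I E (\<lambda>t. F z (t, y))" "continuous_map ?I E (\<lambda>t. F z' (t, y))"
      using continuous_map_compose[OF c NF(3)] that by (auto simp: o_def)
  qed (use that NF in auto)
  define G where "G = (\<lambda>(t, y). F y (t, y))"
  have "continuous_map (prod_topology ?I Z) E G"
  proof (rule pasting_lemma[where I = "topspace Z" and T = "\<lambda>z. {0..1} \<times> N z" and f = F])
    fix z assume z: "z \<in> topspace Z"
    show "openin (prod_topology ?I Z) ({0..1} \<times> N z)"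
      using NF(1)[OF z] by (simp add: openin_prod_Times_iff)
    have "subtopology (prod_topology ?I Z) ({0..1} \<times> N z) = prod_topology ?I (subtopology Z (N z))"
      by (metis prod_topology_subtopology(2) subtopology_Times subtopology_topspace topspace_euclidean_subtopology)
    then show "continuous_map (subtopology (prod_topology ?I Z) ({0..1} \<times> N z)) E (F z)"
      using NF(3)[OF z] by simp
  next
    fix z z' w assume "z \<in> topspace Z" "z' \<in> topspace Z"
      "w \<in> topspace (prod_topology ?I Z) \<inter> {0..1} \<times> N z \<inter> {0..1} \<times> N z'"
    then show "F z w = F z' w"
      using agree[of z z' "snd w" "fst w"] by (cases w) simp
  next
    fix w assume "w \<in> topspace (prod_topology ?I Z)"
    then show "\<exists>j. j \<in> topspace Z \<and> w \<in> {0..1} \<times> N j \<and> G w = F j w"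
      using NF(2)[of "snd w"] by (intro exI[of _ "snd w"]) (cases w, simp add: G_def)
  qed
  then show ?thesis
  proof (rule that)
    show "p (G (t, z)) = H (t, z)" if "t \<in> {0..1}" "z \<in> topspace Z" for t z
      using NF(4)[OF that(2,1) NF(2)] that by (simp add: G_def)
    show "G (0, z) = g z" if "z \<in> topspace Z" for z
      using NF(5)[OF that NF(2)] that by (simp add: G_def)
  qed
qed

section \<open>Spheres\<close>

lemma topspace_nsphere: "topspace (nsphere n) = {x. (\<Sum>i\<le>n. (x i)\<^sup>2) = 1 \<and> (\<forall>i>n. x i = 0)}"
  by (simp add: nsphere)

lemma Hausdorff_space_nsphere: "Hausdorff_space (nsphere n)"
  by (simp add: nsphere_def Hausdorff_Euclidean_space Hausdorff_space_subtopology)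

lemma metrizable_space_nsphere: "metrizable_space (nsphere n)"
  by (simp add: nsphere euclidean_product_topology metrizable_space_euclidean metrizable_space_subtopology)

lemma nsphere_coordinate_le_1:
  assumes "x \<in> topspace (nsphere n)"
  shows "\<bar>x i\<bar> \<le> 1"
proof (cases "i \<le> n")
  case True
  then have "(x i)\<^sup>2 \<le> (\<Sum>i\<le>n. (x i)\<^sup>2)"
    by (intro member_le_sum) auto
  then show ?thesis
    using assms by (simp add: topspace_nsphere abs_square_le_1)
qed (use assms in \<open>simp add: topspace_nsphere\<close>)

lemma compact_space_nsphere: "compact_space (nsphere n)"
proof -
  let ?X = "powertop_real UNIV"
  have c: "closedin ?X {x \<in> topspace ?X. (\<Sum>i\<le>n. (x i)\<^sup>2) \<in> {1}}"
    by (rule closedin_continuous_map_preimage[of _ euclideanreal])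
       (auto intro!: continuous_intros continuous_map_product_projection)
  have "closedin ?X ({x \<in> topspace ?X. (\<Sum>i\<le>n. (x i)\<^sup>2) \<in> {1}} \<inter> topspace (Euclidean_space (Suc n)))"
    by (intro closedin_Int c closedin_Euclidean_space)
  also have "({x \<in> topspace ?X. (\<Sum>i\<le>n. (x i)\<^sup>2) \<in> {1}} \<inter> topspace (Euclidean_space (Suc n))) = topspace (nsphere n)"
    by (auto simp: topspace_nsphere topspace_Euclidean_space)
  finally have cl: "closedin ?X (topspace (nsphere n))" .
  have "compactin ?X (PiE UNIV (\<lambda>_. {-1..1}))"
    by (simp add: compactin_PiE)
  moreover have "topspace (nsphere n) \<subseteq> PiE UNIV (\<lambda>_. {-1..1})"
  proof
    fix x assume "x \<in> topspace (nsphere n)"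
    then have "- 1 \<le> x i \<and> x i \<le> 1" for i using nsphere_coordinate_le_1[of x n i] by linarith
    then show "x \<in> PiE UNIV (\<lambda>_. {-1..1})" by (simp add: PiE_iff)
  qed
  ultimately have "compactin ?X (topspace (nsphere n))"
    using cl closed_compactin by blast
  then show ?thesis
    using compact_space_subtopology by (simp add: topspace_nsphere nsphere)
qed

text \<open>The sphere of dimension \<open>n+1\<close> as unreduced suspension: \<open>t = 0\<close>
  and \<open>t = 1\<close> collapse to the poles where coordinate \<open>Suc n\<close> is 1 and -1.
  A map on the larger sphere becomes a homotopy, which covering maps can lift.\<close>

definition suspension_map :: "nat \<Rightarrow> real \<times> (nat \<Rightarrow> real) \<Rightarrow> nat \<Rightarrow> real" where
  "suspension_map n = (\<lambda>(t, u) i. if i = Suc n then cos (pi * t) else sin (pi * t) * u i)"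

lemma continuous_suspension_map:
  "continuous_map (prod_topology (top_of_set {0..1}) (nsphere n)) (nsphere (Suc n)) (suspension_map n)"
proof -
  let ?P = "prod_topology (top_of_set {0..1::real}) (nsphere n)"
  have 1: "continuous_map ?P euclideanreal fst"
    by (rule continuous_map_into_fulltopology, rule continuous_map_fst)
  have 2: "continuous_map ?P euclideanreal (\<lambda>w. snd w i)" for i
    using continuous_map_compose[OF continuous_map_snd continuous_map_nsphere_projection] by (simp add: o_def)
  have "continuous_map ?P euclideanreal (\<lambda>w. suspension_map n w i)" for i
  proof -
    have c: "continuous_map ?P euclideanreal (\<lambda>w. cos (pi * fst w))" "continuous_map ?P euclideanreal (\<lambda>w. sin (pi * fst w))"
      using continuous_map_compose[OF 1, of euclideanreal "\<lambda>t. cos (pi * t)"]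
        continuous_map_compose[OF 1, of euclideanreal "\<lambda>t. sin (pi * t)"]
      by (simp_all add: o_def continuous_intros)
    show ?thesis
      using c 2 by (cases "i = Suc n") (auto simp: suspension_map_def case_prod_beta intro!: continuous_map_real_mult)
  qed
  moreover have "suspension_map n w \<in> topspace (nsphere (Suc n))" if "w \<in> topspace ?P" for w
  proof -
    obtain t u where w: "w = (t, u)" by fastforce
    have u: "(\<Sum>i\<le>n. (u i)\<^sup>2) = 1" "\<forall>i>n. u i = 0" using that w by (auto simp: topspace_nsphere)
    have "(\<Sum>i\<le>n. (suspension_map n w i)\<^sup>2) = (\<Sum>i\<le>n. (sin (pi * t))\<^sup>2 * (u i)\<^sup>2)"
      by (intro sum.cong) (auto simp: suspension_map_def w power_mult_distrib)
    also have "\<dots> = (sin (pi * t))\<^sup>2" using u by (simp flip: sum_distrib_left)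
    finally show ?thesis using u by (auto simp: topspace_nsphere suspension_map_def w)
  qed
  ultimately show ?thesis
    unfolding nsphere[of "Suc n"] continuous_map_in_subtopology continuous_map_componentwise_UNIV
    by (auto simp: topspace_nsphere)
qed

lemma suspension_map_surj:
  assumes "z \<in> topspace (nsphere (Suc n))"
  shows "\<exists>t\<in>{0..1}. \<exists>u\<in>topspace (nsphere n). suspension_map n (t, u) = z"
proof -
  define c where "c = z (Suc n)"
  have c: "-1 \<le> c" "c \<le> 1" using nsphere_coordinate_le_1[OF assms, of "Suc n"] by (auto simp: c_def)
  define t where "t = arccos c / pi"
  have t: "t \<in> {0..1}" using c arccos_bounded[of c] by (auto simp: t_def)
  have ct: "cos (pi * t) = c" "sin (pi * t) = sqrt (1 - c\<^sup>2)"
    using c by (auto simp: t_def sin_arccos_abs)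
  have sz: "(\<Sum>i\<le>n. (z i)\<^sup>2) = 1 - c\<^sup>2" "\<And>i. i > Suc n \<Longrightarrow> z i = 0"
    using assms by (auto simp: topspace_nsphere c_def)
  show ?thesis
  proof (cases "sqrt (1 - c\<^sup>2) = 0")
    \<comment> \<open>At a pole the factor \<open>sin (pi * t)\<close> vanishes, so any direction
      \<open>u\<close> will do; \<open>sphere_base\<close> is taken.\<close>
    case True
    then have "z i = 0" if "i \<noteq> Suc n" for i
    proof (cases "i \<le> n")
      case True
      have "(\<Sum>i\<le>n. (z i)\<^sup>2) = 0" using sz \<open>sqrt (1 - c\<^sup>2) = 0\<close> by simp
      then show ?thesis using True by (simp add: sum_nonneg_eq_0_iff)
    qed (use sz that in auto)
    then have "suspension_map n (t, sphere_base) = z"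
      using True ct by (auto simp: suspension_map_def c_def fun_eq_iff)
    moreover have "sphere_base \<in> topspace (nsphere n)"
      using in_topspace_nsphere by (simp add: sphere_base_def)
    ultimately show ?thesis using t by blast
  next
    case False
    define s where "s = sqrt (1 - c\<^sup>2)"
    have s: "s \<noteq> 0" "s\<^sup>2 = 1 - c\<^sup>2" using False c by (auto simp: s_def abs_square_le_1)
    define u where "u i = (if i \<le> n then z i / s else 0)" for i
    have "(\<Sum>i\<le>n. (u i)\<^sup>2) = (\<Sum>i\<le>n. (z i)\<^sup>2) / s\<^sup>2"
      by (simp add: u_def power_divide sum_divide_distrib)
    then have "u \<in> topspace (nsphere n)"
      using sz s by (auto simp: topspace_nsphere u_def)
    moreover have "suspension_map n (t, u) = z"
    proof
      fix i show "suspension_map n (t, u) i = z i"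
        using ct s sz(2)[of i] by (cases "i = Suc n"; cases "i \<le> n") (auto simp: suspension_map_def u_def s_def c_def)
    qed
    ultimately show ?thesis using t by blast
  qed
qed

lemma quotient_map_suspension_map:
  "quotient_map (prod_topology (top_of_set {0..1}) (nsphere n)) (nsphere (Suc n)) (suspension_map n)"
proof (rule continuous_imp_quotient_map[OF continuous_suspension_map])
  show "compact_space (prod_topology (top_of_set {0..1::real}) (nsphere n))"
    by (simp add: compact_space_prod_topology compact_space_nsphere compact_space_subtopology)
  show "suspension_map n ` topspace (prod_topology (top_of_set {0..1}) (nsphere n)) = topspace (nsphere (Suc n))"
    using suspension_map_surj[of _ n] continuous_suspension_map[of n]
    by (force simp: continuous_map_def image_iff Bex_def)
qed (rule Hausdorff_space_nsphere)

text \<open>The circle is the image of the real line; every further sphere is an image of the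
  connected product of an interval with the sphere below it.\<close>

lemma connected_space_nsphere: "connected_space (nsphere (Suc n))"
proof (induction n)
  case 0
  define f :: "real \<Rightarrow> nat \<Rightarrow> real" where "f t i = (if i = 0 then cos t else if i = 1 then sin t else 0)" for t i
  have "continuous_map euclideanreal (powertop_real UNIV) f"
    unfolding continuous_map_componentwise_UNIV
  proof
    fix k show "continuous_map euclideanreal euclideanreal (\<lambda>x. f x k)"
      by (cases "k = 0"; cases "k = 1") (auto simp: f_def[abs_def] intro!: continuous_intros)
  qed
  then have c: "continuous_map euclideanreal (nsphere 1) f"
    by (auto simp: nsphere continuous_map_in_subtopology f_def)
  have "connectedin (nsphere 1) (f ` UNIV)"
    using connectedin_continuous_map_image[OF c, of UNIV] by simp
  moreover have "f ` UNIV = topspace (nsphere 1)"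
  proof
    show "f ` UNIV \<subseteq> topspace (nsphere 1)" using c by (auto simp: continuous_map_def)
    show "topspace (nsphere 1) \<subseteq> f ` UNIV"
    proof
      fix z assume "z \<in> topspace (nsphere 1)"
      then have z: "(z 0)\<^sup>2 + (z 1)\<^sup>2 = 1" "\<And>i. i > 1 \<Longrightarrow> z i = 0" by (auto simp: topspace_nsphere)
      then obtain t where "z 0 = cos t" "z 1 = sin t" using sincos_total_2pi by metis
      then have "z = f t" using z(2) by (auto simp: f_def fun_eq_iff)
      then show "z \<in> f ` UNIV" by blast
    qed
  qed
  ultimately show ?case
    by (simp add: connectedin_topspace)
next
  case (Suc n)
  have "connected_space (prod_topology (top_of_set {0..1::real}) (nsphere (Suc n)))"
    using Suc by (simp add: connected_space_prod_topology connected_space_subtopology)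
  then show ?case
    using quotient_map_suspension_map connected_space_quotient_map_image by blast
qed

text \<open>Lift the homotopy given by the suspension, starting constantly at \<open>e\<close>. Its
  other end maps the sphere of dimension \<open>n - 1\<close> into one fibre; that sphere is
  connected because \<open>n \<ge> 2\<close>, so the end is constant and the lift descends to the
  quotient. The prescribed point is the pole \<open>t = 0\<close>.\<close>

lemma cover_map_lift_nsphere:
  assumes p: "cover_map E X p" and n: "n \<ge> 2" and f: "continuous_map (nsphere n) X f"
    and e: "e \<in> topspace E" "p e = f (\<lambda>i. if i = n then 1 else 0)"
  obtains g where "continuous_map (nsphere n) E g" "\<And>z. z \<in> topspace (nsphere n) \<Longrightarrow> p (g z) = f z"
    "g (\<lambda>i. if i = n then 1 else 0) = e"
proof -
  obtain k where nk: "n = Suc (Suc k)" using n by (intro that[of "n - 2"]) simp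
  define l where "l = Suc k"
  let ?P = "prod_topology (top_of_set {0..1::real}) (nsphere l)"
  let ?q = "suspension_map l"
  have q: "quotient_map ?P (nsphere n) ?q"
    using quotient_map_suspension_map[of l] by (simp add: nk l_def)
  have H: "continuous_map ?P X (f \<circ> ?q)"
    using continuous_map_compose[OF quotient_imp_continuous_map[OF q] f] .
  have q0: "?q (0, z) = (\<lambda>i. if i = n then 1 else 0)" and q1: "?q (1, z) = (\<lambda>i. if i = n then -1 else 0)" for z
    by (auto simp: suspension_map_def nk l_def fun_eq_iff)
  obtain G where G: "continuous_map ?P E G"
    "\<And>t z. t \<in> {0..1} \<Longrightarrow> z \<in> topspace (nsphere l) \<Longrightarrow> p (G (t, z)) = f (?q (t, z))"
    "\<And>z. z \<in> topspace (nsphere l) \<Longrightarrow> G (0, z) = e"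
    using cover_map_lift_homotopy[OF p H, of "\<lambda>_. e"] e q0 by auto
  define u0 :: "nat \<Rightarrow> real" where "u0 = sphere_base"
  have u0: "u0 \<in> topspace (nsphere l)"
    using in_topspace_nsphere by (simp add: sphere_base_def u0_def)
  have G1: "G (1, z) = G (1, u0)" if z: "z \<in> topspace (nsphere l)" for z
  proof (rule cover_map_lift_unique[OF p, of "nsphere l" "\<lambda>z. G (1, z)" "\<lambda>z. G (1, u0)" u0])
    show "connected_space (nsphere l)" using connected_space_nsphere by (simp add: l_def)
    have "continuous_map (nsphere l) ?P (\<lambda>z. (1, z))" by (simp add: continuous_map_pairwise o_def)
    from continuous_map_compose[OF this G(1)] show "continuous_map (nsphere l) E (\<lambda>z. G (1, z))" by (simp add: o_def)
    then show "continuous_map (nsphere l) E (\<lambda>z. G (1, u0))"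
      using u0 by (auto simp: continuous_map_def)
    show "p (G (1, z)) = p (G (1, u0))" if "z \<in> topspace (nsphere l)" for z
      using G(2)[of 1 z] G(2)[of 1 u0] that u0 by (simp add: q1)
  qed (use u0 z in auto)
  \<comment> \<open>Equal images force equal heights and, away from the poles, equal directions; at
    the poles \<open>G\<close> does not depend on the direction.\<close>
  have inj: "G w = G w'" if w: "w \<in> topspace ?P" "w' \<in> topspace ?P" "?q w = ?q w'" for w w'
  proof -
    obtain t u t' u' where [simp]: "w = (t, u)" "w' = (t', u')" by fastforce
    have tu: "t \<in> {0..1}" "t' \<in> {0..1}" "u \<in> topspace (nsphere l)" "u' \<in> topspace (nsphere l)" using w by auto
    have "?q w (Suc l) = ?q w' (Suc l)" using w by simp
    then have "cos (pi * t) = cos (pi * t')" by (simp add: suspension_map_def)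
    then have t: "t = t'"
      using tu cos_inj_pi[of "pi * t" "pi * t'"] by simp
    show ?thesis
    proof (cases "t = 0 \<or> t = 1")
      case True
      then show ?thesis using t tu G(3) G1 by auto
    next
      case False
      then have "sin (pi * t) \<noteq> 0"
        using tu sin_gt_zero[of "pi * t"] by auto
      moreover have "sin (pi * t) * u i = sin (pi * t) * u' i" if "i \<noteq> Suc l" for i
        using fun_cong[OF w(3), of i] that t by (simp add: suspension_map_def)
      moreover have "u (Suc l) = u' (Suc l)" using tu by (simp add: topspace_nsphere)
      ultimately have "u = u'" by (metis ext mult_cancel_left)
      then show ?thesis using t by simp
    qed
  qed
  obtain g where g: "continuous_map (nsphere n) E g" "\<And>w. w \<in> topspace ?P \<Longrightarrow> g (?q w) = G w"
    using quotient_map_lift_exists[OF q G(1)] inj by (metis (no_types, lifting))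
  show ?thesis
  proof (rule that[OF g(1)])
    fix z assume "z \<in> topspace (nsphere n)"
    then obtain w where "w \<in> topspace ?P" "z = ?q w"
      using q by (metis (no_types, lifting) image_iff quotient_map_def)
    then show "p (g z) = f z"
      using g(2) G(2) by (cases w) auto
  next
    show "g (\<lambda>i. if i = n then 1 else 0) = e"
      using g(2)[of "(0, u0)"] G(3)[OF u0] u0 by (simp add: q0)
  qed
qed

section \<open>Right-angled Coxeter groups\<close>

locale racg =
  fixes S :: "'s set" and comm :: "'s \<Rightarrow> 's \<Rightarrow> bool"
  assumes finS: "finite S" and comm_sym: "comm s t \<Longrightarrow> comm t s" and comm_irrefl: "\<not> comm s s"
begin

text \<open>A word up to commutations is determined by its restrictions to the pairs of non-commuting
  letters. Elements of the group are represented by these restrictions for reduced words, and a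
  generator acts from the right by cancelling or appending a letter.\<close>

definition word_fam :: "'s list \<Rightarrow> 's \<Rightarrow> 's \<Rightarrow> 's list" where
  "word_fam w = (\<lambda>s t. if comm s t then [] else filter (\<lambda>a. a = s \<or> a = t) w)"

text \<open>Excludes exactly the words in which two equal letters could be moved together by
  commutations and cancelled.\<close>

definition reduced :: "'s list \<Rightarrow> bool" where
  "reduced w \<longleftrightarrow> (\<forall>s a b c. w = a @ s # b @ s # c \<longrightarrow> (\<exists>t\<in>set b. \<not> comm s t))"

definition W :: "('s \<Rightarrow> 's \<Rightarrow> 's list) set" where
  "W = word_fam ` {w. reduced w \<and> set w \<subseteq> S}"

text \<open>Says that some \<open>s\<close> can be commuted to the end of the word. The case
  \<open>t = s\<close> is included since \<open>comm\<close> is irreflexive, and it forces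
  \<open>s\<close> to occur.\<close>

definition descent :: "'s \<Rightarrow> ('s \<Rightarrow> 's \<Rightarrow> 's list) \<Rightarrow> bool" where
  "descent s F \<longleftrightarrow> (\<forall>t. \<not> comm s t \<longrightarrow> F s t \<noteq> [] \<and> last (F s t) = s)"

definition act :: "'s \<Rightarrow> ('s \<Rightarrow> 's \<Rightarrow> 's list) \<Rightarrow> 's \<Rightarrow> 's \<Rightarrow> 's list" where
  "act s F = (\<lambda>a b. if \<not> comm a b \<and> (a = s \<or> b = s)
     then if descent s F then butlast (F a b) else F a b @ [s] else F a b)"

text \<open>The diagonal entry \<open>F s s\<close> is a power of \<open>s\<close>, so its length
  counts the occurrences of \<open>s\<close>.\<close>

definition len :: "('s \<Rightarrow> 's \<Rightarrow> 's list) \<Rightarrow> nat" where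
  "len F = (\<Sum>s\<in>S. length (F s s))"

text \<open>A homomorphism to Z/2 for each colour. With the coordinate of a facet as its colour it
  will give the sign of the second coordinate of a chain.\<close>

definition parity :: "('s \<Rightarrow> 'c) \<Rightarrow> 'c \<Rightarrow> ('s \<Rightarrow> 's \<Rightarrow> 's list) \<Rightarrow> bool" where
  "parity col c F \<longleftrightarrow> odd (\<Sum>s\<in>{s\<in>S. col s = c}. length (F s s))"

lemma word_fam_sym: "word_fam w s t = word_fam w t s"
proof -
  have "comm s t \<longleftrightarrow> comm t s" using comm_sym by blast
  then show ?thesis by (simp add: word_fam_def disj_commute)
qed

lemma W_sym: "F \<in> W \<Longrightarrow> F s t = F t s"
  unfolding W_def by (elim imageE) (simp add: word_fam_sym[of _ s t])

text \<open>Take the last \<open>s\<close> of \<open>w\<close>. A later letter \<open>t\<close> that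
  does not commute with \<open>s\<close> would make the restriction to \<open>s\<close> and
  \<open>t\<close> end in \<open>t\<close>.\<close>

lemma descent_word_fam:
  "descent s (word_fam w) \<longleftrightarrow> (\<exists>a b. w = a @ s # b \<and> (\<forall>t\<in>set b. comm s t))"
proof
  assume d: "descent s (word_fam w)"
  have "word_fam w s s \<noteq> []"
    using d comm_irrefl unfolding descent_def by blast
  then have "filter (\<lambda>a. a = s \<or> a = s) w \<noteq> []"
    using comm_irrefl by (simp add: word_fam_def)
  then have "s \<in> set w" by (auto simp: filter_empty_conv)
  then obtain a b where ab: "w = a @ s # b" "s \<notin> set b"
    by (metis split_list_last)
  have "comm s t" if "t \<in> set b" for t
  proof (rule ccontr)
    assume n: "\<not> comm s t"
    then have l: "last (filter (\<lambda>a. a = s \<or> a = t) w) = s"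
      using d by (auto simp: descent_def word_fam_def)
    have "filter (\<lambda>a. a = s \<or> a = t) b \<noteq> []" using that by (auto simp: filter_empty_conv)
    then have "last (filter (\<lambda>a. a = s \<or> a = t) w) \<in> set (filter (\<lambda>a. a = s \<or> a = t) b)"
      using ab last_in_set by (metis (no_types, lifting) filter_append filter.simps(2) last_ConsR last_appendR list.distinct(1))
    then show False using l ab by auto
  qed
  then show "\<exists>a b. w = a @ s # b \<and> (\<forall>t\<in>set b. comm s t)" using ab by blast
next
  assume "\<exists>a b. w = a @ s # b \<and> (\<forall>t\<in>set b. comm s t)"
  then obtain a b where ab: "w = a @ s # b" "\<forall>t\<in>set b. comm s t" by blast
  show "descent s (word_fam w)"
    unfolding descent_def
  proof (intro allI impI)
    fix t assume t: "\<not> comm s t"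
    then have "filter (\<lambda>a. a = s \<or> a = t) b = []"
      using ab comm_irrefl by (auto simp: filter_empty_conv)
    then show "word_fam w s t \<noteq> [] \<and> last (word_fam w s t) = s"
      using t ab by (simp add: word_fam_def)
  qed
qed

lemma act_descent:
  assumes "\<forall>t\<in>set b. comm s t"
  shows "act s (word_fam (a @ s # b)) = word_fam (a @ b)"
proof (intro ext)
  fix x y
  have d: "descent s (word_fam (a @ s # b))" using assms descent_word_fam by blast
  show "act s (word_fam (a @ s # b)) x y = word_fam (a @ b) x y"
  proof (cases "\<not> comm x y \<and> (x = s \<or> y = s)")
    case True
    then have "filter (\<lambda>a. a = x \<or> a = y) b = []"
      using assms comm_irrefl comm_sym by (auto simp: filter_empty_conv)
    then show ?thesis using True d by (auto simp: act_def word_fam_def butlast_append)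
  next
    case False
    then show ?thesis using d by (auto simp: act_def word_fam_def)
  qed
qed

lemma act_ascent:
  assumes "\<not> descent s (word_fam w)"
  shows "act s (word_fam w) = word_fam (w @ [s])"
  using assms by (auto simp: act_def word_fam_def fun_eq_iff)

text \<open>A cancelling pair of \<open>a @ b\<close> that straddles the gap stays cancelling when
  \<open>s\<close> is put back, because \<open>s\<close> commutes with the letters of
  \<open>b\<close>. A second movable \<open>s\<close> would cancel against the deleted one.\<close>

lemma reduced_delete:
  assumes r: "reduced (a @ s # b)" and b: "\<forall>t\<in>set b. comm s t"
  shows "reduced (a @ b)" "\<not> descent s (word_fam (a @ b))"
proof -
  show "reduced (a @ b)"
    unfolding reduced_def
  proof (intro allI impI)
    fix t a' c d assume e: "a @ b = a' @ t # c @ t # d"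
    from e consider u where "a = a' @ t # c @ t # u" "d = u @ b" | u v where "a = a' @ t # u" "c = u @ v" "b = v @ t # d"
       | u where "a' = a @ u" "b = u @ t # c @ t # d"
      by (auto simp: append_eq_append_conv2 append_eq_Cons_conv Cons_eq_append_conv)
    then show "\<exists>s\<in>set c. \<not> comm t s"
    proof cases
      case 1
      then have "a @ s # b = a' @ t # c @ t # (u @ s # b)" by simp
      then show ?thesis using r unfolding reduced_def by blast
    next
      case 2
      then have "a @ s # b = a' @ t # (u @ s # v) @ t # d" by simp
      then have "\<exists>x\<in>set (u @ s # v). \<not> comm t x" using r unfolding reduced_def by blast
      moreover have "comm t s" using b 2 comm_sym by auto
      ultimately show ?thesis using 2 by auto
    next
      case 3
      then have "a @ s # b = (a @ s # u) @ t # c @ t # d" by simp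
      then show ?thesis using r unfolding reduced_def by blast
    qed
  qed
  show "\<not> descent s (word_fam (a @ b))"
    unfolding descent_word_fam
  proof
    assume "\<exists>a' c. a @ b = a' @ s # c \<and> (\<forall>t\<in>set c. comm s t)"
    then obtain a' c where e: "a @ b = a' @ s # c" "\<forall>t\<in>set c. comm s t" by blast
    have "s \<notin> set b" using b comm_irrefl by blast
    with e obtain u where "a = a' @ s # u" "c = u @ b"
      by (auto simp: append_eq_append_conv2 append_eq_Cons_conv Cons_eq_append_conv)
    then have "a @ s # b = a' @ s # u @ s # b" by simp
    then have "\<exists>t\<in>set u. \<not> comm s t" using r unfolding reduced_def by blast
    then show False using e \<open>c = u @ b\<close> by auto
  qed
qed

lemma reduced_snoc:
  assumes "reduced w" "\<not> descent s (word_fam w)"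
  shows "reduced (w @ [s])"
  unfolding reduced_def
proof (intro allI impI)
  fix t a b c assume e: "w @ [s] = a @ t # b @ t # c"
  show "\<exists>x\<in>set b. \<not> comm t x"
  proof (cases c rule: rev_cases)
    case Nil
    then have "w = a @ t # b" "t = s" using e by auto
    then show ?thesis using assms(2) descent_word_fam by blast
  next
    case (snoc d x)
    then have "w = a @ t # b @ t # d" using e by auto
    then show ?thesis using assms(1) unfolding reduced_def by blast
  qed
qed

text \<open>Deleting a movable \<open>s\<close> and appending it again yields a word that differs
  from \<open>w\<close> only by commutations, hence has the same restrictions; in the opposite order
  the appended \<open>s\<close> is the one deleted.\<close>

lemma act_closed_invol:
  assumes F: "F \<in> W" and s: "s \<in> S"
  shows "act s F \<in> W" "act s (act s F) = F" "descent s (act s F) \<longleftrightarrow> \<not> descent s F"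
proof -
  obtain w where w: "F = word_fam w" "reduced w" "set w \<subseteq> S" using F by (auto simp: W_def)
  have "act s F \<in> W \<and> act s (act s F) = F \<and> (descent s (act s F) \<longleftrightarrow> \<not> descent s F)"
  proof (cases "descent s F")
    case True
    then obtain a b where ab: "w = a @ s # b" "\<forall>t\<in>set b. comm s t"
      using w descent_word_fam by blast
    have 1: "act s F = word_fam (a @ b)" using act_descent ab w by simp
    have r: "reduced (a @ b)" "\<not> descent s (word_fam (a @ b))" using reduced_delete ab w by auto
    have "word_fam (a @ b @ [s]) = word_fam (a @ s # b)"
    proof (intro ext)
      fix x y
      show "word_fam (a @ b @ [s]) x y = word_fam (a @ s # b) x y"
      proof (cases "\<not> comm x y \<and> (x = s \<or> y = s)")
        case True
        then have "filter (\<lambda>a. a = x \<or> a = y) b = []"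
          using ab comm_irrefl comm_sym by (auto simp: filter_empty_conv)
        then show ?thesis using True by (auto simp: word_fam_def)
      qed (auto simp: word_fam_def)
    qed
    then have "act s (act s F) = F" using 1 r act_ascent w ab by simp
    moreover have "act s F \<in> W" unfolding 1 W_def using r w ab by auto
    ultimately show ?thesis using r 1 True by simp
  next
    case False
    then have 1: "act s F = word_fam (w @ [s])" using act_ascent w by simp
    moreover have "reduced (w @ [s])" using reduced_snoc False w by simp
    ultimately have "act s F \<in> W" using w s unfolding W_def by auto
    moreover have "act s (act s F) = F" using 1 act_descent[of "[]" s w] w by simp
    moreover have "descent s (act s F)" unfolding 1 descent_word_fam by force
    ultimately show ?thesis using False by simp
  qed
  then show "act s F \<in> W" "act s (act s F) = F" "descent s (act s F) \<longleftrightarrow> \<not> descent s F" by auto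
qed

lemma descent_act_comm: "comm s t \<Longrightarrow> descent s (act t F) \<longleftrightarrow> descent s F"
  using comm_irrefl comm_sym unfolding descent_def act_def by (intro all_cong) (auto)

lemma act_comm: "comm s t \<Longrightarrow> act s (act t F) = act t (act s F)"
proof -
  assume c: "comm s t"
  have d: "descent s (act t F) \<longleftrightarrow> descent s F" "descent t (act s F) \<longleftrightarrow> descent t F"
    using c comm_sym descent_act_comm by auto
  have "s \<noteq> t" using c comm_irrefl by auto
  show ?thesis
    using c comm_sym[OF c] \<open>s \<noteq> t\<close> by (subst (1 3) act_def, simp only: d, auto simp: act_def fun_eq_iff)
qed

lemma length_act_diag:
  shows "length (act s F t t) = (if t = s then if descent s F then length (F s s) - 1 else length (F s s) + 1 else length (F t t))"
    and "descent s F \<Longrightarrow> length (F s s) > 0"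
  using comm_irrefl by (auto simp: act_def descent_def)

lemma len_act:
  assumes F: "F \<in> W" and s: "s \<in> S"
  shows "len (act s F) = (if descent s F then len F - 1 else len F + 1)" "descent s F \<Longrightarrow> len F > 0"
proof -
  have 1: "len F' = length (F' s s) + (\<Sum>t\<in>S-{s}. length (F' t t))" for F'
    unfolding len_def using finS s by (simp add: sum.remove)
  have 2: "(\<Sum>t\<in>S-{s}. length (act s F t t)) = (\<Sum>t\<in>S-{s}. length (F t t))"
    by (intro sum.cong) (auto simp: length_act_diag)
  show "len (act s F) = (if descent s F then len F - 1 else len F + 1)" "descent s F \<Longrightarrow> len F > 0"
    using length_act_diag(1)[of s F s] length_act_diag(2)[of s F] 2 1[of F] 1[of "act s F"]
    by (auto split: if_splits simp: neq_Nil_conv)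
qed

lemma parity_act:
  assumes F: "F \<in> W" and s: "s \<in> S"
  shows "parity col c (act s F) \<longleftrightarrow> (parity col c F \<noteq> (col s = c))"
proof (cases "col s = c")
  case True
  let ?A = "{t\<in>S. col t = c}"
  have fin: "finite ?A" "s \<in> ?A" using finS s True by auto
  have 1: "(\<Sum>t\<in>?A. length (F' t t)) = length (F' s s) + (\<Sum>t\<in>?A-{s}. length (F' t t))" for F' :: "'s \<Rightarrow> 's \<Rightarrow> 's list"
    using fin by (simp add: sum.remove)
  have 2: "(\<Sum>t\<in>?A-{s}. length (act s F t t)) = (\<Sum>t\<in>?A-{s}. length (F t t))"
    by (intro sum.cong) (auto simp: length_act_diag)
  show ?thesis
    unfolding parity_def 1[of F] 1[of "act s F"] 2
    using True length_act_diag(1)[of s F s] length_act_diag(2)[of s F] by auto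
next
  case False
  have "(\<Sum>t\<in>{t\<in>S. col t = c}. length (act s F t t)) = (\<Sum>t\<in>{t\<in>S. col t = c}. length (F t t))"
    using False by (intro sum.cong) (auto simp: length_act_diag)
  then show ?thesis using False by (simp add: parity_def)
qed

text \<open>Otherwise \<open>F s t\<close> would be a word ending both in \<open>s\<close> and in
  \<open>t\<close>. This makes the set of descents of an element spherical.\<close>

lemma descents_comm:
  assumes F: "F \<in> W" and "descent s F" "descent t F" "s \<noteq> t"
  shows "comm s t"
proof (rule ccontr)
  assume n: "\<not> comm s t"
  then have "\<not> comm t s" using comm_sym by blast
  then show False using assms n W_sym[OF F, of s t] unfolding descent_def by metis
qed

definition unit :: "'s \<Rightarrow> 's \<Rightarrow> 's list" where "unit = word_fam []"

lemma unit_in_W: "unit \<in> W"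
  by (auto simp: W_def unit_def reduced_def)

lemma parity_unit [simp]: "\<not> parity col c unit"
  using comm_irrefl by (simp add: parity_def unit_def word_fam_def)

lemma exists_descent:
  assumes "F \<in> W" "F \<noteq> unit"
  shows "\<exists>s\<in>S. descent s F"
proof -
  obtain w where w: "F = word_fam w" "set w \<subseteq> S" using assms by (auto simp: W_def)
  then have "w \<noteq> []" using assms by (auto simp: unit_def)
  then obtain v s where "w = v @ [s]" by (metis rev_exhaust)
  then show ?thesis using w descent_word_fam[of s w] by force
qed

lemma len_word_fam: "set w \<subseteq> S \<Longrightarrow> len (word_fam w) = length w"
proof -
  assume "set w \<subseteq> S"
  have "len (word_fam w) = (\<Sum>s\<in>S. count_list w s)"
    using comm_irrefl by (simp add: len_def word_fam_def count_list_eq_length_filter eq_commute)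
  also have "\<dots> = length w"
    using \<open>set w \<subseteq> S\<close> finS by (simp add: sum_count_set)
  finally show ?thesis .
qed

lemma finite_len: "finite {F\<in>W. len F \<le> N}"
proof -
  have "{F\<in>W. len F \<le> N} \<subseteq> word_fam ` {w. set w \<subseteq> S \<and> length w \<le> N}"
    by (auto simp: W_def len_word_fam)
  then show ?thesis
    using finite_lists_length_le[OF finS] finite_subset by blast
qed

section \<open>Special subgroups generated by commuting generators, and their cosets\<close>

definition spherical :: "'s set \<Rightarrow> bool" where
  "spherical T \<longleftrightarrow> T \<subseteq> S \<and> pairwise comm T"

text \<open>Right multiplication by the product of the generators in \<open>A\<close>; the order of
  the fold is immaterial when \<open>A\<close> is spherical.\<close>

definition aset :: "'s set \<Rightarrow> ('s \<Rightarrow> 's \<Rightarrow> 's list) \<Rightarrow> 's \<Rightarrow> 's \<Rightarrow> 's list" where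
  "aset A F = Finite_Set.fold act F A"

definition coset :: "('s \<Rightarrow> 's \<Rightarrow> 's list) \<Rightarrow> 's set \<Rightarrow> ('s \<Rightarrow> 's \<Rightarrow> 's list) set" where
  "coset F T = {aset A F |A. A \<subseteq> T}"

lemma spherical_finite: "spherical T \<Longrightarrow> finite T"
  using finS finite_subset by (auto simp: spherical_def)

lemma spherical_subset: "spherical T \<Longrightarrow> A \<subseteq> T \<Longrightarrow> spherical A"
  by (auto simp: spherical_def pairwise_def)

lemma comp_fun_commute_act: "spherical T \<Longrightarrow> comp_fun_commute_on T act"
proof
  fix s t assume "spherical T" "s \<in> T" "t \<in> T"
  then show "act t \<circ> act s = act s \<circ> act t"
    using act_comm by (cases "s = t") (auto simp: spherical_def pairwise_def fun_eq_iff)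
qed

lemma aset_empty [simp]: "aset {} F = F"
  by (simp add: aset_def)

lemma aset_insert:
  assumes "spherical (insert s A)" "s \<notin> A"
  shows "aset (insert s A) F = act s (aset A F)"
proof -
  have "finite A" using spherical_finite[OF assms(1)] by simp
  then show ?thesis
    unfolding aset_def using comp_fun_commute_on.fold_insert[OF comp_fun_commute_act[OF assms(1)] subset_refl] assms(2)
    by simp
qed

lemma aset_in_W: "spherical A \<Longrightarrow> F \<in> W \<Longrightarrow> aset A F \<in> W"
proof -
  assume A: "spherical A" and F: "F \<in> W"
  from spherical_finite[OF A] A show ?thesis
  proof (induction A)
    case (insert s A)
    have "spherical A" by (rule spherical_subset[OF insert(4) subset_insertI])
    then have "aset A F \<in> W" by (rule insert(3))
    moreover have "s \<in> S" using insert by (simp add: spherical_def)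
    ultimately show ?case using insert act_closed_invol(1) aset_insert by auto
  qed (use F in simp)
qed

lemma act_aset:
  assumes "spherical T" "A \<subseteq> T" "s \<in> T" "F \<in> W"
  shows "act s (aset A F) = aset (if s \<in> A then A - {s} else insert s A) F"
proof (cases "s \<in> A")
  case True
  then have e: "insert s (A - {s}) = A" by auto
  have sA: "spherical A" "spherical (A - {s})" using assms(1,2) by (auto simp: spherical_def pairwise_def)
  have "aset A F = act s (aset (A - {s}) F)"
    using aset_insert[of s "A - {s}" F] sA e by simp
  moreover have "s \<in> S" using assms by (auto simp: spherical_def)
  ultimately show ?thesis
    using act_closed_invol(2)[OF aset_in_W[OF sA(2) assms(4)]] True by simp
next
  case False
  then show ?thesis using aset_insert[of s A F] assms spherical_subset[OF assms(1), of "insert s A"] by simp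
qed

text \<open>Commuting involutions act through an elementary abelian 2-group, whose product is the
  symmetric difference of subsets of \<open>T\<close>.\<close>

lemma aset_aset:
  assumes T: "spherical T" "A \<subseteq> T" "B \<subseteq> T" and F: "F \<in> W"
  shows "aset B (aset A F) = aset ((A - B) \<union> (B - A)) F"
proof -
  have "finite B" by (rule spherical_finite[OF spherical_subset[OF T(1,3)]])
  then show ?thesis using T(3)
  proof (induction B)
    case (insert s B)
    have sp: "spherical (insert s B)" by (rule spherical_subset[OF T(1) insert(4)])
    have "aset (insert s B) (aset A F) = act s (aset ((A - B) \<union> (B - A)) F)"
      using aset_insert[OF sp insert(2)] insert by simp
    also have "\<dots> = aset (if s \<in> (A - B) \<union> (B - A) then (A - B) \<union> (B - A) - {s} else insert s ((A - B) \<union> (B - A))) F"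
      by (rule act_aset[OF T(1)]) (use T insert F in auto)
    also have "(if s \<in> (A - B) \<union> (B - A) then (A - B) \<union> (B - A) - {s} else insert s ((A - B) \<union> (B - A)))
       = (A - insert s B) \<union> (insert s B - A)"
      using insert by auto
    finally show ?case .
  qed simp
qed

lemma coset_self: "F \<in> coset F T"
  by (auto simp: coset_def intro!: exI[of _ "{}"])

lemma coset_in_W: "spherical T \<Longrightarrow> F \<in> W \<Longrightarrow> coset F T \<subseteq> W"
  unfolding coset_def by (auto intro!: aset_in_W elim: spherical_subset)

lemma finite_coset: "spherical T \<Longrightarrow> finite (coset F T)"
proof -
  assume "spherical T"
  have "coset F T = (\<lambda>A. aset A F) ` Pow T" by (auto simp: coset_def)
  then show ?thesis using spherical_finite[OF \<open>spherical T\<close>] by simp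
qed

lemma coset_eq:
  assumes T: "spherical T" and F: "F \<in> W" and G: "G \<in> coset F T"
  shows "coset G T = coset F T"
proof -
  obtain A where A: "A \<subseteq> T" "G = aset A F" using G by (auto simp: coset_def)
  have "aset B G \<in> coset F T" if "B \<subseteq> T" for B
  proof -
    have "(A - B) \<union> (B - A) \<subseteq> T" using A that by blast
    then show ?thesis using aset_aset[OF T A(1) that F] A by (auto simp: coset_def)
  qed
  moreover have "aset B F \<in> coset G T" if "B \<subseteq> T" for B
  proof -
    let ?C = "(A - B) \<union> (B - A)"
    have C: "?C \<subseteq> T" using A that by blast
    have e: "(A - ?C) \<union> (?C - A) = B" by blast
    have "aset ?C G = aset B F" unfolding A(2) aset_aset[OF T A(1) C F] e ..
    then show ?thesis using C unfolding coset_def by (metis (mono_tags, lifting) mem_Collect_eq)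
  qed
  ultimately show ?thesis by (auto simp: coset_def)
qed

lemma coset_mono: "T \<subseteq> T' \<Longrightarrow> coset F T \<subseteq> coset F T'"
  by (auto simp: coset_def)

text \<open>Injectivity of \<open>col\<close> on \<open>A\<close> means that each colour is toggled
  at most once.\<close>

lemma parity_aset:
  assumes "spherical A" "inj_on col A" "F \<in> W"
  shows "parity col c (aset A F) \<longleftrightarrow> (parity col c F \<noteq> (c \<in> col ` A))"
  using spherical_finite[OF assms(1)] assms
proof (induction A)
  case (insert s A)
  have sp: "spherical A" "s \<in> S" "inj_on col A" using insert(4,5) by (auto simp: spherical_def pairwise_insert)
  have "col s \<notin> col ` A" using insert(2,5) by (auto simp: inj_on_def)
  then show ?case
    using parity_act[OF aset_in_W[OF sp(1) \<open>F \<in> W\<close>] sp(2), of col c] insert(3)[OF sp(1,3) \<open>F \<in> W\<close>]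
      aset_insert[OF \<open>spherical (insert s A)\<close> insert(2), of F]
    by auto
qed simp

lemma descent_aset:
  assumes "spherical (insert s A)" "s \<notin> A"
  shows "descent s (aset A F) \<longleftrightarrow> descent s F"
  using spherical_finite[OF assms(1)[THEN spherical_subset, of A, OF subset_insertI]] assms
proof (induction A)
  case (insert t A)
  have "spherical (insert s A)" "spherical (insert t A)" using insert(4) by (auto simp: spherical_def pairwise_def)
  moreover have "comm s t" using insert by (auto simp: spherical_def pairwise_def)
  ultimately show ?case
    using insert aset_insert[of t A F] descent_act_comm by auto
qed simp

lemma len_aset:
  assumes "spherical A" "F \<in> W" "\<And>s. s \<in> A \<Longrightarrow> \<not> descent s F"
  shows "len (aset A F) = len F + card A"
  using spherical_finite[OF assms(1)] assms
proof (induction A)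
  case (insert s A)
  have sp: "spherical A" "s \<in> S" using insert(4) by (auto simp: spherical_def pairwise_insert)
  have "\<not> descent s (aset A F)" using descent_aset insert by auto
  then show ?case
    using len_act(1)[OF aset_in_W[OF sp(1) \<open>F \<in> W\<close>] sp(2)] insert sp aset_insert[OF \<open>spherical (insert s A)\<close> insert(2)]
    by auto
qed simp

text \<open>If no generator of \<open>T\<close> were a descent of \<open>F\<close>, every nonempty
  product of generators of \<open>T\<close> would lengthen \<open>F\<close>, and \<open>F\<close>
  would be the unique shortest element of its coset.\<close>

lemma coset_descent:
  assumes "spherical T" "F \<in> W" "G \<in> coset F T" "G \<noteq> F" "len G \<le> len F"
  shows "\<exists>s\<in>T. descent s F"
proof (rule ccontr)
  assume n: "\<not> (\<exists>s\<in>T. descent s F)"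
  obtain A where A: "A \<subseteq> T" "G = aset A F" using assms by (auto simp: coset_def)
  then have "A \<noteq> {}" "finite A" using assms spherical_finite[OF spherical_subset[OF assms(1) A(1)]] by auto
  then have "card A > 0" by auto
  then show False using len_aset[OF spherical_subset[OF assms(1) A(1)] assms(2)] n A assms(5) by auto
qed

end

section \<open>Absolute extensors and the Davis complex\<close>

lemma continuous_map_paste_closed:
  assumes "closedin Z A" "closedin Z B" "continuous_map (subtopology Z A) X f" "continuous_map (subtopology Z B) X g"
    and "\<And>x. x \<in> A \<Longrightarrow> x \<in> B \<Longrightarrow> f x = g x"
  shows "continuous_map (subtopology Z (A \<union> B)) X (\<lambda>x. if x \<in> A then f x else g x)"
proof (rule pasting_lemma_closed[where I = UNIV and T = "\<lambda>b. if b then A else B" and f = "\<lambda>b. if b then f else g"])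
  fix b :: bool
  show "closedin (subtopology Z (A \<union> B)) (if b then A else B)"
    using assms(1,2) by (auto intro!: closedin_subset_topspace)
  show "continuous_map (subtopology (subtopology Z (A \<union> B)) (if b then A else B)) X (if b then f else g)"
    using assms(3,4) by (auto simp: subtopology_subtopology Int_absorb1)
qed (use assms(5) in \<open>auto split: if_splits\<close>)

text \<open>Extension is demanded for all closed pairs inside a fixed \<open>Z\<close>, since gluing
  cuts the domain into closed pieces. \<open>C\<close> is a subset of \<open>X\<close>, so that
  unions and intersections of targets can be formed.\<close>

definition extensor :: "'z topology \<Rightarrow> 'a topology \<Rightarrow> 'a set \<Rightarrow> bool" where
  "extensor Z X C \<longleftrightarrow> (\<forall>K A f. closedin Z K \<and> closedin Z A \<and> A \<subseteq> K \<and>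
     continuous_map (subtopology Z A) X f \<and> f ` A \<subseteq> C \<longrightarrow>
     (\<exists>g. continuous_map (subtopology Z K) X g \<and> g ` K \<subseteq> C \<and> (\<forall>a\<in>A. g a = f a)))"

lemma extensorD:
  assumes "extensor Z X C" "closedin Z K" "closedin Z A" "A \<subseteq> K"
     "continuous_map (subtopology Z A) X f" "f ` A \<subseteq> C"
  obtains g where "continuous_map (subtopology Z K) X g" "g ` K \<subseteq> C" "\<And>a. a \<in> A \<Longrightarrow> g a = f a"
  using assms unfolding extensor_def by meson

text \<open>A metrizable space is completely normal, so \<open>K\<close> splits into closed pieces
  \<open>KC\<close> and \<open>KD\<close> that meet \<open>A\<close> exactly where \<open>f\<close>
  lies in \<open>C\<close> and in \<open>D\<close>. Extend over \<open>KC \<inter> KD\<close> into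
  \<open>C \<inter> D\<close>, then over each piece separately.\<close>

lemma extensor_Un:
  assumes Z: "metrizable_space Z"
    and C: "closedin X C" "extensor Z X C" and D: "closedin X D" "extensor Z X D"
    and CD: "extensor Z X (C \<inter> D)"
  shows "extensor Z X (C \<union> D)"
  unfolding extensor_def
proof (intro allI impI, elim conjE)
  fix K A f
  assume K: "closedin Z K" and A: "closedin Z A" "A \<subseteq> K"
    and f: "continuous_map (subtopology Z A) X f" "f ` A \<subseteq> C \<union> D"
  define AC where "AC = {a \<in> A. f a \<in> C}"
  define AD where "AD = {a \<in> A. f a \<in> D}"
  have AZ: "A \<subseteq> topspace Z" using A closedin_subset by blast
  then have "topspace (subtopology Z A) = A" by auto
  then have "closedin (subtopology Z A) AC" "closedin (subtopology Z A) AD"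
    using closedin_continuous_map_preimage[OF f(1) C(1)] closedin_continuous_map_preimage[OF f(1) D(1)]
    by (simp_all add: AC_def AD_def)
  then have cl: "closedin Z AC" "closedin Z AD" using A(1) closedin_trans_full by blast+
  have AUn: "AC \<union> AD = A" using f(2) by (auto simp: AC_def AD_def)
  have "separatedin Z (AC - AD) (AD - AC)" using cl by (rule separatedin_closedin_diff)
  from metrizable_space_separation[OF Z this]
  obtain U V where UV: "openin Z U" "openin Z V" "AC - AD \<subseteq> U" "AD - AC \<subseteq> V" "disjnt U V"
    by (elim exE conjE)
  \<comment> \<open>\<open>V - AC\<close> is open, so \<open>KC\<close> is closed; sparing
    \<open>AC\<close> keeps in \<open>KC\<close> all points of \<open>A\<close> that
    \<open>f\<close> sends to \<open>C\<close>.\<close>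
  define KC where "KC = K - (V - AC)"
  define KD where "KD = K - (U - AD)"
  have clK: "closedin Z KC" "closedin Z KD"
    unfolding KC_def KD_def using K UV cl by (auto intro!: closedin_diff openin_diff)
  have KK: "KC \<union> KD = K" using UV(5) by (auto simp: KC_def KD_def disjnt_iff)
  have AK: "A \<inter> KC = AC" "A \<inter> KD = AD"
    using UV AUn A(2) by (auto simp: KC_def KD_def disjnt_iff)
  have clI: "closedin Z (KC \<inter> KD)" "closedin Z (AC \<inter> AD)" using clK cl by auto
  have f': "continuous_map (subtopology Z B) X f" if "B \<subseteq> A" for B
    using f(1) that continuous_map_from_subtopology_mono by blast
  obtain h where h: "continuous_map (subtopology Z (KC \<inter> KD)) X h" "h ` (KC \<inter> KD) \<subseteq> C \<inter> D" "\<And>a. a \<in> AC \<inter> AD \<Longrightarrow> h a = f a"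
  proof (rule extensorD[OF CD clI, of f])
    show "AC \<inter> AD \<subseteq> KC \<inter> KD" using AK by blast
    show "continuous_map (subtopology Z (AC \<inter> AD)) X f" using AUn by (intro f') auto
    show "f ` (AC \<inter> AD) \<subseteq> C \<inter> D" by (auto simp: AC_def AD_def)
  qed (use that in blast)
  have ext: "\<exists>g. continuous_map (subtopology Z K') X g \<and> g ` K' \<subseteq> C' \<and> (\<forall>a\<in>A'. g a = f a) \<and> (\<forall>a\<in>KC \<inter> KD. g a = h a)"
    if C': "extensor Z X C'" "C \<inter> D \<subseteq> C'" and K': "closedin Z K'" "KC \<inter> KD \<subseteq> K'" and A': "closedin Z A'" "A' \<subseteq> A" "A' \<subseteq> K'" "f ` A' \<subseteq> C'"
      and I: "A' \<inter> (KC \<inter> KD) = AC \<inter> AD" for C' K' A'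
  proof -
    have eq: "f x = h x" if "x \<in> A'" "x \<in> KC \<inter> KD" for x proof -
      have "x \<in> AC \<inter> AD" using I that by blast
      then show ?thesis using h(3)[of x] by simp
    qed
    have c: "continuous_map (subtopology Z (A' \<union> (KC \<inter> KD))) X (\<lambda>x. if x \<in> A' then f x else h x)"
      by (rule continuous_map_paste_closed[OF A'(1) clI(1) f'[OF A'(2)] h(1) eq])
    obtain g where "continuous_map (subtopology Z K') X g" "g ` K' \<subseteq> C'" "\<And>a. a \<in> A' \<union> (KC \<inter> KD) \<Longrightarrow> g a = (if a \<in> A' then f a else h a)"
    proof (rule extensorD[OF C'(1) K'(1) _ _ c])
      show "closedin Z (A' \<union> (KC \<inter> KD))" using A'(1) clI(1) by (rule closedin_Un)
      show "A' \<union> KC \<inter> KD \<subseteq> K'" using A'(3) K'(2) by blast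
      show "(\<lambda>x. if x \<in> A' then f x else h x) ` (A' \<union> KC \<inter> KD) \<subseteq> C'"
        using A'(4) h(2) C'(2) by (auto simp: image_subset_iff)
    qed (use that in blast)
    then show ?thesis using eq by (metis (no_types, lifting) UnCI)
  qed
  have "\<exists>g. continuous_map (subtopology Z KC) X g \<and> g ` KC \<subseteq> C \<and> (\<forall>a\<in>AC. g a = f a) \<and> (\<forall>a\<in>KC \<inter> KD. g a = h a)"
    using C cl clK AK AUn by (intro ext) (auto simp: AC_def)
  then obtain gC where gC: "continuous_map (subtopology Z KC) X gC" "gC ` KC \<subseteq> C" "\<And>a. a\<in>AC \<Longrightarrow> gC a = f a" "\<And>a. a\<in>KC \<inter> KD \<Longrightarrow> gC a = h a"
    by blast
  have "\<exists>g. continuous_map (subtopology Z KD) X g \<and> g ` KD \<subseteq> D \<and> (\<forall>a\<in>AD. g a = f a) \<and> (\<forall>a\<in>KC \<inter> KD. g a = h a)"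
    using D cl clK AK AUn by (intro ext) (auto simp: AD_def)
  then obtain gD where gD: "continuous_map (subtopology Z KD) X gD" "gD ` KD \<subseteq> D" "\<And>a. a\<in>AD \<Longrightarrow> gD a = f a" "\<And>a. a\<in>KC \<inter> KD \<Longrightarrow> gD a = h a"
    by blast
  have "continuous_map (subtopology Z (KC \<union> KD)) X (\<lambda>x. if x \<in> KC then gC x else gD x)"
    using gC(4) gD(4) by (intro continuous_map_paste_closed clK gC(1) gD(1)) auto
  then show "\<exists>g. continuous_map (subtopology Z K) X g \<and> g ` K \<subseteq> C \<union> D \<and> (\<forall>a\<in>A. g a = f a)"
  proof (intro exI conjI)
    show "(\<lambda>x. if x \<in> KC then gC x else gD x) ` K \<subseteq> C \<union> D" using gC(2) gD(2) KK by auto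
    show "\<forall>a\<in>A. (if a \<in> KC then gC a else gD a) = f a"
      using gC(3) gD(3) AK AUn by auto
  qed (simp add: KK)
qed

text \<open>\<open>r\<close> is a left inverse of \<open>j\<close> on \<open>C\<close>, so extension
  problems are carried to \<open>C\<close> and their solutions back. This moves the property from
  the base \<open>X\<close> to a chamber of \<open>U\<close>.\<close>

lemma extensor_image:
  assumes C: "extensor Z X C" and j: "continuous_map X Y j" and r: "continuous_map Y X r" "\<And>x. x \<in> C \<Longrightarrow> r (j x) = x"
  shows "extensor Z Y (j ` C)"
  unfolding extensor_def
proof (intro allI impI, elim conjE)
  fix K A f
  assume K: "closedin Z K" and A: "closedin Z A" "A \<subseteq> K"
    and f: "continuous_map (subtopology Z A) Y f" "f ` A \<subseteq> j ` C"
  have c: "continuous_map (subtopology Z A) X (r \<circ> f)" using continuous_map_compose[OF f(1) r(1)] .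
  obtain g where g: "continuous_map (subtopology Z K) X g" "g ` K \<subseteq> C" "\<And>a. a \<in> A \<Longrightarrow> g a = (r \<circ> f) a"
    by (rule extensorD[OF C K A c]) (use f(2) r(2) in auto)
  have "j (g a) = f a" if a: "a \<in> A" for a
  proof -
    obtain x where "x \<in> C" "f a = j x" using f(2) a by blast
    then show ?thesis using g(3)[OF a] r(2) by simp
  qed
  then show "\<exists>g. continuous_map (subtopology Z K) Y g \<and> g ` K \<subseteq> j ` C \<and> (\<forall>a\<in>A. g a = f a)"
    using continuous_map_compose[OF g(1) j] g(2) by (intro exI[of _ "j \<circ> g"]) auto
qed

section \<open>The Davis complex of a space with mirrors\<close>

lemma openin_prod_discrete:
  "openin (prod_topology (discrete_topology W) X) V \<longleftrightarrow>
     V \<subseteq> W \<times> topspace X \<and> (\<forall>F\<in>W. openin X {x \<in> topspace X. (F, x) \<in> V})"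
proof safe
  assume V: "openin (prod_topology (discrete_topology W) X) V"
  show "a \<in> W" "b \<in> topspace X" if "(a, b) \<in> V" for a b
    using openin_subset[OF V] that by auto
  fix F assume "F \<in> W"
  then have "continuous_map X (prod_topology (discrete_topology W) X) (\<lambda>x. (F, x))"
    by (simp add: continuous_map_pairwise o_def)
  from openin_continuous_map_preimage[OF this V]
  show "openin X {x \<in> topspace X. (F, x) \<in> V}" .
next
  assume V: "V \<subseteq> W \<times> topspace X" "\<forall>F\<in>W. openin X {x \<in> topspace X. (F, x) \<in> V}"
  have "V = (\<Union>F\<in>W. {F} \<times> {x \<in> topspace X. (F, x) \<in> V})" using V(1) by auto
  moreover have "openin (prod_topology (discrete_topology W) X) \<dots>"
    using V(2) by (intro openin_Union) (auto simp: openin_prod_Times_iff)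
  ultimately show "openin (prod_topology (discrete_topology W) X) V" by simp
qed

text \<open>By \<open>comm_mir\<close> the mirrors through any one point belong to commuting
  generators, so the chambers around a point form a finite coset.\<close>

locale davis = racg S comm for S :: "'s set" and comm :: "'s \<Rightarrow> 's \<Rightarrow> bool" +
  fixes X :: "'x topology" and mir :: "'s \<Rightarrow> 'x set"
  assumes HX: "Hausdorff_space X"
    and closedin_mir: "s \<in> S \<Longrightarrow> closedin X (mir s)"
    and comm_mir: "\<lbrakk>s \<in> S; t \<in> S; s \<noteq> t; x \<in> mir s; x \<in> mir t\<rbrakk> \<Longrightarrow> comm s t"
begin

definition Sx :: "'x \<Rightarrow> 's set" where "Sx x = {s \<in> S. x \<in> mir s}"

text \<open>The class of \<open>(F, x)\<close> when chambers are identified along mirrors; the coset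
  of \<open>F\<close> together with \<open>x\<close> is a canonical name for it.\<close>

definition pt :: "('s \<Rightarrow> 's \<Rightarrow> 's list) \<Rightarrow> 'x \<Rightarrow> ('s \<Rightarrow> 's \<Rightarrow> 's list) set \<times> 'x" where
  "pt F x = (coset F (Sx x), x)"

definition U :: "(('s \<Rightarrow> 's \<Rightarrow> 's list) set \<times> 'x) topology" where
  "U = quotient_topology (prod_topology (discrete_topology W) X) (\<lambda>(F, x). pt F x)"

lemma spherical_Sx: "spherical (Sx x)"
  using comm_mir by (auto simp: spherical_def pairwise_def Sx_def)

lemma snd_pt [simp]: "snd (pt F x) = x"
  by (simp add: pt_def)

lemma pt_eq_iff:
  assumes "F \<in> W" "G \<in> W"
  shows "pt F x = pt G y \<longleftrightarrow> x = y \<and> G \<in> coset F (Sx x)"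
  using coset_eq[OF spherical_Sx assms(1)] coset_self[of G] by (auto simp: pt_def)

lemma topspace_U: "topspace U = {pt F x |F x. F \<in> W \<and> x \<in> topspace X}"
  by (auto simp: U_def image_iff pt_def)

lemma openin_U:
  "openin U V \<longleftrightarrow> V \<subseteq> topspace U \<and> (\<forall>F\<in>W. openin X {x \<in> topspace X. pt F x \<in> V})"
proof -
  let ?V = "{w \<in> topspace (prod_topology (discrete_topology W) X). (\<lambda>(F, x). pt F x) w \<in> V}"
  have "openin U V \<longleftrightarrow> V \<subseteq> topspace U \<and> openin (prod_topology (discrete_topology W) X) ?V"
    by (simp add: U_def openin_quotient_topology)
  also have "openin (prod_topology (discrete_topology W) X) ?V \<longleftrightarrow> (\<forall>F\<in>W. openin X {x \<in> topspace X. pt F x \<in> V})"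
    by (auto simp: openin_prod_discrete cong: conj_cong)
  finally show ?thesis .
qed

lemma closedin_U:
  "closedin U V \<longleftrightarrow> V \<subseteq> topspace U \<and> (\<forall>F\<in>W. closedin X {x \<in> topspace X. pt F x \<in> V})"
proof -
  have "{x \<in> topspace X. pt F x \<in> topspace U - V} = topspace X - {x \<in> topspace X. pt F x \<in> V}" if "F \<in> W" for F
    using that by (auto simp: topspace_U)
  then show ?thesis by (auto simp: closedin_def openin_U)
qed

lemma continuous_map_from_U:
  assumes "\<And>F. F \<in> W \<Longrightarrow> continuous_map X Y (\<lambda>x. g (pt F x))"
  shows "continuous_map U Y g"
  unfolding continuous_map_def openin_U
proof (intro conjI allI impI ballI)
  show "g \<in> topspace U \<rightarrow> topspace Y"
  proof
    fix z assume "z \<in> topspace U"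
    then obtain F x where "z = pt F x" "F \<in> W" "x \<in> topspace X" unfolding topspace_U by blast
    then show "g z \<in> topspace Y" using assms[of F] by (auto simp: continuous_map_def)
  qed
  fix V F assume V: "openin Y V" and F: "F \<in> W"
  have "{x \<in> topspace X. pt F x \<in> {x \<in> topspace U. g x \<in> V}} = {x \<in> topspace X. g (pt F x) \<in> V}"
    using F by (auto simp: topspace_U)
  then show "openin X {x \<in> topspace X. pt F x \<in> {x \<in> topspace U. g x \<in> V}}"
    using openin_continuous_map_preimage[OF assms[OF F] V] by simp
qed auto

lemma continuous_map_pt: "F \<in> W \<Longrightarrow> continuous_map X U (pt F)"
  by (auto simp: continuous_map_def openin_U topspace_U)

lemma continuous_map_snd_U: "continuous_map U X snd"
  by (rule continuous_map_from_U) simp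

lemma closedin_face: "A \<subseteq> S \<Longrightarrow> closedin X (topspace X \<inter> \<Inter> (mir ` A))"
proof -
  assume A: "A \<subseteq> S"
  then have "finite A" using finS finite_subset by blast
  then show ?thesis using A
  proof (induction A)
    case (insert s A)
    then have "closedin X (mir s)" "closedin X (topspace X \<inter> \<Inter> (mir ` A))" using closedin_mir by auto
    then have "closedin X (mir s \<inter> (topspace X \<inter> \<Inter> (mir ` A)))" by (rule closedin_Int)
    moreover have "mir s \<inter> (topspace X \<inter> \<Inter> (mir ` A)) = topspace X \<inter> \<Inter> (mir ` insert s A)" by auto
    ultimately show ?case by simp
  qed simp
qed

text \<open>A finite union of closed faces: passing to a limit point can only add mirrors to
  \<open>Sx\<close>. Questions of openness in \<open>U\<close> are reduced to this.\<close>

lemma closedin_Sx: "closedin X {x \<in> topspace X. \<exists>A. A \<subseteq> Sx x \<and> Q A}"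
proof -
  have "closedin X (\<Union>A\<in>{A \<in> Pow S. Q A}. topspace X \<inter> \<Inter> (mir ` A))"
    using finS by (intro closedin_Union) (auto intro!: closedin_face)
  also have "(\<Union>A\<in>{A \<in> Pow S. Q A}. topspace X \<inter> \<Inter> (mir ` A)) = {x \<in> topspace X. \<exists>A. A \<subseteq> Sx x \<and> Q A}"
    by (auto simp: Sx_def)
  finally show ?thesis .
qed

lemma openin_Sx: "openin X {x \<in> topspace X. Sx x \<subseteq> T}"
proof -
  have "{x \<in> topspace X. Sx x \<subseteq> T} = topspace X - {x \<in> topspace X. \<exists>A. A \<subseteq> Sx x \<and> \<not> A \<subseteq> T}" by auto
  then show ?thesis using closedin_Sx[of "\<lambda>A. \<not> A \<subseteq> T"] by auto
qed

lemma closedin_chamber: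
  assumes F: "F \<in> W" and C: "closedin X C"
  shows "closedin U (pt F ` C)"
  unfolding closedin_U
proof (intro conjI ballI)
  have CX: "C \<subseteq> topspace X" using C closedin_subset by blast
  then show "pt F ` C \<subseteq> topspace U" using F by (auto simp: topspace_U)
  fix G assume G: "G \<in> W"
  have "{x \<in> topspace X. pt G x \<in> pt F ` C} = C \<inter> {x \<in> topspace X. \<exists>A. A \<subseteq> Sx x \<and> aset A G = F}"
    using CX pt_eq_iff[OF G F] by (auto simp: coset_def image_iff)
  then show "closedin X {x \<in> topspace X. pt G x \<in> pt F ` C}"
    using closedin_Sx[of "\<lambda>A. aset A G = F"] C by auto
qed

text \<open>The chambers of one coset, restricted to the open part of \<open>X\<close> touched only
  by mirrors in \<open>T\<close>. For \<open>T = Sx x\<close> it is a neighbourhood of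
  \<open>pt F x\<close>.\<close>

definition star :: "('s \<Rightarrow> 's \<Rightarrow> 's list) \<Rightarrow> 's set \<Rightarrow> (('s \<Rightarrow> 's \<Rightarrow> 's list) set \<times> 'x) set" where
  "star F T = {pt G x |G x. G \<in> coset F T \<and> x \<in> topspace X \<and> Sx x \<subseteq> T}"

lemma pt_in_star:
  assumes "spherical T" "F \<in> W" "G \<in> W" "x \<in> topspace X"
  shows "pt G x \<in> star F T \<longleftrightarrow> G \<in> coset F T \<and> Sx x \<subseteq> T"
proof
  assume "pt G x \<in> star F T"
  then obtain G' where G': "G' \<in> coset F T" "pt G x = pt G' x" "Sx x \<subseteq> T"
    by (auto simp: star_def pt_def)
  then have "G' \<in> W" using coset_in_W assms by blast
  then have "G \<in> coset G' (Sx x)" using pt_eq_iff[OF \<open>G' \<in> W\<close> assms(3)] G' by metis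
  then have "G \<in> coset G' T" using coset_mono[OF G'(3)] by blast
  then show "G \<in> coset F T \<and> Sx x \<subseteq> T" using coset_eq[OF assms(1,2) G'(1)] G' by simp
qed (use assms in \<open>auto simp: star_def\<close>)

lemma openin_star:
  assumes T: "spherical T" and F: "F \<in> W"
  shows "openin U (star F T)"
  unfolding openin_U
proof (intro conjI ballI)
  show "star F T \<subseteq> topspace U"
    using coset_in_W[OF T F] by (auto simp: star_def topspace_U)
  fix G assume G: "G \<in> W"
  have "{x \<in> topspace X. pt G x \<in> star F T} = (if G \<in> coset F T then {x \<in> topspace X. Sx x \<subseteq> T} else {})"
    using pt_in_star[OF T F G] by auto
  then show "openin X {x \<in> topspace X. pt G x \<in> star F T}" using openin_Sx by simp
qed

text \<open>Different base points are separated in \<open>X\<close>. Over the same \<open>x\<close>,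
  a common point of two stars would lie in a chamber belonging to both cosets of
  \<open>Sx x\<close>, making the cosets equal.\<close>

lemma Hausdorff_U: "Hausdorff_space U"
  unfolding Hausdorff_space_def
proof (intro allI impI, elim conjE)
  fix a b assume "a \<in> topspace U" "b \<in> topspace U" and ne: "a \<noteq> b"
  then obtain F x G y where a: "a = pt F x" "F \<in> W" "x \<in> topspace X" and b: "b = pt G y" "G \<in> W" "y \<in> topspace X"
    by (auto simp: topspace_U)
  show "\<exists>A B. openin U A \<and> openin U B \<and> a \<in> A \<and> b \<in> B \<and> disjnt A B"
  proof (cases "x = y")
    case False
    then obtain A B where AB: "openin X A" "openin X B" "x \<in> A" "y \<in> B" "disjnt A B"
      using HX a b unfolding Hausdorff_space_def by metis
    let ?f = "\<lambda>A. {z \<in> topspace U. snd z \<in> A}"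
    have "openin U (?f A)" "openin U (?f B)" using AB continuous_map_snd_U openin_continuous_map_preimage by blast+
    moreover have "a \<in> ?f A" "b \<in> ?f B" using a b AB by (auto simp: topspace_U)
    moreover have "disjnt (?f A) (?f B)" using AB by (auto simp: disjnt_iff)
    ultimately show ?thesis by blast
  next
    case True
    let ?T = "Sx x"
    have "openin U (star F ?T)" "openin U (star G ?T)" using openin_star spherical_Sx a b by auto
    moreover have "a \<in> star F ?T" "b \<in> star G ?T"
      using a b True by (auto simp: pt_in_star spherical_Sx coset_self)
    moreover have "disjnt (star F ?T) (star G ?T)"
      unfolding disjnt_iff
    proof (intro allI notI)
      fix z assume "z \<in> star F ?T \<and> z \<in> star G ?T"
      then obtain H w where z: "z = pt H w" "H \<in> W" "w \<in> topspace X" "pt H w \<in> star F ?T" "pt H w \<in> star G ?T"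
        using openin_subset[OF openin_star[OF spherical_Sx a(2)]] by (fastforce simp: topspace_U)
      then have "H \<in> coset F ?T" "H \<in> coset G ?T" using pt_in_star spherical_Sx a b by blast+
      then have "coset F ?T = coset G ?T" using coset_eq[OF spherical_Sx] a b by metis
      then show False using ne a b True by (simp add: pt_def)
    qed
    ultimately show ?thesis by blast
  qed
qed

text \<open>Faces are added one at a time. The parameter \<open>B\<close> carries the induction: the
  new face meets the earlier ones in a union of the same kind with \<open>s\<close> added to
  \<open>B\<close>.\<close>

lemma extensor_faces_Un:
  assumes Z: "metrizable_space Z"
    and ext: "\<And>T. spherical T \<Longrightarrow> extensor Z X (topspace X \<inter> \<Inter> (mir ` T))"
    and T: "finite T" "T \<noteq> {}" "spherical (T \<union> B)"
  shows "extensor Z X (\<Union>s\<in>T. topspace X \<inter> \<Inter> (mir ` insert s B))"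
  using T
proof (induction T arbitrary: B rule: finite_ne_induct)
  case (singleton s)
  then show ?case using ext[of "insert s B"] by simp
next
  case (insert s T)
  let ?M = "\<lambda>T B. \<Union>s\<in>T. topspace X \<inter> \<Inter> (mir ` insert s B)"
  have sub: "insert s T \<union> B \<subseteq> S" using insert by (auto simp: spherical_def)
  have "closedin X (topspace X \<inter> \<Inter> (mir ` insert t B))" if "t \<in> T" for t
    using sub that by (intro closedin_face) auto
  then have cl: "closedin X (?M T B)" using insert(1) by (intro closedin_Union) blast+
  have "extensor Z X (?M T B)" using insert(4)[of B] insert(5) spherical_subset[of "insert s T \<union> B" "T \<union> B"] by auto
  moreover have "extensor Z X (?M {s} B)" using ext[of "insert s B"] insert(5) spherical_subset[of "insert s T \<union> B" "insert s B"] by auto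
  moreover have "closedin X (?M {s} B)" using closedin_face[of "insert s B"] sub by auto
  moreover have "?M T B \<inter> ?M {s} B = ?M T (insert s B)" by auto
  moreover have "extensor Z X (?M T (insert s B))" using insert(4)[of "insert s B"] insert(5) by simp
  ultimately have "extensor Z X (?M T B \<union> ?M {s} B)" using extensor_Un[OF Z cl, of "?M {s} B"] by simp
  moreover have "?M T B \<union> ?M {s} B = ?M (insert s T) B" by auto
  ultimately show ?case by simp
qed

lemma len_unit: "len unit = 0"
  by (simp add: unit_def len_word_fam)

text \<open>Chambers are added in order of increasing length. A new chamber meets the previous ones in
  the mirrors of its descents, which pairwise commute.\<close>

lemma extensor_chambers:
  assumes Z: "metrizable_space Z"
    and ext: "\<And>T. spherical T \<Longrightarrow> extensor Z X (topspace X \<inter> \<Inter> (mir ` T))"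
    and C: "finite C" "C \<subseteq> W" "unit \<in> C" "\<And>F s. F \<in> C \<Longrightarrow> s \<in> S \<Longrightarrow> descent s F \<Longrightarrow> act s F \<in> C"
  shows "extensor Z U (\<Union>F\<in>C. pt F ` topspace X)"
  using C
proof (induction "card C" arbitrary: C rule: less_induct)
  case less
  have chamber: "extensor Z U (pt F ` C')" if "F \<in> W" "extensor Z X C'" for F C'
    using extensor_image[OF that(2) continuous_map_pt[OF that(1)] continuous_map_snd_U] by simp
  have face0: "extensor Z X (topspace X)" using ext[of "{}"] by (simp add: spherical_def)
  show ?case
  proof (cases "C = {unit}")
    case True
    then show ?thesis using chamber[OF unit_in_W face0] by simp
  next
    case False
    let ?D = "C - {unit}"
    have D: "finite ?D" "?D \<noteq> {}" using less False by auto
    then obtain F where F: "F \<in> ?D" "\<And>G. G \<in> ?D \<Longrightarrow> len G \<le> len F"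
      using obtains_MAX[OF D, of len] by (metis (no_types, lifting) Max_ge finite_imageI imageI)
    have FW: "F \<in> W" using F less by auto
    have lenF: "len G \<le> len F" if "G \<in> C" for G
      using that F len_unit by (cases "G = unit") auto
    let ?C = "C - {F}"
    \<comment> \<open>\<open>F\<close> has maximal length and descents shorten, so no descent step
      leads to \<open>F\<close> and \<open>C - {F}\<close> stays closed under descents.\<close>
    have C': "act s G \<in> ?C" if G: "G \<in> C" "s \<in> S" "descent s G" for G s
    proof -
      have GW: "G \<in> W" using G less by auto
      have "len (act s G) < len G" using len_act[OF GW G(2)] G(3) by simp
      then have "act s G \<noteq> F" using lenF[OF G(1)] by auto
      then show ?thesis using less G by auto
    qed
    have IH: "extensor Z U (\<Union>F\<in>?C. pt F ` topspace X)"
    proof (rule less(1))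
      show "card ?C < card C" using F less(2) by (intro card_Diff1_less) auto
    qed (use less F C' in auto)
    have fin: "finite ?C" using less by simp
    have cl: "closedin U (\<Union>F\<in>?C. pt F ` topspace X)"
      using fin less by (intro closedin_Union) (auto intro!: closedin_chamber)
    let ?T = "{s \<in> S. descent s F}"
    have T: "spherical ?T" "finite ?T" using descents_comm[OF FW] finS by (auto simp: spherical_def pairwise_def)
    have Tne: "?T \<noteq> {}" using exists_descent[OF FW] F by auto
    have M: "extensor Z X (\<Union>s\<in>?T. topspace X \<inter> \<Inter> (mir ` {s}))"
      using extensor_faces_Un[OF Z ext T(2) Tne, of "{}"] T by simp
    \<comment> \<open>A point of the new chamber that lies in an older one has in its coset another
      element of no greater length, so some mirror through it is a descent of \<open>F\<close>.
      Conversely a descent mirror is shared with the shorter chamber \<open>act s F\<close>.\<close>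
    have "(\<Union>F\<in>?C. pt F ` topspace X) \<inter> pt F ` topspace X = pt F ` (\<Union>s\<in>?T. topspace X \<inter> \<Inter> (mir ` {s}))"
    proof (intro equalityI subsetI)
      fix z assume "z \<in> (\<Union>F\<in>?C. pt F ` topspace X) \<inter> pt F ` topspace X"
      then obtain G x where G: "G \<in> C" "G \<noteq> F" "x \<in> topspace X" "z = pt F x" "pt G x = pt F x"
        by (auto simp: pt_def)
      then have "G \<in> coset F (Sx x)" using pt_eq_iff[OF FW, of G x x] less by auto
      then have "\<exists>s\<in>Sx x. descent s F" using coset_descent[OF spherical_Sx FW] G lenF by blast
      then show "z \<in> pt F ` (\<Union>s\<in>?T. topspace X \<inter> \<Inter> (mir ` {s}))" using G by (auto simp: Sx_def)
    next
      fix z assume "z \<in> pt F ` (\<Union>s\<in>?T. topspace X \<inter> \<Inter> (mir ` {s}))"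
      then obtain s x where s: "s \<in> S" "descent s F" "x \<in> topspace X" "x \<in> mir s" "z = pt F x" by auto
      have "spherical {s}" using s by (auto simp: spherical_def pairwise_def)
      then have "act s F = aset {s} F" using aset_insert[of s "{}" F] by simp
      then have "act s F \<in> coset F (Sx x)" using s by (auto simp: coset_def Sx_def intro!: exI[of _ "{s}"])
      then have "pt F x = pt (act s F) x" using pt_eq_iff[OF FW] act_closed_invol(1)[OF FW s(1)] by auto
      moreover have "act s F \<in> ?C" using C' F s by auto
      moreover have "z \<in> pt F ` topspace X" using s by blast
      ultimately show "z \<in> (\<Union>F\<in>?C. pt F ` topspace X) \<inter> pt F ` topspace X" using s by auto
    qed
    then have "extensor Z U ((\<Union>F\<in>?C. pt F ` topspace X) \<union> pt F ` topspace X)"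
      using extensor_Un[OF Z cl IH closedin_chamber[OF FW closedin_topspace] chamber[OF FW face0]] chamber[OF FW M] by simp
    moreover have "(\<Union>F\<in>?C. pt F ` topspace X) \<union> pt F ` topspace X = (\<Union>F\<in>C. pt F ` topspace X)" using F by auto
    ultimately show ?thesis by simp
  qed
qed

text \<open>\<open>O' N\<close> collects the points all of whose chambers have length at most
  \<open>N\<close>. Asking this of the whole coset makes the set open, and finiteness of cosets
  makes these sets cover \<open>U\<close>.\<close>

lemma compact_in_chambers:
  assumes "compactin U C"
  shows "\<exists>N. C \<subseteq> (\<Union>F\<in>{F\<in>W. len F \<le> N}. pt F ` topspace X)"
proof -
  define O' where "O' N = {pt F x |F x. F \<in> W \<and> x \<in> topspace X \<and> (\<forall>G\<in>coset F (Sx x). len G \<le> N)}" for N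
  have in_O: "pt F x \<in> O' N \<longleftrightarrow> (\<forall>G\<in>coset F (Sx x). len G \<le> N)" if "F \<in> W" "x \<in> topspace X" for F x N
    using that by (auto simp: O'_def pt_def)
  have "openin U (O' N)" for N
    unfolding openin_U
  proof (intro conjI ballI)
    fix F assume F: "F \<in> W"
    have "{x \<in> topspace X. pt F x \<in> O' N} = topspace X - {x \<in> topspace X. \<exists>A. A \<subseteq> Sx x \<and> \<not> len (aset A F) \<le> N}"
      using in_O[OF F] by (auto simp: coset_def)
    then show "openin X {x \<in> topspace X. pt F x \<in> O' N}" using closedin_Sx[of "\<lambda>A. \<not> len (aset A F) \<le> N"] by auto
  qed (auto simp: O'_def topspace_U)
  moreover have "C \<subseteq> \<Union> (range O')"
  proof
    fix z assume "z \<in> C"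
    then obtain F x where z: "z = pt F x" "F \<in> W" "x \<in> topspace X"
      using compactin_subset_topspace[OF assms] by (auto simp: topspace_U)
    have "finite (len ` coset F (Sx x))" using finite_coset[OF spherical_Sx] by simp
    then have "\<forall>G\<in>coset F (Sx x). len G \<le> Max (len ` coset F (Sx x))" by simp
    then show "z \<in> \<Union> (range O')" using in_O z by blast
  qed
  ultimately obtain \<F> where "finite \<F>" "\<F> \<subseteq> range O'" "C \<subseteq> \<Union>\<F>"
    using assms unfolding compactin_def by (metis (no_types, lifting) imageE)
  then obtain J where J: "finite J" "C \<subseteq> (\<Union>N\<in>J. O' N)"
    using finite_subset_image[of \<F> O' UNIV] by blast
  have mono: "O' N \<subseteq> O' (Max J)" if "N \<in> J" for N
  proof -
    have "N \<le> Max J" using J that by simp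
    then show ?thesis by (force simp: O'_def)
  qed
  have "O' (Max J) \<subseteq> (\<Union>F\<in>{F\<in>W. len F \<le> Max J}. pt F ` topspace X)"
    using coset_self by (auto simp: O'_def)
  then show ?thesis using J(2) mono by (intro exI[of _ "Max J"]) blast
qed

text \<open>The image of the compact set \<open>A\<close> meets only chambers of bounded length. The
  elements of length at most \<open>N\<close> are finite in number and closed under descents, so
  their chambers form an extensor.\<close>

theorem extensor_U:
  assumes Z: "metrizable_space Z" and K: "compact_space Z"
    and ext: "\<And>T. spherical T \<Longrightarrow> extensor Z X (topspace X \<inter> \<Inter> (mir ` T))"
    and A: "closedin Z A" and f: "continuous_map (subtopology Z A) U f"
  obtains g where "continuous_map Z U g" "\<And>a. a \<in> A \<Longrightarrow> g a = f a"
proof -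
  have "compactin Z A" using K A closedin_compact_space by blast
  then have "compactin U (f ` A)" using f by (metis compactin_absolute image_compactin topspace_subtopology_subset compactin_subset_topspace compactin_subtopology subset_refl)
  then obtain N where N: "f ` A \<subseteq> (\<Union>F\<in>{F\<in>W. len F \<le> N}. pt F ` topspace X)"
    using compact_in_chambers by blast
  have ex: "extensor Z U (\<Union>F\<in>{F\<in>W. len F \<le> N}. pt F ` topspace X)"
  proof (rule extensor_chambers[OF Z ext finite_len])
    show "act s F \<in> {F \<in> W. len F \<le> N}" if "F \<in> {F \<in> W. len F \<le> N}" "s \<in> S" "descent s F" for F s
      using that act_closed_invol(1)[of F s] len_act(1)[of F s] by (auto intro: le_trans[OF diff_le_self])
  qed (use unit_in_W len_unit in auto)
  show ?thesis
  proof (rule extensorD[OF ex closedin_topspace A closedin_subset[OF A] f N])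
    fix g assume g: "continuous_map (subtopology Z (topspace Z)) U g" "\<And>a. a \<in> A \<Longrightarrow> g a = f a"
    show thesis by (rule that[of g]) (use g in simp_all)
  qed
qed

end

section \<open>Short codes and the flag condition\<close>

lemma set_le_refl: "set_le A A"
  unfolding set_le_def by (intro exI[of _ id]) auto

lemma set_le_trans: "set_le A B \<Longrightarrow> set_le B C \<Longrightarrow> set_le A C"
proof -
  assume "set_le A B" "set_le B C"
  then obtain f g where "inj_on f A" "f ` A \<subseteq> B" "\<forall>i\<in>A. i \<le> f i" "inj_on g B" "g ` B \<subseteq> C" "\<forall>i\<in>B. i \<le> g i"
    unfolding set_le_def by blast
  then show ?thesis
    unfolding set_le_def using order_trans
    by (intro exI[of _ "g \<circ> f"] conjI comp_inj_on) (auto intro: inj_on_subset simp: image_subset_iff intro: order_trans)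
qed

text \<open>The sum of the elements is strictly monotone for \<open>set_le\<close>; it supplies
  antisymmetry and maximal elements. Since 0 is not in \<open>B\<close>, the sum detects every
  additional element.\<close>

lemma set_le_sum:
  assumes "set_le A B" "finite B" "0 \<notin> B"
  shows "\<Sum>A \<le> \<Sum>B" "\<Sum>A = \<Sum>B \<Longrightarrow> A = B"
proof -
  obtain f where f: "inj_on f A" "f ` A \<subseteq> B" "\<forall>i\<in>A. i \<le> f i"
    using assms unfolding set_le_def by blast
  have fin: "finite A" using f assms(2) by (meson finite_subset inj_on_finite)
  have 1: "\<Sum>A \<le> (\<Sum>i\<in>A. f i)" using f by (intro sum_mono) auto
  have 2: "(\<Sum>i\<in>A. f i) = \<Sum>(f ` A)" using f by (simp add: sum.reindex)
  have B: "\<Sum>B = \<Sum>(f ` A) + \<Sum>(B - f ` A)"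
    using sum.subset_diff[OF f(2) assms(2)] by (simp add: add.commute)
  show "\<Sum>A \<le> \<Sum>B" using 1 2 B by simp
  assume e: "\<Sum>A = \<Sum>B"
  then have "\<Sum>(B - f ` A) = 0" using 1 2 B by simp
  then have "\<forall>b\<in>B - f ` A. b = 0" using assms(2) by simp
  then have "b \<in> f ` A" if "b \<in> B" for b using that assms(3) by (metis DiffI)
  then have fB: "f ` A = B" using f by blast
  have "\<Sum>A = (\<Sum>i\<in>A. f i)" using e 2 fB by simp
  then have "(\<Sum>i\<in>A. f i - i) = 0" using f fin by (subst sum_subtractf_nat) auto
  then have "\<forall>i\<in>A. f i = i" using f fin by (auto simp: le_antisym)
  then show "A = B" using fB by simp
qed

text \<open>The injection raises elements, so it preserves being at least \<open>k\<close>. Its use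
  is to refute \<open>set_le\<close> by counting.\<close>

lemma set_le_card:
  assumes "set_le A B" "finite B"
  shows "card {i \<in> A. k \<le> i} \<le> card {j \<in> B. k \<le> j}"
proof -
  obtain f where f: "inj_on f A" "f ` A \<subseteq> B" "\<forall>i\<in>A. i \<le> f i"
    using assms unfolding set_le_def by blast
  show ?thesis
    by (rule card_inj_on_le[of f]) (use f assms(2) in \<open>auto intro: inj_on_subset order_trans\<close>)
qed

lemma set_le_replace:
  assumes "J - {x} \<subseteq> A - {y}" "x \<le> y" "y \<in> A"
  shows "set_le J A"
  unfolding set_le_def
proof (intro exI conjI)
  show "inj_on (id(x := y)) J" using assms(1) by (auto simp: inj_on_def)
qed (use assms in auto)

lemma set_le_subset: "J \<subseteq> A \<Longrightarrow> set_le J A"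
  unfolding set_le_def by (intro exI[of _ id]) auto

section \<open>Short sets of a length vector and its code\<close>

locale lengths =
  fixes m :: nat and \<alpha> :: "nat \<Rightarrow> real"
  assumes m3: "m \<ge> 3" and lv: "length_vector m \<alpha>" and gen: "generic m \<alpha>"
    and mono\<alpha>: "mono_on {1..m-1} \<alpha>" and last_short: "\<alpha> m < (\<Sum>i=1..m-1. \<alpha> i)"
begin

abbreviation "M \<equiv> {1..m-1}"

lemma pos: "i \<in> {1..m} \<Longrightarrow> 0 < \<alpha> i"
  using lv by (simp add: length_vector_def)

lemma posM: "i \<in> M \<Longrightarrow> 0 < \<alpha> i"
  using pos by auto

lemma M_subset: "M \<subseteq> {1..m}"
  by auto

lemma m_notin_M: "m \<notin> M"
  using m3 by simp

lemma insert_M: "insert m M = {1..m}"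
  using m3 by auto

lemma short_iff: "short m \<alpha> I \<longleftrightarrow> I \<subseteq> {1..m} \<and> 2 * sum \<alpha> I < sum \<alpha> {1..m}"
  unfolding short_def using sum.subset_diff[of I "{1..m}" \<alpha>] by auto

lemma generic_sum: "I \<subseteq> {1..m} \<Longrightarrow> 2 * sum \<alpha> I \<noteq> sum \<alpha> {1..m}"
proof
  assume I: "I \<subseteq> {1..m}" and eq: "2 * sum \<alpha> I = sum \<alpha> {1..m}"
  define \<epsilon> :: "nat \<Rightarrow> real" where "\<epsilon> i = (if i \<in> I then 1 else -1)" for i
  have "(\<Sum>i=1..m. \<epsilon> i * \<alpha> i) = (\<Sum>i\<in>I. \<epsilon> i * \<alpha> i) + (\<Sum>i\<in>{1..m}-I. \<epsilon> i * \<alpha> i)"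
    using sum.subset_diff[OF I, of "\<lambda>i. \<epsilon> i * \<alpha> i"] by simp
  also have "(\<Sum>i\<in>I. \<epsilon> i * \<alpha> i) = sum \<alpha> I" by (intro sum.cong) (auto simp: \<epsilon>_def)
  also have "(\<Sum>i\<in>{1..m}-I. \<epsilon> i * \<alpha> i) = - sum \<alpha> ({1..m}-I)"
    unfolding sum_negf[symmetric] by (intro sum.cong) (auto simp: \<epsilon>_def)
  also have "sum \<alpha> I + - sum \<alpha> ({1..m}-I) = 0" using sum.subset_diff[OF I, of \<alpha>] eq by simp
  finally have "(\<Sum>i=1..m. \<epsilon> i * \<alpha> i) = 0" .
  moreover have "\<forall>i\<in>{1..m}. \<epsilon> i \<in> {-1, 1}" by (auto simp: \<epsilon>_def)
  ultimately show False using gen unfolding generic_def by blast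
qed

lemma short_mono:
  assumes "short m \<alpha> I" "J \<subseteq> I"
  shows "short m \<alpha> J"
proof -
  have I: "I \<subseteq> {1..m}" "2 * sum \<alpha> I < sum \<alpha> {1..m}" using assms by (simp_all add: short_iff)
  then have "finite I" using finite_subset by blast
  moreover have "0 \<le> \<alpha> i" if "i \<in> I - J" for i using that I(1) pos[of i] by (simp add: subset_iff)
  ultimately have "sum \<alpha> J \<le> sum \<alpha> I" using assms(2) by (intro sum_mono2)
  then have "2 * sum \<alpha> J < sum \<alpha> {1..m}" using I(2) by linarith
  then show ?thesis using I assms(2) by (simp add: short_iff)
qed

lemma not_short_iff_compl:
  assumes "I \<subseteq> {1..m}"
  shows "\<not> short m \<alpha> I \<longleftrightarrow> short m \<alpha> ({1..m} - I)"
proof -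
  have "sum \<alpha> {1..m} = sum \<alpha> ({1..m} - I) + sum \<alpha> I"
    using assms by (intro sum.subset_diff) auto
  then show ?thesis using generic_sum[OF assms] assms unfolding short_iff by simp linarith
qed

text \<open>Complementation in \<open>{1..m}\<close> turns long subsets of \<open>M\<close> into
  short sets containing \<open>m\<close>, which are the sets that the code describes.\<close>

lemma not_short_compl_M:
  assumes "I \<subseteq> M"
  shows "\<not> short m \<alpha> I \<longleftrightarrow> short m \<alpha> (insert m (M - I))"
proof -
  have "{1..m} - I = insert m (M - I)" using assms m3 by auto
  moreover have "I \<subseteq> {1..m}" using assms M_subset by (rule order_trans)
  ultimately show ?thesis using not_short_iff_compl[of I] by simp
qed

lemma short_replace:
  assumes A: "short m \<alpha> (insert m A)" and "A \<subseteq> M" "J \<subseteq> M" "J - {x} \<subseteq> A - {y}" "x \<le> y" "y \<in> A" "1 \<le> x"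
  shows "short m \<alpha> (insert m J)"
proof -
  have fin: "finite J" "finite A" using assms finite_subset by blast+
  have nm: "m \<notin> A" "m \<notin> J" using assms m3 by auto
  have "sum \<alpha> J \<le> sum \<alpha> (insert x (J - {x}))"
  proof (rule sum_mono2)
    show "0 \<le> \<alpha> b" if "b \<in> insert x (J - {x}) - J" for b
      using that assms by (intro less_imp_le pos) auto
  qed (use fin in auto)
  also have "\<dots> = \<alpha> x + sum \<alpha> (J - {x})" using fin by (subst sum.insert) auto
  also have "\<alpha> x \<le> \<alpha> y" using mono\<alpha> assms by (auto simp: mono_on_def)
  also have "sum \<alpha> (J - {x}) \<le> sum \<alpha> (A - {y})"
  proof (rule sum_mono2)
    show "0 \<le> \<alpha> b" if "b \<in> A - {y} - (J - {x})" for b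
      using that assms(2) M_subset by (intro less_imp_le pos) blast
  qed (use fin assms in auto)
  also have "\<alpha> y + sum \<alpha> (A - {y}) = sum \<alpha> A" using fin assms by (simp add: sum.remove)
  finally have "sum \<alpha> J \<le> sum \<alpha> A" by simp
  then have "sum \<alpha> (insert m J) \<le> sum \<alpha> (insert m A)" using fin nm by simp
  moreover have "insert m J \<subseteq> {1..m}" using order_trans[OF assms(3) M_subset] m3 by auto
  ultimately show ?thesis using A unfolding short_iff by linarith
qed

lemma short_m: "short m \<alpha> {m}"
proof -
  have "sum \<alpha> {1..m} = \<alpha> m + sum \<alpha> M"
    unfolding insert_M[symmetric] using m3 by (subst sum.insert) auto
  then show ?thesis using last_short m3 by (simp add: short_iff)
qed

lemma short_sets_iff: "B \<in> short_sets m \<alpha> \<longleftrightarrow> (\<exists>J\<subseteq>M. B = insert m J \<and> short m \<alpha> (insert m J))"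
proof
  assume B: "B \<in> short_sets m \<alpha>"
  then have "B - {m} \<subseteq> M" "insert m (B - {m}) = B" by (auto simp: short_sets_def)
  then show "\<exists>J\<subseteq>M. B = insert m J \<and> short m \<alpha> (insert m J)"
    using B by (intro exI[of _ "B - {m}"]) (auto simp: short_sets_def)
qed (auto simp: short_sets_def short_iff)

text \<open>In a finite order a unique maximal element is greatest: among the elements above any
  \<open>B\<close>, one of largest sum is maximal.\<close>

lemma short_code_eq_singleton:
  "short_code m \<alpha> = {A} \<longleftrightarrow> A \<in> short_sets m \<alpha> \<and> (\<forall>B\<in>short_sets m \<alpha>. set_le B A)"
proof
  have fin: "finite (short_sets m \<alpha>)" by (rule finite_subset[of _ "Pow {1..m}"]) (auto simp: short_sets_def)
  have B0: "finite B \<and> 0 \<notin> B" if "B \<in> short_sets m \<alpha>" for B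
    using that by (auto simp: short_sets_def intro: finite_subset)
  {
    assume c: "short_code m \<alpha> = {A}"
    then have A: "A \<in> short_sets m \<alpha>" by (auto simp: short_code_def)
    moreover have "set_le B A" if B: "B \<in> short_sets m \<alpha>" for B
    proof -
      let ?U = "{C \<in> short_sets m \<alpha>. set_le B C}"
      have U: "finite ?U" "?U \<noteq> {}" using fin B set_le_refl by auto
      obtain C where C: "C \<in> ?U" "\<And>D. D \<in> ?U \<Longrightarrow> \<Sum>D \<le> \<Sum>C"
      proof -
        obtain C where "C \<in> ?U" "Max ((\<lambda>D. \<Sum>D) ` ?U) = \<Sum>C" by (rule obtains_MAX[OF U])
        moreover have "\<Sum>D \<le> Max ((\<lambda>D. \<Sum>D) ` ?U)" if "D \<in> ?U" for D using that U by (intro Max_ge) auto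
        ultimately show ?thesis using that by simp
      qed
      have "C \<in> short_code m \<alpha>"
        unfolding short_code_def
      proof (intro CollectI conjI ballI impI)
        fix D assume D: "D \<in> short_sets m \<alpha>" "set_le C D"
        then have "D \<in> ?U" using C set_le_trans by blast
        then have "\<Sum>C = \<Sum>D" using C(2) set_le_sum(1)[OF D(2)] B0[OF D(1)] by (auto intro: le_antisym)
        then show "D = C" using set_le_sum(2)[OF D(2)] B0[OF D(1)] by auto
      qed (use C in auto)
      then show ?thesis using c C by auto
    qed
    ultimately show "A \<in> short_sets m \<alpha> \<and> (\<forall>B\<in>short_sets m \<alpha>. set_le B A)" by blast
  next
    assume A: "A \<in> short_sets m \<alpha> \<and> (\<forall>B\<in>short_sets m \<alpha>. set_le B A)"
    have "B = A" if "B \<in> short_sets m \<alpha>" "set_le A B" for B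
      using set_le_sum[of A B] set_le_sum[of B A] that A B0 by (metis le_antisym)
    moreover have "B = A" if "B \<in> short_code m \<alpha>" for B
      using that A unfolding short_code_def by blast
    ultimately show "short_code m \<alpha> = {A}" using A by (auto simp: short_code_def)
  }
qed

text \<open>The complex of facets of the cube meeting the hyperplane section has no missing face with
  more than two vertices.\<close>

definition flag :: bool where
  "flag \<longleftrightarrow> (\<forall>I\<subseteq>M. \<not> short m \<alpha> I \<longrightarrow> (\<exists>H\<subseteq>I. card H \<le> 2 \<and> \<not> short m \<alpha> H)) \<and>
     (\<forall>J\<subseteq>M. \<not> short m \<alpha> (insert m J) \<longrightarrow> (\<exists>H\<subseteq>J. card H \<le> 2 \<and> \<not> short m \<alpha> (insert m H)))"

lemma flag_m3: "m = 3 \<Longrightarrow> flag"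
proof -
  assume "m = 3"
  then have "card I \<le> 2" if "I \<subseteq> M" for I
    using card_mono[OF _ that] by simp
  then show ?thesis unfolding flag_def by blast
qed

text \<open>\<open>\<G>\<close> lists, without \<open>m\<close>, the small long sets containing
  \<open>m\<close>. The half of \<open>flag\<close> about subsets of \<open>M\<close> comes by
  complements: if \<open>I\<close> is long, then \<open>M - I\<close> contains no member of
  \<open>\<G>\<close>, and \<open>H\<close> is the complement of a short set around
  \<open>M - I\<close>.\<close>

lemma flagI:
  assumes A: "short m \<alpha> (insert m A)" "A \<subseteq> M"
    and gens: "\<And>G. G \<in> \<G> \<Longrightarrow> card G \<le> 2 \<and> \<not> short m \<alpha> (insert m G)"
    and J: "\<And>J. J \<subseteq> M \<Longrightarrow> (\<And>G. G \<in> \<G> \<Longrightarrow> \<not> G \<subseteq> J) \<Longrightarrow> short m \<alpha> (insert m J)"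
    and H: "\<And>J. J \<subseteq> M \<Longrightarrow> (\<And>G. G \<in> \<G> \<Longrightarrow> \<not> G \<subseteq> J) \<Longrightarrow> \<exists>H\<subseteq>M. card H \<le> 2 \<and> J \<inter> H = {} \<and> short m \<alpha> (insert m (M - H))"
  shows flag
  unfolding flag_def
proof (intro conjI allI impI)
  fix I assume I: "I \<subseteq> M" "\<not> short m \<alpha> I"
  then have s: "short m \<alpha> (insert m (M - I))" using not_short_compl_M by simp
  have "\<not> G \<subseteq> M - I" if "G \<in> \<G>" for G
    using gens[OF that] short_mono[OF s, of "insert m G"] by blast
  then obtain H where "H \<subseteq> M" "card H \<le> 2" "(M - I) \<inter> H = {}" "short m \<alpha> (insert m (M - H))"
    using H[of "M - I"] by auto
  then show "\<exists>H\<subseteq>I. card H \<le> 2 \<and> \<not> short m \<alpha> H"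
    using not_short_compl_M[of H] by (intro exI[of _ H]) auto
next
  fix J assume "J \<subseteq> M" "\<not> short m \<alpha> (insert m J)"
  then obtain G where "G \<in> \<G>" "G \<subseteq> J" using J by blast
  then show "\<exists>H\<subseteq>J. card H \<le> 2 \<and> \<not> short m \<alpha> (insert m H)" using gens by blast
qed

section \<open>From the four codes to the flag condition\<close>

definition max_code :: "nat set \<Rightarrow> bool" where
  "max_code A \<longleftrightarrow> short m \<alpha> (insert m A) \<and> (\<forall>J\<subseteq>M. short m \<alpha> (insert m J) \<longrightarrow> set_le (insert m J) (insert m A))"

lemma short_code_eq:
  assumes "A \<subseteq> M" shows "short_code m \<alpha> = {A \<union> {m}} \<longleftrightarrow> max_code A"
proof -
  have "insert m A \<in> short_sets m \<alpha> \<longleftrightarrow> short m \<alpha> (insert m A)"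
    using assms by (auto simp: short_sets_def short_iff)
  then show ?thesis
    by (auto simp: short_code_eq_singleton max_code_def short_sets_iff)
qed

text \<open>Passing up in \<open>set_le\<close> never lowers the number of elements that are at
  least \<open>k\<close>, so a set with more of them than the maximum cannot be short.\<close>

lemma max_code_card:
  assumes "max_code A" "A \<subseteq> M" "J \<subseteq> M" "card {i\<in>A. k \<le> i} < card {i\<in>J. k \<le> i}" "k \<le> m"
  shows "\<not> short m \<alpha> (insert m J)"
proof
  assume "short m \<alpha> (insert m J)"
  then have le: "set_le (insert m J) (insert m A)" using assms by (auto simp: max_code_def)
  have fin: "finite J" "finite A" using assms(2,3) finite_subset by blast+
  have "card {i\<in>insert m J. k \<le> i} = Suc (card {i\<in>J. k \<le> i})" if "finite J" "J \<subseteq> M" for J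
  proof -
    have "{i\<in>insert m J. k \<le> i} = insert m {i\<in>J. k \<le> i}" using assms(5) by auto
    moreover have "m \<notin> J" using that(2) m_notin_M by blast
    ultimately show ?thesis using that(1) by simp
  qed
  then show False using set_le_card[OF le, of k] fin assms(2-4) by simp
qed

text \<open>Both \<open>m-2\<close> and \<open>m-1\<close> are long together with \<open>m\<close>,
  so \<open>{1..m-3}\<close> with \<open>m\<close> is the only maximal short set containing
  \<open>m\<close>; its complement is the pair \<open>{m-2,m-1}\<close>.\<close>

lemma max_code_flag_1: "max_code {1..m-3} \<Longrightarrow> flag"
proof -
  assume c: "max_code {1..m-3}"
  have sub: "{1..m-3} \<subseteq> M" by auto
  have s: "short m \<alpha> (insert m {1..m-3})" using c by (simp add: max_code_def)
  have n: "\<not> short m \<alpha> {m, i}" if "i \<in> {m-2, m-1}" for i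
  proof -
    have e: "{j \<in> {1..m-3}. m-2 \<le> j} = {}" "{j \<in> {i}. m-2 \<le> j} = {i}" using that m3 by auto
    show ?thesis
      by (rule max_code_card[OF c sub, of "{i}" "m-2"], unfold e) (use that m3 in auto)
  qed
  show flag
  proof (rule flagI[OF s sub, of "{{m-2},{m-1}}"])
    fix J assume J: "J \<subseteq> M" "\<And>G. G \<in> {{m-2},{m-1}} \<Longrightarrow> \<not> G \<subseteq> J"
    have "J \<subseteq> {1..m-3}"
    proof
      fix j assume "j \<in> J"
      then have "j \<noteq> m - 2" "j \<noteq> m - 1" "j \<in> M" using J by auto
      then show "j \<in> {1..m-3}" by auto
    qed
    then show "short m \<alpha> (insert m J)" by (intro short_mono[OF s]) blast
    have "M - {m-2,m-1} = {1..m-3}" using m3 by auto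
    then show "\<exists>H\<subseteq>M. card H \<le> 2 \<and> J \<inter> H = {} \<and> short m \<alpha> (insert m (M - H))"
      using s J m3 by (intro exI[of _ "{m-2,m-1}"]) (auto simp: card_insert_if)
  qed (use n in auto)
qed

lemma max_code_flag_2: "max_code {1..m-2} \<Longrightarrow> flag"
proof -
  assume c: "max_code {1..m-2}"
  have sub: "{1..m-2} \<subseteq> M" by auto
  have s: "short m \<alpha> (insert m {1..m-2})" using c by (simp add: max_code_def)
  have n: "\<not> short m \<alpha> {m, m-1}"
  proof -
    have e: "{j \<in> {1..m-2}. m-1 \<le> j} = {}" "{j \<in> {m-1}. m-1 \<le> j} = {m-1}" using m3 by auto
    show ?thesis
      by (rule max_code_card[OF c sub, of "{m-1}" "m-1"], unfold e) (use m3 in auto)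
  qed
  show flag
  proof (rule flagI[OF s sub, of "{{m-1}}"])
    fix J assume J: "J \<subseteq> M" "\<And>G. G \<in> {{m-1}} \<Longrightarrow> \<not> G \<subseteq> J"
    have "J \<subseteq> {1..m-2}"
    proof
      fix j assume "j \<in> J"
      then have "j \<noteq> m - 1" "j \<in> M" using J by auto
      then show "j \<in> {1..m-2}" by auto
    qed
    then show "short m \<alpha> (insert m J)" by (intro short_mono[OF s]) blast
    have "M - {m-1} = {1..m-2}" using m3 by auto
    then show "\<exists>H\<subseteq>M. card H \<le> 2 \<and> J \<inter> H = {} \<and> short m \<alpha> (insert m (M - H))"
      using s J m3 by (intro exI[of _ "{m-1}"]) auto
  qed (use n in auto)
qed

text \<open>Two inclusion-maximal short sets arise, \<open>?A\<close> and \<open>{1..m-3}\<close>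
  with \<open>m\<close> added, since \<open>m-3\<close> and \<open>m-2\<close> cannot occur
  together. Their complements are \<open>{m-3,m-1}\<close> and \<open>{m-2,m-1}\<close>.\<close>

lemma max_code_flag_3: "m \<ge> 4 \<Longrightarrow> max_code ({1..m-4} \<union> {m-2}) \<Longrightarrow> flag"
proof -
  let ?A = "{1..m-4} \<union> {m-2}"
  assume m4: "m \<ge> 4" and c: "max_code ?A"
  have sub: "?A \<subseteq> M" using m4 by auto
  have s: "short m \<alpha> (insert m ?A)" using c by (simp add: max_code_def)
  have n1: "\<not> short m \<alpha> {m, m-1}"
  proof -
    have e: "{j \<in> ?A. m-1 \<le> j} = {}" "{j \<in> {m-1}. m-1 \<le> j} = {m-1}" using m4 by auto
    show ?thesis
      by (rule max_code_card[OF c sub, of "{m-1}" "m-1"], unfold e) (use m3 in auto)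
  qed
  have n2: "\<not> short m \<alpha> {m, m-3, m-2}"
  proof -
    have e: "{j \<in> ?A. m-3 \<le> j} = {m-2}" "{j \<in> {m-3,m-2}. m-3 \<le> j} = {m-3,m-2}" using m4 by auto
    show ?thesis
      by (rule max_code_card[OF c sub, of "{m-3,m-2}" "m-3"], unfold e) (use m4 in auto)
  qed
  have sr: "short m \<alpha> (insert m J)" if "J \<subseteq> {1..m-3}" for J
    by (rule short_replace[OF s sub, of J "m-3" "m-2"]) (use that m4 in \<open>auto simp: subset_iff\<close>)
  show flag
  proof (rule flagI[OF s sub, of "{{m-1},{m-3,m-2}}"])
    fix J assume J: "J \<subseteq> M" "\<And>G. G \<in> {{m-1},{m-3,m-2}} \<Longrightarrow> \<not> G \<subseteq> J"
    then have J': "m - 1 \<notin> J" "m - 3 \<notin> J \<or> m - 2 \<notin> J" by auto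
    have *: "J \<subseteq> {1..m-3} \<or> J \<subseteq> ?A"
    proof (cases "m - 2 \<in> J")
      case True
      have "j \<in> ?A" if "j \<in> J" for j
      proof -
        have "j \<noteq> m - 1" "j \<noteq> m - 3" "j \<in> M" using that J J' True by auto
        then show ?thesis by auto
      qed
      then show ?thesis by blast
    next
      case False
      have "j \<in> {1..m-3}" if "j \<in> J" for j
      proof -
        have "j \<noteq> m - 1" "j \<noteq> m - 2" "j \<in> M" using that J J' False by auto
        then show ?thesis by auto
      qed
      then show ?thesis by blast
    qed
    show "short m \<alpha> (insert m J)"
      using * by (rule disjE) (erule sr, rule short_mono[OF s], blast)
    have e: "M - {m-2,m-1} = {1..m-3}" "M - {m-3,m-1} = ?A" using m4 by auto
    show "\<exists>H\<subseteq>M. card H \<le> 2 \<and> J \<inter> H = {} \<and> short m \<alpha> (insert m (M - H))"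
    proof (cases "m - 2 \<in> J")
      case True
      show ?thesis
      proof (intro exI conjI)
        show "{m-3,m-1} \<subseteq> M" using m4 by auto
        show "card {m-3,m-1} \<le> 2" by (simp add: card_insert_if)
        show "J \<inter> {m-3,m-1} = {}" using J' True by auto
        show "short m \<alpha> (insert m (M - {m-3,m-1}))" unfolding e(2) by (rule s)
      qed
    next
      case False
      show ?thesis
      proof (intro exI conjI)
        show "{m-2,m-1} \<subseteq> M" using m4 by auto
        show "card {m-2,m-1} \<le> 2" by (simp add: card_insert_if)
        show "J \<inter> {m-2,m-1} = {}" using J' False by auto
        show "short m \<alpha> (insert m (M - {m-2,m-1}))" unfolding e(1) by (rule sr[OF subset_refl])
      qed
    qed
  qed (use n1 n2 in \<open>auto simp: card_insert_if\<close>)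
qed

text \<open>A short set containing \<open>m\<close> holds at most one of the three largest elements
  of \<open>M\<close>. The inclusion-maximal ones are \<open>{1..m-4}\<close> and \<open>m\<close>
  with one of these three, and each has a pair as complement.\<close>

lemma max_code_flag_4: "m \<ge> 4 \<Longrightarrow> max_code ({1..m-4} \<union> {m-1}) \<Longrightarrow> flag"
proof -
  let ?A = "{1..m-4} \<union> {m-1}" and ?T = "{m-3,m-2,m-1}"
  assume m4: "m \<ge> 4" and c: "max_code ?A"
  have sub: "?A \<subseteq> M" using m4 by auto
  have s: "short m \<alpha> (insert m ?A)" using c by (simp add: max_code_def)
  have n: "\<not> short m \<alpha> (insert m {i, j})" if "i \<in> ?T" "j \<in> ?T" "i \<noteq> j" for i j
  proof -
    have e: "{j \<in> ?A. m-3 \<le> j} = {m-1}" "{k \<in> {i,j}. m-3 \<le> k} = {i,j}" using m4 that by auto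
    show ?thesis
      by (rule max_code_card[OF c sub, of "{i,j}" "m-3"], unfold e) (use that m4 in auto)
  qed
  have sr: "short m \<alpha> (insert m J)" if "J \<subseteq> {1..m-4} \<union> {i}" "i \<in> ?T" for J i
    by (rule short_replace[OF s sub, of J i "m-1"]) (use that m4 in \<open>auto simp: subset_iff\<close>)
  have ex: "\<exists>i\<in>?T. J \<subseteq> {1..m-4} \<union> {i}"
    if J: "J \<subseteq> M" "\<And>G. G \<in> {{i, j} |i j. i \<in> ?T \<and> j \<in> ?T \<and> i \<noteq> j} \<Longrightarrow> \<not> G \<subseteq> J" for J
  proof -
    obtain i where i: "i \<in> ?T" "J \<inter> ?T \<subseteq> {i}"
    proof (cases "J \<inter> ?T = {}")
      case False
      then obtain i where "i \<in> J" "i \<in> ?T" by blast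
      moreover have "j = i" if "j \<in> J \<inter> ?T" for j
      proof (rule ccontr)
        assume "j \<noteq> i"
        then have "{i, j} \<in> {{i, j} |i j. i \<in> ?T \<and> j \<in> ?T \<and> i \<noteq> j}" using that \<open>i \<in> ?T\<close> by blast
        from J(2)[OF this] show False using that \<open>i \<in> J\<close> by blast
      qed
      ultimately show ?thesis using that by blast
    qed (use that in blast)
    have "j \<in> {1..m-4} \<union> {i}" if "j \<in> J" for j
    proof (cases "j \<in> ?T")
      case False
      then have "j \<noteq> m-1" "j \<noteq> m-2" "j \<noteq> m-3" "j \<in> M" using J that by auto
      then show ?thesis by auto
    qed (use i that in blast)
    then show ?thesis using i by blast
  qed
  show flag
  proof (rule flagI[OF s sub, of "{{i, j} |i j. i \<in> ?T \<and> j \<in> ?T \<and> i \<noteq> j}"])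
    fix J assume J: "J \<subseteq> M" "\<And>G. G \<in> {{i, j} |i j. i \<in> ?T \<and> j \<in> ?T \<and> i \<noteq> j} \<Longrightarrow> \<not> G \<subseteq> J"
    obtain i where i: "i \<in> ?T" "J \<subseteq> {1..m-4} \<union> {i}" using ex[OF J] by blast
    then show "short m \<alpha> (insert m J)" by (intro sr)
    have "M - (?T - {i}) = {1..m-4} \<union> {i}" using i m4 by auto
    then have "short m \<alpha> (insert m (M - (?T - {i})))" using sr[OF subset_refl i(1)] by simp
    moreover have "J \<inter> (?T - {i}) = {}"
    proof -
      have "?T \<inter> {1..m-4} = {}" using m4 by auto
      then show ?thesis using i(2) by blast
    qed
    moreover have "card (?T - {i}) \<le> 2"
    proof -
      have "card ?T \<le> 3" by (simp add: card_insert_if)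
      then show ?thesis using i(1) by (subst card_Diff_singleton) auto
    qed
    ultimately show "\<exists>H\<subseteq>M. card H \<le> 2 \<and> J \<inter> H = {} \<and> short m \<alpha> (insert m (M - H))"
      using m4 by (intro exI[of _ "?T - {i}"]) auto
  next
    fix G assume "G \<in> {{i, j} |i j. i \<in> ?T \<and> j \<in> ?T \<and> i \<noteq> j}"
    then show "card G \<le> 2 \<and> \<not> short m \<alpha> (insert m G)" using n by (auto simp: card_insert_if)
  qed
qed

section \<open>From the flag condition to the codes\<close>

lemma flag_pair:
  assumes flag "I \<subseteq> M" "\<not> short m \<alpha> I" "short m \<alpha> {m-1}"
  obtains i j where "i \<in> I" "j \<in> I" "i < j" "\<not> short m \<alpha> {i, j}"
proof -
  obtain H where H: "H \<subseteq> I" "card H \<le> 2" "\<not> short m \<alpha> H" using assms unfolding flag_def by blast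
  have fin: "finite H" by (rule finite_subset[OF order_trans[OF H(1) assms(2)] finite_atLeastAtMost])
  \<comment> \<open>Lengths increase on \<open>M\<close>, so shortness of \<open>{m-1}\<close>
    passes to all singletons and a long \<open>H\<close> must be a pair.\<close>
  have single: "short m \<alpha> {i}" if "i \<in> M" for i
  proof -
    have "\<alpha> i \<le> \<alpha> (m-1)" using mono\<alpha> that by (auto simp: mono_on_def)
    then show ?thesis using assms(4) that by (auto simp: short_iff)
  qed
  consider "card H = 0" | "card H = 1" | "card H = 2" using H by linarith
  then show ?thesis
  proof cases
    case 1
    then have "H = {}" using fin by simp
    then show ?thesis using H short_mono[OF short_m, of "{}"] by simp
  next
    case 2
    then obtain i where "H = {i}" using card_1_singletonE by blast
    then show ?thesis using H single assms by auto
  next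
    case 3
    then obtain i j where ij: "H = {i, j}" "i \<noteq> j" unfolding card_2_iff by (elim exE conjE)
    show ?thesis
    proof (cases "i < j")
      case True
      show ?thesis by (rule that[of i j]) (use H(1,3) ij True in simp_all)
    next
      case False
      have "H = {j, i}" using ij by blast
      then show ?thesis by (intro that[of j i]) (use H(1,3) ij False in simp_all)
    qed
  qed
qed

lemma not_short_pair_mono:
  assumes "\<not> short m \<alpha> {i, j}" "i < j" "i' < j'" "i \<le> i'" "j \<le> j'" "1 \<le> i" "j' \<le> m - 1"
  shows "\<not> short m \<alpha> {i', j'}"
proof -
  have "\<alpha> i \<le> \<alpha> i'" "\<alpha> j \<le> \<alpha> j'" using mono\<alpha> assms by (auto simp: mono_on_def)
  then show ?thesis using assms by (auto simp: short_iff)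
qed

lemma max_code_1:
  assumes "short m \<alpha> (insert m {1..m-3})" "\<And>i. i \<in> {m-2, m-1} \<Longrightarrow> \<not> short m \<alpha> {m, i}"
  shows "max_code {1..m-3}"
  unfolding max_code_def
proof (intro conjI allI impI)
  fix J assume J: "J \<subseteq> M" "short m \<alpha> (insert m J)"
  have "j \<in> {1..m-3}" if "j \<in> J" for j
  proof -
    have "short m \<alpha> {m, j}" by (rule short_mono[OF J(2)]) (use that in blast)
    then have "j \<noteq> m-2" "j \<noteq> m-1" "j \<in> M" using assms(2) J that by auto
    then show ?thesis by auto
  qed
  then show "set_le (insert m J) (insert m {1..m-3})" by (intro set_le_subset) blast
qed (fact assms)

lemma flag_max_code:
  assumes fl: flag
  shows "max_code {1..m-3} \<or> max_code {1..m-2} \<or>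
    m \<ge> 4 \<and> (max_code ({1..m-4} \<union> {m-2}) \<or> max_code ({1..m-4} \<union> {m-1}))"
proof (cases "short m \<alpha> {m-1}")
  \<comment> \<open>If \<open>{m-1}\<close> alone is long, its complement \<open>{1..m-2}\<close>
    with \<open>m\<close> is short, and every short set omits \<open>m-1\<close>: the second
    code.\<close>
  case False
  have M: "M - {m-1} = {1..m-2}" using m3 by auto
  then have s: "short m \<alpha> (insert m {1..m-2})"
    using not_short_compl_M[of "{m-1}"] False m3 by auto
  have "max_code {1..m-2}"
    unfolding max_code_def
  proof (intro conjI allI impI)
    fix J assume J: "J \<subseteq> M" "short m \<alpha> (insert m J)"
    have "m - 1 \<notin> J"
      using short_mono[OF J(2), of "{m-1}"] False by blast
    then have "J \<subseteq> {1..m-2}" using J M by blast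
    then show "set_le (insert m J) (insert m {1..m-2})" by (intro set_le_subset) blast
  qed (fact s)
  then show ?thesis by blast
next
  case True
  note pair = flag_pair[OF fl _ _ True]
  have m12: "m-1 \<in> M" "m-2 \<in> M" "m - 2 < m - 1" using m3 by auto
  \<comment> \<open>\<open>{m}\<close> is short, so \<open>M\<close> is long; the flag condition
    finds a long pair in \<open>M\<close>, and moving it up gives \<open>{m-2,m-1}\<close>.\<close>
  have "short m \<alpha> (insert m (M - M))" using short_m by simp
  then have "\<not> short m \<alpha> M" using not_short_compl_M[of M] by simp
  then obtain i j where ij: "i \<in> M" "j \<in> M" "i < j" "\<not> short m \<alpha> {i, j}" using pair[of M] by blast
  then have "\<not> short m \<alpha> {m-2, m-1}" by (intro not_short_pair_mono[OF ij(4,3)]) auto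
  moreover have M3: "M - {m-2,m-1} = {1..m-3}" using m3 by auto
  ultimately have s3: "short m \<alpha> (insert m {1..m-3})" using not_short_compl_M[of "{m-2,m-1}"] m12 by auto
  show ?thesis
  proof (cases "short m \<alpha> {m, m-2}")
    case False
    have "\<not> short m \<alpha> {m, m-1}"
    proof
      have "\<alpha> (m-2) \<le> \<alpha> (m-1)" using mono\<alpha> m12 by (auto simp: mono_on_def)
      moreover have "m \<noteq> m - 1" "m \<noteq> m - 2" using m3 by auto
      moreover assume "short m \<alpha> {m, m-1}"
      ultimately have "short m \<alpha> {m, m-2}" using m3 by (auto simp: short_iff)
      then show False using False by simp
    qed
    then show ?thesis using max_code_1[OF s3] False by blast
  next
    case m2: True
    \<comment> \<open>The complement of \<open>{m,m-2}\<close>. A long pair avoiding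
      \<open>m-2\<close> has its smaller entry at most \<open>m-3\<close>; this yields
      \<open>m \<ge> 4\<close> and, moved up, the long pair \<open>{m-3,m-1}\<close>.\<close>
    have "\<not> short m \<alpha> (M - {m-2})"
      using not_short_compl_M[of "M - {m-2}"] m2 m12 by (simp add: double_diff)
    then obtain i j where ij: "i \<in> M - {m-2}" "j \<in> M - {m-2}" "i < j" "\<not> short m \<alpha> {i, j}" using pair[of "M - {m-2}"] by blast
    then have ii: "i \<le> m - 3" "1 \<le> i" "j \<le> m - 1" "j \<in> M" by auto
    then have m4: "m \<ge> 4" by linarith
    have m31: "\<not> short m \<alpha> {m-3, m-1}" using ii m4 by (intro not_short_pair_mono[OF ij(4,3)]) auto
    have m13: "m - 3 \<in> M" "m - 3 < m - 2" using m4 by auto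
    have A3: "M - {m-3, m-1} = {1..m-4} \<union> {m-2}" using m4 by auto
    then have sA3: "short m \<alpha> (insert m ({1..m-4} \<union> {m-2}))"
      using not_short_compl_M[of "{m-3, m-1}"] m31 m12 m13 by auto
    show ?thesis
    proof (cases "short m \<alpha> {m, m-1}")
      case False
      \<comment> \<open>Otherwise every subset of \<open>{1..m-2}\<close> with at most two elements
        would be short together with \<open>m\<close>, against the flag condition:
        \<open>{1..m-2}\<close> with \<open>m\<close> is long, being the complement of the short
        \<open>{m-1}\<close>.\<close>
      have n32: "\<not> short m \<alpha> (insert m {m-3, m-2})"
      proof
        assume s: "short m \<alpha> (insert m {m-3, m-2})"
        have "\<not> short m \<alpha> (insert m {1..m-2})"
        proof
          assume "short m \<alpha> (insert m {1..m-2})"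
          moreover have "M - {m-1} = {1..m-2}" using m3 by auto
          ultimately show False using not_short_compl_M[of "{m-1}"] True m12 by auto
        qed
        moreover have "{1..m-2} \<subseteq> M" by auto
        ultimately obtain H where H: "H \<subseteq> {1..m-2}" "card H \<le> 2" "\<not> short m \<alpha> (insert m H)"
          using fl unfolding flag_def by meson
        have H0: "H \<noteq> {}" using H short_m by auto
        have mne: "m - 3 \<noteq> m - 2" "m \<noteq> m - 3" "m \<noteq> m - 2" using m4 by auto
        have "{1..m-2} \<subseteq> {1..m}" by auto
        then have sub: "insert m H \<subseteq> {1..m}" using H(1) m3 by (simp add: order_trans[OF H(1)])
        have s': "2 * (\<alpha> m + \<alpha> (m-3) + \<alpha> (m-2)) < sum \<alpha> {1..m}"
          using s mne unfolding short_iff by (simp add: add.assoc)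
        consider (one) x where "H = {x}" | (two) x y where "H = {x, y}" "x < y"
        proof -
          have "finite H" by (rule finite_subset[OF H(1) finite_atLeastAtMost])
          then have "card H = 1 \<or> card H = 2" using H H0 by (metis One_nat_def Suc_1 card_eq_0_iff le_SucE le_zero_eq)
          then show ?thesis
          proof
            assume "card H = 2"
            then obtain x y where xy: "H = {x, y}" "x \<noteq> y" unfolding card_2_iff by (elim exE conjE)
            then have "H = {y, x}" "x < y \<or> y < x" by auto
            then show ?thesis using that(2)[OF xy(1)] that(2)[of y x] by blast
          qed (use that(1) card_1_singletonE in blast)
        qed
        then have "short m \<alpha> (insert m H)"
        proof cases
          case (one x)
          then have x: "x \<in> M" "x \<le> m - 2" "x \<noteq> m" using H(1) m4 by auto
          then have "\<alpha> x \<le> \<alpha> (m-2)" using mono\<alpha> m12 by (auto simp: mono_on_def)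
          moreover have "0 < \<alpha> (m-3)" using posM m13 by simp
          moreover have "sum \<alpha> (insert m H) = \<alpha> m + \<alpha> x" using one x by simp
          ultimately show ?thesis using s' sub by (simp add: short_iff)
        next
          case (two x y)
          then have x: "x \<in> M" "x \<le> m - 3" "y \<in> M" "y \<le> m - 2" "x \<noteq> m" "y \<noteq> m" using H(1) m4 by auto
          then have "\<alpha> x \<le> \<alpha> (m-3)" "\<alpha> y \<le> \<alpha> (m-2)" using mono\<alpha> m12 m13 by (simp_all add: mono_on_def)
          moreover have "sum \<alpha> (insert m H) = \<alpha> m + \<alpha> x + \<alpha> y" using two x by simp
          ultimately show ?thesis using s' sub by (simp add: short_iff)
        qed
        then show False using H by simp
      qed
      have "max_code ({1..m-4} \<union> {m-2})"
        unfolding max_code_def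
      proof (intro conjI allI impI)
        fix J assume J: "J \<subseteq> M" "short m \<alpha> (insert m J)"
        have "m - 1 \<notin> J" using short_mono[OF J(2), of "{m, m-1}"] False by blast
        moreover have "\<not> (m - 2 \<in> J \<and> m - 3 \<in> J)" using short_mono[OF J(2), of "insert m {m-3, m-2}"] n32 by blast
        moreover have N: "M - {m-3, m-2, m-1} = {1..m-4}" "m - 2 \<notin> {1..m-4}" using m4 by auto
        ultimately consider "J \<subseteq> M - {m-3, m-1}" | "J - {m-3} \<subseteq> {1..m-4}" using J(1) by blast
        then show "set_le (insert m J) (insert m ({1..m-4} \<union> {m-2}))"
        proof cases
          case 1
          then show ?thesis unfolding A3 by (intro set_le_subset) blast
        next
          case 2
          have "m \<noteq> m - 2" using m4 by auto
          then show ?thesis using 2 N(2) by (intro set_le_replace[of _ "m-3" _ "m-2"]) auto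
        qed
      qed (fact sA3)
      then show ?thesis using m4 by blast
    next
      case m1: True
      \<comment> \<open>The same argument with \<open>m-1\<close> removed: a long pair below
        \<open>m-1\<close> moves up to \<open>{m-3,m-2}\<close>, so any two of the three largest
        elements of \<open>M\<close> form a long pair.\<close>
      have "\<not> short m \<alpha> (M - {m-1})"
        using not_short_compl_M[of "M - {m-1}"] m1 m12 by (simp add: double_diff)
      then obtain i j where ij: "i \<in> M - {m-1}" "j \<in> M - {m-1}" "i < j" "\<not> short m \<alpha> {i, j}" using pair[of "M - {m-1}"] by blast
      then have ii: "j \<le> m - 2" "1 \<le> i" by auto
      have m32: "\<not> short m \<alpha> {m-3, m-2}" using ii ij m4 by (intro not_short_pair_mono[OF ij(4,3)]) auto
      let ?T = "{m-3,m-2,m-1}"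
      have n: "\<not> short m \<alpha> {i, j}" if "i \<in> ?T" "j \<in> ?T" "i \<noteq> j" for i j
      proof -
        have "\<not> short m \<alpha> {m-2, m-1}" using m4 by (intro not_short_pair_mono[OF m32]) auto
        then show ?thesis using that m32 m31 by (auto simp: insert_commute)
      qed
      let ?A = "{1..m-4} \<union> {m-1}"
      have A: "M - {m-3, m-2} = ?A" using m4 by auto
      then have sA: "short m \<alpha> (insert m ?A)"
        using not_short_compl_M[of "{m-3, m-2}"] m32 m12 m13 by auto
      have "max_code ?A"
        unfolding max_code_def
      proof (intro conjI allI impI)
        fix J assume J: "J \<subseteq> M" "short m \<alpha> (insert m J)"
        have one: "i = j" if "i \<in> J" "j \<in> J" "i \<in> ?T" "j \<in> ?T" for i j
          using n[OF that(3,4)] short_mono[OF J(2), of "{i, j}"] that by blast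
        have "\<exists>x\<in>?T. J - {x} \<subseteq> {1..m-4}"
        proof (cases "J \<inter> ?T = {}")
          case True
          moreover have "M - ?T = {1..m-4}" using m4 by auto
          ultimately have "J \<subseteq> {1..m-4}" using J(1) by blast
          then show ?thesis by blast
        next
          case False
          then obtain x where x: "x \<in> J" "x \<in> ?T" by blast
          have "J - {x} \<subseteq> M - ?T" using one[OF x(1) _ x(2)] J by blast
          also have "M - ?T = {1..m-4}" using m4 by auto
          finally show ?thesis using x by blast
        qed
        then obtain x where x: "x \<in> ?T" "J - {x} \<subseteq> {1..m-4}" by blast
        show "set_le (insert m J) (insert m ?A)"
        proof (rule set_le_replace)
          have "m - 1 \<notin> {1..m-4}" "m \<noteq> m - 1" using m4 by auto
          then show "insert m J - {x} \<subseteq> insert m ?A - {m-1}" using x(2) by fastforce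
          show "x \<le> m - 1" using x m4 by auto
        qed auto
      qed (fact sA)
      then show ?thesis using m4 by blast
    qed
  qed
qed

theorem short_code_iff_flag:
  "short_code m \<alpha> = {{1..m-3} \<union> {m}} \<or>
     short_code m \<alpha> = {{1..m-2} \<union> {m}} \<or>
     short_code m \<alpha> = {{1..m-4} \<union> {m-2, m}} \<or>
     short_code m \<alpha> = {{1..m-4} \<union> {m-1, m}} \<longleftrightarrow> flag"
proof (cases "m = 3")
  \<comment> \<open>For \<open>m = 3\<close> truncated subtraction makes \<open>{1..m-4}\<close>
    empty, and \<open>flag\<close> is automatic because \<open>M\<close> has two elements; one of
    the first two codes then always occurs.\<close>
  case True
  then have "flag" using flag_m3 by simp
  have sub: "{1..m-3} \<subseteq> M" "{1..m-2} \<subseteq> M" by auto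
  from flag_max_code[OF \<open>flag\<close>] True have "max_code {1..m-3} \<or> max_code {1..m-2}" by simp
  then have "short_code m \<alpha> = {{1..m-3} \<union> {m}} \<or> short_code m \<alpha> = {{1..m-2} \<union> {m}}"
    using short_code_eq[OF sub(1)] short_code_eq[OF sub(2)] by blast
  then show ?thesis using \<open>flag\<close> by blast
next
  case False
  then have m4: "m \<ge> 4" using m3 by simp
  have sub: "{1..m-3} \<subseteq> M" "{1..m-2} \<subseteq> M" "{1..m-4} \<union> {m-2} \<subseteq> M" "{1..m-4} \<union> {m-1} \<subseteq> M" using m4 by auto
  have e: "{1..m-4} \<union> {m-2, m} = ({1..m-4} \<union> {m-2}) \<union> {m}" "{1..m-4} \<union> {m-1, m} = ({1..m-4} \<union> {m-1}) \<union> {m}" by auto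
  show ?thesis
    unfolding e short_code_eq[OF sub(1)] short_code_eq[OF sub(2)] short_code_eq[OF sub(3)] short_code_eq[OF sub(4)]
    using flag_max_code max_code_flag_1 max_code_flag_2 max_code_flag_3[OF m4] max_code_flag_4[OF m4] by blast
qed

end

section \<open>The double cover of the chain space\<close>

context lengths
begin

definition chset :: "(nat \<Rightarrow> real \<times> real) set" where "chset = topspace (chains m \<alpha>)"

lemma in_chset:
  "v \<in> chset \<longleftrightarrow> (\<forall>i\<in>M. (fst (v i))\<^sup>2 + (snd (v i))\<^sup>2 = 1) \<and> (\<forall>i. i \<notin> M \<longrightarrow> v i = undefined) \<and>
     (\<Sum>i\<in>M. \<alpha> i * fst (v i)) = \<alpha> m"
  by (auto simp: chset_def chains_def PiE_iff extensional_def sphere_prod_iff simp del: mem_sphere mem_sphere_0)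

lemma chset_abs_le_1: "v \<in> chset \<Longrightarrow> i \<in> M \<Longrightarrow> \<bar>fst (v i)\<bar> \<le> 1"
  using sum_power2_ge_zero[of "fst (v i)" "snd (v i)"] by (auto simp: in_chset abs_square_le_1[symmetric]) (smt (verit) atLeastAtMost_iff zero_le_power2)

lemma continuous_map_into_chains:
  assumes "\<And>z. z \<in> topspace Z \<Longrightarrow> f z \<in> chset"
    and "\<And>i. i \<in> M \<Longrightarrow> continuous_map Z euclideanreal (\<lambda>z. fst (f z i))"
    and "\<And>i. i \<in> M \<Longrightarrow> continuous_map Z euclideanreal (\<lambda>z. snd (f z i))"
  shows "continuous_map Z (chains m \<alpha>) f"
proof -
  have "continuous_map Z (top_of_set (sphere 0 1)) (\<lambda>z. f z i)" if i: "i \<in> M" for i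
  proof -
    have "continuous_map Z (prod_topology euclideanreal euclideanreal) (\<lambda>z. f z i)"
      unfolding continuous_map_pairwise using assms(2,3)[OF i] by (simp add: o_def)
    moreover have "f z i \<in> sphere 0 1" if "z \<in> topspace Z" for z
      using assms(1)[OF that] i by (simp add: in_chset sphere_prod_iff del: mem_sphere mem_sphere_0)
    ultimately show ?thesis by (simp add: continuous_map_in_subtopology Pi_iff del: mem_sphere mem_sphere_0)
  qed
  moreover have "f \<in> topspace Z \<rightarrow> extensional M"
    using assms(1) by (auto simp: in_chset extensional_def)
  moreover have "(\<Sum>i=1..m-1. \<alpha> i * fst (f z i)) = \<alpha> m" if "z \<in> topspace Z" for z
    using assms(1)[OF that] by (simp add: in_chset)
  ultimately show ?thesis
    unfolding chains_def continuous_map_in_subtopology continuous_map_componentwise by auto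
qed

lemma continuous_map_chains_coord:
  assumes "i \<in> M"
  shows "continuous_map (chains m \<alpha>) euclideanreal (\<lambda>v. fst (v i))" "continuous_map (chains m \<alpha>) euclideanreal (\<lambda>v. snd (v i))"
proof -
  have "continuous_map (chains m \<alpha>) (top_of_set (sphere 0 1)) (\<lambda>v. v i)"
    unfolding chains_def using assms by (intro continuous_map_from_subtopology continuous_map_product_projection)
  then have "continuous_map (chains m \<alpha>) (prod_topology euclideanreal euclideanreal) (\<lambda>v. v i)"
    using continuous_map_into_fulltopology by auto
  then show "continuous_map (chains m \<alpha>) euclideanreal (\<lambda>v. fst (v i))" "continuous_map (chains m \<alpha>) euclideanreal (\<lambda>v. snd (v i))"
    unfolding continuous_map_pairwise by (simp_all add: o_def)
qed

lemma Hausdorff_chains: "Hausdorff_space (chains m \<alpha>)"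
  unfolding chains_def
  by (intro Hausdorff_space_subtopology) (simp add: Hausdorff_space_product_topology Hausdorff_space_subtopology)

lemma reflect_chset: "v \<in> chset \<Longrightarrow> reflect m v \<in> chset" "v \<in> chset \<Longrightarrow> reflect m (reflect m v) = v"
  unfolding chset_def by (fact reflect_chains)+

lemma reflect_apply: "i \<in> M \<Longrightarrow> reflect m v i = (fst (v i), - snd (v i))"
  by (simp add: reflect_def)

lemma continuous_map_reflect: "continuous_map (chains m \<alpha>) (chains m \<alpha>) (reflect m)"
proof (rule continuous_map_into_chains)
  fix i assume "i \<in> M"
  then show "continuous_map (chains m \<alpha>) euclideanreal (\<lambda>v. fst (reflect m v i))"
    "continuous_map (chains m \<alpha>) euclideanreal (\<lambda>v. snd (reflect m v i))"
    using continuous_map_chains_coord by (auto simp: reflect_apply intro!: continuous_map_minus)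
qed (use reflect_chset in \<open>simp add: chset_def[symmetric]\<close>)

text \<open>If all second coordinates vanished, the first ones would be signs and, with sign -1 at
  \<open>m\<close>, would contradict genericity. Hence \<open>reflect\<close> has no fixed
  chain.\<close>

lemma chset_snd_nonzero:
  assumes "v \<in> chset"
  obtains i where "i \<in> M" "snd (v i) \<noteq> 0"
proof -
  have "\<exists>i\<in>M. snd (v i) \<noteq> 0"
  proof (rule ccontr)
    assume "\<not> (\<exists>i\<in>M. snd (v i) \<noteq> 0)"
    then have x: "fst (v i) = 1 \<or> fst (v i) = -1" if "i \<in> M" for i
      using assms that by (auto simp: in_chset power2_eq_1_iff)
    define \<epsilon> where "\<epsilon> i = (if i = m then -1 else fst (v i))" for i
    have "(\<Sum>i=1..m. \<epsilon> i * \<alpha> i) = - \<alpha> m + (\<Sum>i\<in>M. \<epsilon> i * \<alpha> i)"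
      unfolding insert_M[symmetric] using m_notin_M by (subst sum.insert) (auto simp: \<epsilon>_def)
    also have "(\<Sum>i\<in>M. \<epsilon> i * \<alpha> i) = (\<Sum>i\<in>M. \<alpha> i * fst (v i))"
      using m3 by (intro sum.cong) (auto simp: \<epsilon>_def)
    finally have "(\<Sum>i=1..m. \<epsilon> i * \<alpha> i) = 0" using assms by (simp add: in_chset)
    moreover have "\<epsilon> i \<in> {-1, 1}" if "i \<in> {1..m}" for i
      using x[of i] that by (auto simp: \<epsilon>_def)
    ultimately show False using gen unfolding generic_def by blast
  qed
  then show ?thesis using that by blast
qed

definition qmap :: "(nat \<Rightarrow> real \<times> real) \<Rightarrow> (nat \<Rightarrow> real \<times> real) set" where
  "qmap v = {v, reflect m v}"

lemma quotient_map_qmap: "quotient_map (chains m \<alpha>) (chain_space m \<alpha>) qmap"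
proof -
  have "qmap = (\<lambda>v. {v, reflect m v})" by (auto simp: qmap_def)
  then show ?thesis by (simp add: chain_space_def quotient_map_quotient_topology)
qed

lemma qmap_eq_iff: "v \<in> chset \<Longrightarrow> w \<in> chset \<Longrightarrow> qmap v = qmap w \<longleftrightarrow> v = w \<or> v = reflect m w"
  using reflect_chset(2)[of v] reflect_chset(2)[of w] unfolding qmap_def by (metis doubleton_eq_iff)

lemma topspace_chain_space: "topspace (chain_space m \<alpha>) = qmap ` chset"
  using quotient_map_qmap by (simp add: quotient_map_def chset_def)

lemma openin_chains_coord:
  assumes "i \<in> M"
  shows "openin (chains m \<alpha>) {w \<in> chset. c * snd (w i) > 0}"
proof -
  have "continuous_map (chains m \<alpha>) euclideanreal (\<lambda>w. c * snd (w i))"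
    using continuous_map_chains_coord(2)[OF assms] by (intro continuous_map_real_mult_left)
  from openin_continuous_map_preimage[OF this, of "{0<..}"] show ?thesis by (simp add: chset_def)
qed

text \<open>Near a chain with \<open>snd (v i) \<noteq> 0\<close> the sign of this one coordinate
  tells the two preimages apart.\<close>

lemma cover_map_qmap: "cover_map (chains m \<alpha>) (chain_space m \<alpha>) qmap"
  unfolding cover_map_def
proof (intro conjI ballI)
  show "continuous_map (chains m \<alpha>) (chain_space m \<alpha>) qmap"
    using quotient_map_qmap by (rule quotient_imp_continuous_map)
  show "Hausdorff_space (chains m \<alpha>)" by (rule Hausdorff_chains)
  fix v assume "v \<in> topspace (chains m \<alpha>)"
  then have v: "v \<in> chset" by (simp add: chset_def)
  then obtain i where i: "i \<in> M" "snd (v i) \<noteq> 0" using chset_snd_nonzero by blast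
  let ?N = "{w \<in> chset. snd (v i) * snd (w i) > 0}"
  have "inj_on qmap ?N"
  proof (rule inj_onI)
    fix a b assume ab: "a \<in> ?N" "b \<in> ?N" "qmap a = qmap b"
    have "a \<noteq> reflect m b"
    proof
      assume "a = reflect m b"
      then have "snd (a i) = - snd (b i)" using i(1) by (simp add: reflect_apply)
      then show False using ab by auto
    qed
    then show "a = b" using ab qmap_eq_iff by blast
  qed
  moreover have "v \<in> ?N" using v i by (auto simp: zero_less_mult_iff neq_iff)
  ultimately show "\<exists>N. openin (chains m \<alpha>) N \<and> v \<in> N \<and> inj_on qmap N"
    using openin_chains_coord[OF i(1), of "snd (v i)"] by blast
next
  fix x assume "x \<in> topspace (chain_space m \<alpha>)"
  then obtain v where v: "v \<in> chset" "x = qmap v" by (auto simp: topspace_chain_space)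
  then obtain i where i: "i \<in> M" "snd (v i) \<noteq> 0" using chset_snd_nonzero by blast
  let ?N = "{w \<in> chset. snd (w i) \<noteq> 0}"
  let ?V = "qmap ` ?N"
  have refl_i: "snd (reflect m w i) = - snd (w i)" for w using i(1) by (simp add: reflect_apply)
  have N: "{w \<in> topspace (chains m \<alpha>). qmap w \<in> ?V} = ?N"
    using qmap_eq_iff refl_i by (auto simp: chset_def[symmetric])
  have oN: "openin (chains m \<alpha>) ?N"
  proof -
    have "?N = {w \<in> chset. 1 * snd (w i) > 0} \<union> {w \<in> chset. (-1) * snd (w i) > 0}" by auto
    then show ?thesis by (simp only:) (intro openin_Un openin_chains_coord i(1))
  qed
  have oV: "openin (chain_space m \<alpha>) ?V"
  proof -
    have "?V \<subseteq> topspace (chain_space m \<alpha>)" by (auto simp: topspace_chain_space)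
    moreover have "openin (chains m \<alpha>) {w \<in> topspace (chains m \<alpha>). qmap w \<in> ?V}" unfolding N by (rule oN)
    ultimately show ?thesis using quotient_map_qmap unfolding quotient_map_def by blast
  qed
  show "\<exists>V. openin (chain_space m \<alpha>) V \<and> x \<in> V \<and>
        (\<forall>e\<in>topspace (chains m \<alpha>). qmap e \<in> V \<longrightarrow>
           (\<exists>\<sigma>. continuous_map (subtopology (chain_space m \<alpha>) V) (chains m \<alpha>) \<sigma> \<and> (\<forall>z\<in>V. qmap (\<sigma> z) = z) \<and> \<sigma> (qmap e) = e))"
  proof (intro exI[of _ ?V] conjI ballI impI oV)
    show "x \<in> ?V" using v i by auto
    fix e assume e: "e \<in> topspace (chains m \<alpha>)" "qmap e \<in> ?V"
    then have eN: "e \<in> ?N" using N by blast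
    let ?c = "snd (e i)"
    \<comment> \<open>Of \<open>w\<close> and its reflection, the one whose second coordinate at
      \<open>i\<close> has the same sign as that of \<open>e\<close>.\<close>
    define s where "s w = (if ?c * snd (w i) > 0 then w else reflect m w)" for w
    have sN: "s w \<in> chset" "qmap (s w) = qmap w" "?c * snd (s w i) > 0" if "w \<in> ?N" for w
    proof -
      show "s w \<in> chset" using that reflect_chset by (auto simp: s_def)
      show "qmap (s w) = qmap w" using that reflect_chset qmap_eq_iff by (auto simp: s_def)
      have "?c * snd (w i) \<noteq> 0" using that eN by auto
      then show "?c * snd (s w i) > 0" using refl_i[of w] by (auto simp: s_def zero_less_mult_iff mult_less_0_iff not_less)
    qed
    have q: "quotient_map (subtopology (chains m \<alpha>) ?N) (subtopology (chain_space m \<alpha>) ?V) qmap"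
      by (rule quotient_map_restriction[OF quotient_map_qmap N]) (use oV in simp)
    have cs: "continuous_map (subtopology (chains m \<alpha>) ?N) (chains m \<alpha>) s"
    proof (rule pasting_lemma[where I = UNIV and T = "\<lambda>b. {w \<in> chset. (if b then ?c else - ?c) * snd (w i) > 0}" and f = "\<lambda>b. if b then id else reflect m"])
      fix b :: bool
      have "openin (chains m \<alpha>) {w \<in> chset. (if b then ?c else - ?c) * snd (w i) > 0}"
        by (rule openin_chains_coord[OF i(1)])
      then show "openin (subtopology (chains m \<alpha>) ?N) {w \<in> chset. (if b then ?c else - ?c) * snd (w i) > 0}"
        unfolding openin_subtopology
        by (intro exI[of _ "{w \<in> chset. (if b then ?c else - ?c) * snd (w i) > 0}"] conjI) auto
      show "continuous_map (subtopology (subtopology (chains m \<alpha>) ?N) {w \<in> chset. (if b then ?c else - ?c) * snd (w i) > 0}) (chains m \<alpha>) (if b then id else reflect m)"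
        using continuous_map_reflect by (auto intro!: continuous_map_from_subtopology)
    next
      fix b b' :: bool and w assume "w \<in> topspace (subtopology (chains m \<alpha>) ?N) \<inter> {w \<in> chset. (if b then ?c else - ?c) * snd (w i) > 0} \<inter> {w \<in> chset. (if b' then ?c else - ?c) * snd (w i) > 0}"
      then have "b = b'" by (auto split: if_splits)
      then show "(if b then id else reflect m) w = (if b' then id else reflect m) w" by simp
    next
      fix w assume "w \<in> topspace (subtopology (chains m \<alpha>) ?N)"
      then have w: "w \<in> chset" "snd (w i) \<noteq> 0" by auto
      then have "?c * snd (w i) \<noteq> 0" using eN by auto
      then have "?c * snd (w i) > 0 \<or> ?c * snd (w i) < 0" by linarith
      then show "\<exists>j. j \<in> UNIV \<and> w \<in> {w \<in> chset. (if j then ?c else - ?c) * snd (w i) > 0} \<and> s w = (if j then id else reflect m) w"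
        using w by (intro exI[of _ "?c * snd (w i) > 0"]) (auto simp: s_def)
    qed
    have wd: "s w = s w'" if "w \<in> topspace (subtopology (chains m \<alpha>) ?N)" "w' \<in> topspace (subtopology (chains m \<alpha>) ?N)" "qmap w = qmap w'" for w w'
    proof -
      have w: "w \<in> ?N" "w' \<in> ?N" using that by auto
      then have "qmap (s w) = qmap (s w')" using sN(2) that by simp
      then have "s w = s w' \<or> s w = reflect m (s w')" using qmap_eq_iff sN(1) w by simp
      moreover have "s w \<noteq> reflect m (s w')"
      proof
        assume "s w = reflect m (s w')"
        then have "snd (s w i) = - snd (s w' i)" using refl_i by simp
        then show False using sN(3)[OF w(1)] sN(3)[OF w(2)] by simp
      qed
      ultimately show ?thesis by blast
    qed
    obtain \<sigma> where \<sigma>: "continuous_map (subtopology (chain_space m \<alpha>) ?V) (chains m \<alpha>) \<sigma>"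
      "\<And>w. w \<in> topspace (subtopology (chains m \<alpha>) ?N) \<Longrightarrow> \<sigma> (qmap w) = s w"
    proof (rule quotient_map_lift_exists[OF q cs wd])
      fix g assume "continuous_map (subtopology (chain_space m \<alpha>) ?V) (chains m \<alpha>) g"
        and "\<And>w. w \<in> topspace (subtopology (chains m \<alpha>) ?N) \<Longrightarrow> g (qmap w) = s w"
      then show thesis by (rule that)
    qed
    have tN: "topspace (subtopology (chains m \<alpha>) ?N) = ?N" by (auto simp: chset_def)
    have \<sigma>2: "\<sigma> (qmap w) = s w" if "w \<in> ?N" for w by (rule \<sigma>(2)) (unfold tN, rule that)
    show "\<exists>\<sigma>. continuous_map (subtopology (chain_space m \<alpha>) ?V) (chains m \<alpha>) \<sigma> \<and> (\<forall>z\<in>?V. qmap (\<sigma> z) = z) \<and> \<sigma> (qmap e) = e"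
    proof (intro exI[of _ \<sigma>] conjI ballI \<sigma>(1))
      fix z assume "z \<in> ?V"
      then obtain w where w: "w \<in> ?N" "z = qmap w" by blast
      then show "qmap (\<sigma> z) = z" using \<sigma>2[OF w(1)] sN(2)[OF w(1)] by simp
    next
      have "s e = e" using eN by (auto simp: s_def zero_less_mult_iff)
      then show "\<sigma> (qmap e) = e" using \<sigma>2[OF eN] by simp
    qed
  qed
qed

end

section \<open>The polytope of first coordinates\<close>

context lengths
begin

definition P :: "(nat \<Rightarrow> real) set" where
  "P = {x. (\<forall>i\<in>M. \<bar>x i\<bar> \<le> 1) \<and> (\<forall>i. i \<notin> M \<longrightarrow> x i = 0) \<and> (\<Sum>i\<in>M. \<alpha> i * x i) = \<alpha> m}"

definition X :: "(nat \<Rightarrow> real) topology" where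
  "X = subtopology (powertop_real UNIV) P"

definition val :: "bool \<Rightarrow> real" where "val b = (if b then 1 else -1)"

definition mir :: "nat \<times> bool \<Rightarrow> (nat \<Rightarrow> real) set" where
  "mir s = {x \<in> P. x (fst s) = val (snd s)}"

text \<open>Only nonempty facets become generators, so a coordinate can contribute two, one or none
  of them.\<close>

definition facets :: "(nat \<times> bool) set" where
  "facets = {s. fst s \<in> M \<and> mir s \<noteq> {}}"

definition comm :: "nat \<times> bool \<Rightarrow> nat \<times> bool \<Rightarrow> bool" where
  "comm s t \<longleftrightarrow> s \<noteq> t \<and> mir s \<inter> mir t \<noteq> {}"

lemma topspace_X: "topspace X = P"
  by (simp add: X_def)

lemma continuous_map_into_X:
  assumes "\<And>z. z \<in> topspace Z \<Longrightarrow> f z \<in> P" "\<And>i. i \<in> M \<Longrightarrow> continuous_map Z euclideanreal (\<lambda>z. f z i)"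
  shows "continuous_map Z X f"
  unfolding X_def continuous_map_in_subtopology continuous_map_componentwise_UNIV
proof (intro conjI allI)
  fix k show "continuous_map Z euclideanreal (\<lambda>z. f z k)"
  proof (cases "k \<in> M")
    case False
    have "continuous_map Z euclideanreal (\<lambda>z. 0)" by simp
    then show ?thesis
      by (rule continuous_map_eq) (use assms(1) False in \<open>auto simp: P_def\<close>)
  qed (use assms(2) in simp)
qed (use assms(1) in auto)

lemma continuous_map_X_coord: "continuous_map X euclideanreal (\<lambda>x. x i)"
  unfolding X_def by (intro continuous_map_from_subtopology continuous_map_product_projection) simp

lemma sum_M_split:
  fixes g :: "nat \<Rightarrow> real"
  assumes "I \<subseteq> M" "J \<subseteq> M" "I \<inter> J = {}"
  shows "sum g M = sum g I + sum g J + sum g (M - I - J)"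
proof -
  have "sum g M = sum g (M - I) + sum g I" using assms by (intro sum.subset_diff) auto
  moreover have "sum g (M - I) = sum g (M - I - J) + sum g J" using assms by (intro sum.subset_diff) auto
  ultimately show ?thesis by simp
qed

lemma sum_total: "sum \<alpha> {Suc 0..m} = \<alpha> m + sum \<alpha> {Suc 0..m - Suc 0}"
proof -
  have "sum \<alpha> {1..m} = \<alpha> m + sum \<alpha> M"
    unfolding insert_M[symmetric] using m_notin_M by (subst sum.insert) auto
  then show ?thesis by simp
qed

lemma short_I_iff: "I \<subseteq> M \<Longrightarrow> short m \<alpha> I \<longleftrightarrow> sum \<alpha> I < \<alpha> m + sum \<alpha> (M - I)"
  using sum_M_split[of I "{}" \<alpha>] order_trans[OF _ M_subset, of I] by (auto simp: short_iff sum_total)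

lemma short_J_iff:
  assumes J: "J \<subseteq> M"
  shows "short m \<alpha> (insert m J) \<longleftrightarrow> \<alpha> m + sum \<alpha> J < sum \<alpha> (M - J)"
proof -
  have "m \<notin> J" "finite J" using J m_notin_M finite_subset[OF J] by auto
  moreover have "insert m J \<subseteq> {1..m}" using order_trans[OF J M_subset] m3 by simp
  ultimately show ?thesis using sum_M_split[of J "{}" \<alpha>] J by (auto simp: short_iff sum_total)
qed

text \<open>With \<open>x i = 1\<close> on \<open>I\<close> the other coordinates must compensate,
  and they contribute no less than minus their total weight.\<close>

lemma face_short:
  assumes x: "x \<in> P" and "I \<subseteq> M" "\<And>i. i \<in> I \<Longrightarrow> x i = 1"
  shows "short m \<alpha> I"
proof (rule ccontr)
  assume "\<not> short m \<alpha> I"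
  moreover have "I \<subseteq> {1..m}" using assms(2) M_subset by (rule order_trans)
  ultimately have "2 * sum \<alpha> I > sum \<alpha> {1..m}" using generic_sum[of I] by (auto simp: short_iff)
  moreover have "sum \<alpha> M = sum \<alpha> I + sum \<alpha> (M - I)" using sum_M_split[of I "{}" \<alpha>] assms(2) by simp
  ultimately have gt: "sum \<alpha> I > \<alpha> m + sum \<alpha> (M - I)" by (simp add: sum_total)
  have "\<alpha> m = (\<Sum>i\<in>I. \<alpha> i * x i) + (\<Sum>i\<in>M - I. \<alpha> i * x i)"
    using x sum_M_split[of I "{}" "\<lambda>i. \<alpha> i * x i"] assms(2) by (simp add: P_def)
  also have "(\<Sum>i\<in>I. \<alpha> i * x i) = sum \<alpha> I" using assms(3) by (intro sum.cong) auto
  finally have e: "\<alpha> m = sum \<alpha> I + (\<Sum>i\<in>M - I. \<alpha> i * x i)" .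
  have "- sum \<alpha> (M - I) \<le> (\<Sum>i\<in>M - I. \<alpha> i * x i)"
    unfolding sum_negf[symmetric]
  proof (rule sum_mono)
    fix i assume "i \<in> M - I"
    then have "- 1 \<le> x i" "0 < \<alpha> i" using x posM by (auto simp: P_def abs_le_iff)
    then have "\<alpha> i * (- 1) \<le> \<alpha> i * x i" by (intro mult_left_mono) auto
    then show "- \<alpha> i \<le> \<alpha> i * x i" by simp
  qed
  then show False using gt e by linarith
qed

lemma face_short':
  assumes x: "x \<in> P" and "J \<subseteq> M" "\<And>i. i \<in> J \<Longrightarrow> x i = -1"
  shows "short m \<alpha> (insert m J)"
proof (rule ccontr)
  assume n: "\<not> short m \<alpha> (insert m J)"
  have J: "m \<notin> J" "finite J" "insert m J \<subseteq> {1..m}"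
    using assms(2) m_notin_M finite_subset[OF assms(2)] order_trans[OF assms(2) M_subset] m3 by auto
  then have "2 * sum \<alpha> (insert m J) > sum \<alpha> {1..m}" using generic_sum[of "insert m J"] n by (auto simp: short_iff)
  moreover have "sum \<alpha> M = sum \<alpha> J + sum \<alpha> (M - J)" using sum_M_split[of J "{}" \<alpha>] assms(2) by simp
  ultimately have gt: "\<alpha> m + sum \<alpha> J > sum \<alpha> (M - J)" using J by (simp add: sum_total)
  have "\<alpha> m = (\<Sum>i\<in>J. \<alpha> i * x i) + (\<Sum>i\<in>M - J. \<alpha> i * x i)"
    using x sum_M_split[of J "{}" "\<lambda>i. \<alpha> i * x i"] assms(2) by (simp add: P_def)
  also have "(\<Sum>i\<in>J. \<alpha> i * x i) = - sum \<alpha> J" unfolding sum_negf[symmetric] using assms(3) by (intro sum.cong) auto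
  finally have e: "\<alpha> m = - sum \<alpha> J + (\<Sum>i\<in>M - J. \<alpha> i * x i)" .
  have "(\<Sum>i\<in>M - J. \<alpha> i * x i) \<le> sum \<alpha> (M - J)"
  proof (rule sum_mono)
    fix i assume "i \<in> M - J"
    then have "x i \<le> 1" "0 < \<alpha> i" using x posM by (auto simp: P_def abs_le_iff)
    then have "\<alpha> i * x i \<le> \<alpha> i * 1" by (intro mult_left_mono) auto
    then show "\<alpha> i * x i \<le> \<alpha> i" by simp
  qed
  then show False using gt e by linarith
qed

text \<open>\<open>D\<close> is what the free coordinates must contribute and \<open>R\<close> is
  their total weight. Shortness of \<open>I\<close> amounts to \<open>- R < D\<close> and shortness
  of \<open>insert m J\<close> to \<open>D < R\<close>, so the two kinds of facets obstruct a face
  independently.\<close>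

lemma free_weight:
  assumes "I \<subseteq> M" "J \<subseteq> M" "I \<inter> J = {}" "short m \<alpha> I" "short m \<alpha> (insert m J)"
  defines "D \<equiv> \<alpha> m - sum \<alpha> I + sum \<alpha> J" and "R \<equiv> sum \<alpha> (M - I - J)"
  shows "- R < D" "D < R"
proof -
  have "sum \<alpha> M = sum \<alpha> I + sum \<alpha> J + R" using sum_M_split[OF assms(1-3)] by (simp add: R_def)
  moreover have "sum \<alpha> M = sum \<alpha> I + sum \<alpha> (M - I)" "sum \<alpha> M = sum \<alpha> J + sum \<alpha> (M - J)"
    using sum_M_split[of I "{}" \<alpha>] sum_M_split[of J "{}" \<alpha>] assms by simp_all
  ultimately show "- R < D" "D < R"
    using assms(4,5) short_I_iff[OF assms(1)] short_J_iff[OF assms(2)] by (auto simp: D_def)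
qed

lemma face_in_P:
  assumes "I \<subseteq> M" "J \<subseteq> M" "I \<inter> J = {}"
    and "\<And>i. i \<in> I \<Longrightarrow> x i = 1" "\<And>i. i \<in> J \<Longrightarrow> x i = -1" "\<And>i. i \<in> M - I - J \<Longrightarrow> \<bar>x i\<bar> \<le> 1" "\<And>i. i \<notin> M \<Longrightarrow> x i = 0"
  shows "x \<in> P \<longleftrightarrow> (\<Sum>i\<in>M - I - J. \<alpha> i * x i) = \<alpha> m - sum \<alpha> I + sum \<alpha> J"
proof -
  have "(\<Sum>i\<in>I. \<alpha> i * x i) = sum \<alpha> I" using assms(4) by (intro sum.cong) auto
  moreover have "(\<Sum>i\<in>J. \<alpha> i * x i) = - sum \<alpha> J" unfolding sum_negf[symmetric] using assms(5) by (intro sum.cong) auto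
  ultimately have "(\<Sum>i\<in>M. \<alpha> i * x i) = sum \<alpha> I - sum \<alpha> J + (\<Sum>i\<in>M - I - J. \<alpha> i * x i)"
    using sum_M_split[OF assms(1-3), of "\<lambda>i. \<alpha> i * x i"] by simp
  moreover have "\<bar>x i\<bar> \<le> 1" if "i \<in> M" for i
    using assms(4-6)[of i] that by (cases "i \<in> I"; cases "i \<in> J") auto
  ultimately show ?thesis using assms(7) by (auto simp: P_def)
qed

text \<open>Giving all free coordinates the common value \<open>D / R\<close> solves the linear
  equation.\<close>

lemma face_nonempty:
  assumes "I \<subseteq> M" "J \<subseteq> M" "I \<inter> J = {}" "short m \<alpha> I" "short m \<alpha> (insert m J)"
  obtains x where "x \<in> P" "\<And>i. i \<in> I \<Longrightarrow> x i = 1" "\<And>i. i \<in> J \<Longrightarrow> x i = -1"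
proof -
  define D where "D = \<alpha> m - sum \<alpha> I + sum \<alpha> J"
  define R where "R = sum \<alpha> (M - I - J)"
  have DR: "- R < D" "D < R" using free_weight[OF assms] by (simp_all add: D_def R_def)
  define x where "x i = (if i \<in> I then 1 else if i \<in> J then -1 else if i \<in> M then D / R else 0)" for i
  have "x \<in> P \<longleftrightarrow> (\<Sum>i\<in>M - I - J. \<alpha> i * x i) = \<alpha> m - sum \<alpha> I + sum \<alpha> J"
  proof (rule face_in_P[OF assms(1-3)])
    show "\<bar>x i\<bar> \<le> 1" if "i \<in> M - I - J" for i
      using that DR by (simp add: x_def abs_le_iff field_simps)
  qed (use assms(1-3) in \<open>auto simp: x_def\<close>)
  moreover have "(\<Sum>i\<in>M - I - J. \<alpha> i * x i) = (\<Sum>i\<in>M - I - J. \<alpha> i * (D / R))"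
    by (intro sum.cong) (auto simp: x_def)
  moreover have "\<dots> = D" using DR unfolding sum_distrib_right[symmetric] R_def[symmetric] by simp
  ultimately have "x \<in> P" by (simp add: D_def)
  moreover have "x i = 1" if "i \<in> I" for i using that by (simp add: x_def)
  moreover have "x i = -1" if "i \<in> J" for i using that assms(3) by (auto simp: x_def)
  ultimately show ?thesis using that by blast
qed

text \<open>The values of the free coordinates, obtained from Tietze's theorem, are moved towards
  \<open>1\<close> or \<open>-1\<close> until the linear equation holds.\<close>

lemma extensor_face:
  assumes Z: "metrizable_space Z"
    and IJ: "I \<subseteq> M" "J \<subseteq> M" "I \<inter> J = {}" "short m \<alpha> I" "short m \<alpha> (insert m J)"
  shows "extensor Z X {x \<in> P. (\<forall>i\<in>I. x i = 1) \<and> (\<forall>i\<in>J. x i = -1)}" (is "extensor Z X ?C")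
  unfolding extensor_def
proof (intro allI impI, elim conjE)
  fix K A f
  assume K: "closedin Z K" and A: "closedin Z A" "A \<subseteq> K"
    and f: "continuous_map (subtopology Z A) X f" "f ` A \<subseteq> ?C"
  have KZ: "topspace (subtopology Z K) = K" "topspace (subtopology Z A) = A" using K A closedin_subset by auto
  have "\<exists>g. continuous_map (subtopology Z K) euclideanreal g \<and> (\<forall>a\<in>A. g a = f a i) \<and> g ` K \<subseteq> {-1..1}" if i: "i \<in> M" for i
  proof -
    have "normal_space (subtopology Z K)" using Z metrizable_imp_normal_space metrizable_space_subtopology by blast
    moreover have "closedin (subtopology Z K) A" using A by (simp add: closedin_subset_topspace)
    moreover have "continuous_map (subtopology (subtopology Z K) A) euclideanreal (\<lambda>a. f a i)"
      using continuous_map_compose[OF f(1) continuous_map_X_coord[of i]] A(2)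
      by (simp add: o_def subtopology_subtopology Int_absorb1)
    moreover have "(\<lambda>a. f a i) ` A \<subseteq> {-1..1}" using f(2) i by (fastforce simp: P_def abs_le_iff)
    ultimately obtain g where "continuous_map (subtopology Z K) euclideanreal g"
        "\<And>x. x \<in> A \<Longrightarrow> g x = f x i" "g ` topspace (subtopology Z K) \<subseteq> {-1..1}"
      by (rule Tietze_extension_closed_real_interval) auto
    then show ?thesis using KZ by auto
  qed
  then obtain g where g: "\<And>i. i \<in> M \<Longrightarrow> continuous_map (subtopology Z K) euclideanreal (g i)"
     "\<And>i a. i \<in> M \<Longrightarrow> a \<in> A \<Longrightarrow> g i a = f a i" "\<And>i. i \<in> M \<Longrightarrow> g i ` K \<subseteq> {-1..1}"
    by metis
  define D where "D = \<alpha> m - sum \<alpha> I + sum \<alpha> J"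
  define R where "R = M - I - J"
  define w where "w = sum \<alpha> R"
  have Dw: "- w < D" "D < w" using free_weight[OF IJ] by (simp_all add: D_def w_def R_def)
  have RM: "R \<subseteq> M" by (auto simp: R_def)
  have finR: "finite R" using finite_subset[OF RM] by simp
  define s where "s k = (\<Sum>i\<in>R. \<alpha> i * g i k)" for k
  \<comment> \<open>Chosen so that \<open>s k + t1 k * (w - s k) = D\<close> when
    \<open>s k \<le> D\<close>, and symmetrically for \<open>t2\<close>. The \<open>min\<close> and
    \<open>max\<close> do not change the denominators in the case that matters and keep them
    positive everywhere.\<close>
  define t1 where "t1 k = max 0 (D - s k) / (w - min (s k) D)" for k
  define t2 where "t2 k = max 0 (s k - D) / (w + max (s k) D)" for k
  have den: "w - min (s k) D > 0" "w + max (s k) D > 0" for k using Dw by (auto simp: min_def max_def)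
  define h where "h k i = (if i \<in> I then 1 else if i \<in> J then -1 else if i \<in> R then g i k + t1 k * (1 - g i k) - t2 k * (1 + g i k) else 0)" for k i
  have gb: "-1 \<le> g i k" "g i k \<le> 1" if "i \<in> R" "k \<in> K" for i k
  proof -
    have "i \<in> M" using that RM by blast
    then show "-1 \<le> g i k" "g i k \<le> 1" using g(3)[of i] that by (auto simp: image_subset_iff)
  qed
  have sb: "- w \<le> s k" "s k \<le> w" if "k \<in> K" for k
  proof -
    have 0: "0 \<le> \<alpha> i" if "i \<in> R" for i using posM[of i] that RM by auto
    have "(\<Sum>i\<in>R. \<alpha> i * (-1)) \<le> s k" unfolding s_def
      using gb that 0 by (intro sum_mono mult_left_mono) auto
    then show "- w \<le> s k" by (simp add: w_def sum_negf)
    have "s k \<le> (\<Sum>i\<in>R. \<alpha> i * 1)" unfolding s_def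
      using gb that 0 by (intro sum_mono mult_left_mono) auto
    then show "s k \<le> w" by (simp add: w_def)
  qed
  have hP: "h k \<in> P" if k: "k \<in> K" for k
  proof -
    have t: "0 \<le> t1 k" "t1 k \<le> 1" "0 \<le> t2 k" "t2 k \<le> 1" "t1 k = 0 \<or> t2 k = 0"
      using den[of k] sb[OF k] Dw by (auto simp: t1_def t2_def max_def min_def field_simps)
    have "h k \<in> P \<longleftrightarrow> (\<Sum>i\<in>M - I - J. \<alpha> i * h k i) = \<alpha> m - sum \<alpha> I + sum \<alpha> J"
    proof (rule face_in_P[OF IJ(1-3)])
      fix i assume "i \<in> M - I - J"
      then have i: "i \<in> R" "i \<notin> I" "i \<notin> J" by (auto simp: R_def)
      note b = gb[OF i(1) k]
      have "h k i = g i k + t1 k * (1 - g i k) - t2 k * (1 + g i k)" using i by (simp add: h_def)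
      moreover have "0 \<le> t1 k * (1 - g i k)" "t1 k * (1 - g i k) \<le> 1 - g i k" "0 \<le> t2 k * (1 + g i k)" "t2 k * (1 + g i k) \<le> 1 + g i k"
        using t b by (auto intro: mult_left_le_one_le)
      ultimately show "\<bar>h k i\<bar> \<le> 1" using t(5) by (auto simp: abs_le_iff)
    qed (use IJ(1-3) RM in \<open>auto simp: h_def\<close>)
    moreover have "(\<Sum>i\<in>M - I - J. \<alpha> i * h k i) = D"
    proof -
      have "(\<Sum>i\<in>M - I - J. \<alpha> i * h k i) = (\<Sum>i\<in>R. \<alpha> i * g i k + t1 k * (\<alpha> i - \<alpha> i * g i k) - t2 k * (\<alpha> i + \<alpha> i * g i k))"
        unfolding R_def[symmetric] by (intro sum.cong) (auto simp: h_def R_def algebra_simps)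
      also have "\<dots> = s k + t1 k * (w - s k) - t2 k * (w + s k)"
        by (simp add: sum.distrib sum_subtractf s_def w_def flip: sum_distrib_left)
      also have "\<dots> = D"
        using den[of k] by (cases "s k \<le> D") (auto simp: t1_def t2_def max_def min_def)
      finally show ?thesis .
    qed
    ultimately show ?thesis by (simp add: D_def)
  qed
  have cs: "continuous_map (subtopology Z K) euclideanreal s"
    unfolding s_def using g(1) RM by (intro continuous_map_sum finR continuous_map_real_mult_left) auto
  have ct: "continuous_map (subtopology Z K) euclideanreal t1" "continuous_map (subtopology Z K) euclideanreal t2"
    unfolding t1_def t2_def using cs den
    by (auto intro!: continuous_map_real_divide continuous_map_real_max continuous_map_real_min continuous_map_diff continuous_map_add simp: less_imp_neq[symmetric] simp del: max_less_iff_conj)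
  have "continuous_map (subtopology Z K) X h"
  proof (rule continuous_map_into_X)
    fix i assume i: "i \<in> M"
    show "continuous_map (subtopology Z K) euclideanreal (\<lambda>k. h k i)"
      using g(1)[OF i] ct unfolding h_def
      by (cases "i \<in> I"; cases "i \<in> J"; cases "i \<in> R")
         (auto intro!: continuous_map_add continuous_map_diff continuous_map_real_mult)
  qed (use hP KZ in auto)
  moreover have "h ` K \<subseteq> ?C" using hP IJ(3) by (auto simp: h_def)
  moreover have "h a = f a" if a: "a \<in> A" for a
  proof
    fix i
    have fa: "f a \<in> P" "\<And>i. i \<in> I \<Longrightarrow> f a i = 1" "\<And>i. i \<in> J \<Longrightarrow> f a i = -1" using f(2) a by auto
    have "f a \<in> P \<longleftrightarrow> (\<Sum>i\<in>M - I - J. \<alpha> i * f a i) = \<alpha> m - sum \<alpha> I + sum \<alpha> J"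
      by (rule face_in_P[OF IJ(1-3)]) (use fa in \<open>auto simp: P_def\<close>)
    then have "(\<Sum>i\<in>R. \<alpha> i * f a i) = D" using fa by (simp add: R_def D_def)
    moreover have "s a = (\<Sum>i\<in>R. \<alpha> i * f a i)" unfolding s_def using g(2) a RM by (intro sum.cong) auto
    ultimately have "s a = D" by simp
    then have "t1 a = 0" "t2 a = 0" by (simp_all add: t1_def t2_def)
    then show "h a i = f a i"
      using fa g(2)[OF _ a, of i] RM by (cases "i \<in> M") (auto simp: h_def R_def P_def)
  qed
  ultimately show "\<exists>g. continuous_map (subtopology Z K) X g \<and> g ` K \<subseteq> ?C \<and> (\<forall>a\<in>A. g a = f a)" by blast
qed

end

sublocale lengths \<subseteq> davis facets comm X mir
proof
  show "finite facets"
    by (rule finite_subset[of _ "M \<times> UNIV"]) (auto simp: facets_def)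
  show "Hausdorff_space X"
    unfolding X_def by (intro Hausdorff_space_subtopology) (simp add: Hausdorff_space_product_topology)
  show "closedin X (mir s)" if "s \<in> facets" for s
  proof -
    have "closedin X {x \<in> topspace X. x (fst s) \<in> {val (snd s)}}"
      by (rule closedin_continuous_map_preimage[OF continuous_map_X_coord]) simp
    then show ?thesis by (simp add: topspace_X mir_def)
  qed
qed (auto simp: comm_def)

context lengths
begin

lemma mir_iff: "x \<in> mir (i, b) \<longleftrightarrow> x \<in> P \<and> x i = val b"
  by (simp add: mir_def)

text \<open>Members of \<open>T\<close> meet pairwise, so the subsets of \<open>I\<close> and
  \<open>J\<close> with at most two elements satisfy the respective shortness conditions; the flag
  condition passes this on to \<open>I\<close> and \<open>J\<close> themselves. This turns pairwise
  intersections into a common face.\<close>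

lemma extensor_spherical:
  assumes Z: "metrizable_space Z" and fl: flag and T: "spherical T"
  shows "extensor Z X (topspace X \<inter> \<Inter> (mir ` T))"
proof -
  define I where "I = {i. (i, True) \<in> T}"
  define J where "J = {i. (i, False) \<in> T}"
  have TS: "T \<subseteq> facets" and "pairwise comm T"
    using T unfolding spherical_def by auto
  then have Tc: "mir s \<inter> mir t \<noteq> {}" if "s \<in> T" "t \<in> T" for s t
    using that by (cases "s = t") (auto simp: pairwise_def comm_def facets_def)
  have IJ: "I \<subseteq> M" "J \<subseteq> M" using TS by (auto simp: I_def J_def facets_def)
  have pair: "\<exists>x\<in>P. x i = val b \<and> x j = val c" if "(i, b) \<in> T" "(j, c) \<in> T" for i j b c
    using Tc[OF that] by (auto simp: mir_iff)
  have disj: "I \<inter> J = {}"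
  proof (rule ccontr)
    assume "I \<inter> J \<noteq> {}"
    then obtain i where "(i, True) \<in> T" "(i, False) \<in> T" by (auto simp: I_def J_def)
    then show False using pair by (fastforce simp: val_def)
  qed
  have small: "H = {} \<or> (\<exists>i\<in>H. \<exists>j\<in>H. H = {i, j})" if "card H \<le> 2" "H \<subseteq> M" for H :: "nat set"
  proof -
    have "finite H" by (rule finite_subset[OF that(2)]) simp
    have "card H = 0 \<or> card H = 1 \<or> card H = 2" using that(1) by linarith
    then show ?thesis
    proof (elim disjE)
      assume "card H = 1"
      then obtain x where "H = {x}" by (rule card_1_singletonE)
      then show ?thesis by blast
    next
      assume "card H = 2" then show ?thesis unfolding card_2_iff by blast
    qed (use \<open>finite H\<close> in simp)
  qed
  have sI: "short m \<alpha> I"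
  proof (rule ccontr)
    assume "\<not> short m \<alpha> I"
    then obtain H where H: "H \<subseteq> I" "card H \<le> 2" "\<not> short m \<alpha> H" using fl IJ unfolding flag_def by meson
    have HM: "H \<subseteq> M" using H(1) IJ(1) by (rule order_trans)
    have "H \<noteq> {}" using H(3) short_mono[OF short_m, of "{}"] by auto
    then obtain i j where ij: "i \<in> H" "j \<in> H" "H = {i, j}" using small[OF H(2) HM] by blast
    then have "(i, True) \<in> T" "(j, True) \<in> T" using H(1) by (auto simp: I_def)
    from pair[OF this] obtain x where "x \<in> P" "x i = 1" "x j = 1" by (auto simp: val_def)
    then have "short m \<alpha> H" by (intro face_short[of x] HM) (use ij in auto)
    then show False using H by simp
  qed
  have sJ: "short m \<alpha> (insert m J)"
  proof (rule ccontr)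
    assume "\<not> short m \<alpha> (insert m J)"
    then obtain H where H: "H \<subseteq> J" "card H \<le> 2" "\<not> short m \<alpha> (insert m H)" using fl IJ unfolding flag_def by meson
    have HM: "H \<subseteq> M" using H(1) IJ(2) by (rule order_trans)
    have "H \<noteq> {}" using H(3) short_m by auto
    then obtain i j where ij: "i \<in> H" "j \<in> H" "H = {i, j}" using small[OF H(2) HM] by blast
    then have "(i, False) \<in> T" "(j, False) \<in> T" using H(1) by (auto simp: J_def)
    from pair[OF this] obtain x where "x \<in> P" "x i = -1" "x j = -1" by (auto simp: val_def)
    then have "short m \<alpha> (insert m H)" by (intro face_short'[of x] HM) (use ij in auto)
    then show False using H by simp
  qed
  have "topspace X \<inter> \<Inter> (mir ` T) = {x \<in> P. (\<forall>i\<in>I. x i = 1) \<and> (\<forall>i\<in>J. x i = -1)}"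
  proof (intro equalityI subsetI)
    fix x assume "x \<in> topspace X \<inter> \<Inter> (mir ` T)"
    then show "x \<in> {x \<in> P. (\<forall>i\<in>I. x i = 1) \<and> (\<forall>i\<in>J. x i = -1)}"
      by (fastforce simp: topspace_X I_def J_def mir_iff val_def)
  next
    fix x assume x: "x \<in> {x \<in> P. (\<forall>i\<in>I. x i = 1) \<and> (\<forall>i\<in>J. x i = -1)}"
    have "x \<in> mir s" if "s \<in> T" for s
      using x that by (cases s; cases "snd s") (auto simp: I_def J_def mir_iff val_def)
    then show "x \<in> topspace X \<inter> \<Inter> (mir ` T)" using x by (auto simp: topspace_X)
  qed
  then show ?thesis using extensor_face[OF Z IJ disj sI sJ] by simp
qed

end

section \<open>The chain space as a quotient of the Davis complex\<close>

context lengths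
begin

text \<open>\<open>x\<close> fixes the absolute values of the second coordinates, and the chamber
  \<open>F\<close> prescribes their signs.\<close>

definition chain_of :: "(nat \<times> bool \<Rightarrow> nat \<times> bool \<Rightarrow> (nat \<times> bool) list) \<Rightarrow> (nat \<Rightarrow> real) \<Rightarrow> nat \<Rightarrow> real \<times> real" where
  "chain_of F x = (\<lambda>i\<in>M. (x i, (if parity fst i F then -1 else 1) * sqrt (1 - (x i)\<^sup>2)))"

lemma chset_circle: "v \<in> chset \<Longrightarrow> i \<in> M \<Longrightarrow> (fst (v i))\<^sup>2 + (snd (v i))\<^sup>2 = 1"
  unfolding in_chset by blast

definition pmap where
  "pmap z = chain_of (SOME F. F \<in> fst z) (snd z)"

lemma P_square_le_1: "x \<in> P \<Longrightarrow> i \<in> M \<Longrightarrow> (x i)\<^sup>2 \<le> 1"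
  by (simp add: P_def abs_square_le_1)

lemma chain_of_chset: "x \<in> P \<Longrightarrow> chain_of F x \<in> chset"
  using P_square_le_1[of x] by (auto simp: in_chset chain_of_def power_mult_distrib P_def)

lemma inj_on_fst_Sx: "inj_on fst (Sx x)"
  by (auto simp: inj_on_def Sx_def mir_iff val_def split: if_splits)

lemma Sx_coord: "i \<in> fst ` Sx x \<Longrightarrow> (x i)\<^sup>2 = 1"
  by (auto simp: Sx_def mir_iff val_def)

text \<open>Elements of the coset differ in parity only at coordinates with
  \<open>(x i)\<^sup>2 = 1\<close>, where the second coordinate is 0. So the choice made in
  \<open>pmap\<close> is immaterial.\<close>

lemma chain_of_coset:
  assumes "F \<in> W" "G \<in> coset F (Sx x)"
  shows "chain_of G x = chain_of F x"
proof -
  obtain A where A: "A \<subseteq> Sx x" "G = aset A F" using assms by (auto simp: coset_def)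
  have "parity fst i G \<longleftrightarrow> (parity fst i F \<noteq> (i \<in> fst ` A))" for i
    unfolding A(2) using spherical_subset[OF spherical_Sx A(1)] inj_on_subset[OF inj_on_fst_Sx A(1)] assms(1)
    by (rule parity_aset)
  moreover have "(x i)\<^sup>2 = 1" if "i \<in> fst ` A" for i using that A Sx_coord by blast
  ultimately show ?thesis by (auto simp: chain_of_def fun_eq_iff)
qed

lemma pmap_pt: "F \<in> W \<Longrightarrow> pmap (pt F x) = chain_of F x"
proof -
  assume F: "F \<in> W"
  have "F \<in> coset F (Sx x)" by (rule coset_self)
  then have "(SOME G. G \<in> coset F (Sx x)) \<in> coset F (Sx x)"
    by (rule someI[of "\<lambda>G. G \<in> coset F (Sx x)"])
  then show ?thesis using chain_of_coset[OF F] by (simp add: pmap_def pt_def)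
qed

lemma continuous_map_pmap: "continuous_map U (chains m \<alpha>) pmap"
proof (rule continuous_map_from_U)
  fix F assume F: "F \<in> W"
  show "continuous_map X (chains m \<alpha>) (\<lambda>x. pmap (pt F x))"
    unfolding pmap_pt[OF F]
  proof (rule continuous_map_into_chains)
    show "chain_of F x \<in> chset" if "x \<in> topspace X" for x
      using that chain_of_chset by (simp add: topspace_X)
    fix i assume i: "i \<in> M"
    show "continuous_map X euclideanreal (\<lambda>x. fst (chain_of F x i))"
      using i continuous_map_X_coord by (simp add: chain_of_def)
    have "continuous_map X euclideanreal (\<lambda>x. sqrt (1 - (x i)\<^sup>2))"
      using continuous_map_X_coord by (intro continuous_map_sqrt continuous_map_diff continuous_map_real_pow) auto
    then show "continuous_map X euclideanreal (\<lambda>x. snd (chain_of F x i))"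
      using i by (simp add: chain_of_def continuous_map_minus)
  qed
qed

lemma continuous_map_fold: "continuous_map (chains m \<alpha>) X (\<lambda>v i. if i \<in> M then fst (v i) else 0)"
proof (rule continuous_map_into_X)
  show "(\<lambda>i. if i \<in> M then fst (v i) else 0) \<in> P" if "v \<in> topspace (chains m \<alpha>)" for v
    using that chset_abs_le_1[of v] by (auto simp: chset_def[symmetric] in_chset P_def)
qed (use continuous_map_chains_coord in simp)

definition foldc :: "(nat \<Rightarrow> real \<times> real) \<Rightarrow> nat \<Rightarrow> real" where
  "foldc v i = (if i \<in> M then fst (v i) else 0)"

lemma foldc_in_P: "v \<in> chset \<Longrightarrow> foldc v \<in> P"
  using continuous_map_fold unfolding foldc_def[abs_def] chset_def
  by (auto simp: continuous_map_def topspace_X)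

lemma foldc_chain_of: "x \<in> P \<Longrightarrow> foldc (chain_of F x) = x"
  by (auto simp: foldc_def chain_of_def P_def fun_eq_iff)

lemma snd_chset: "v \<in> chset \<Longrightarrow> i \<in> M \<Longrightarrow> \<bar>snd (v i)\<bar> = sqrt (1 - (foldc v i)\<^sup>2)"
proof -
  assume "v \<in> chset" "i \<in> M"
  then have "(snd (v i))\<^sup>2 = 1 - (foldc v i)\<^sup>2" by (simp add: in_chset foldc_def eq_diff_eq add.commute)
  then show ?thesis using real_sqrt_abs by metis
qed

lemma chain_of_foldc:
  assumes v: "v \<in> chset" and par: "\<And>i. i \<in> M \<Longrightarrow> snd (v i) \<noteq> 0 \<Longrightarrow> parity fst i F \<longleftrightarrow> snd (v i) < 0"
  shows "chain_of F (foldc v) = v"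
proof
  fix i
  show "chain_of F (foldc v) i = v i"
  proof (cases "i \<in> M")
    case True
    have "(if parity fst i F then -1 else 1) * sqrt (1 - (foldc v i)\<^sup>2) = snd (v i)"
      unfolding snd_chset[OF v True, symmetric] using par[OF True] by (cases "snd (v i) = 0") auto
    then show ?thesis using True by (simp add: chain_of_def foldc_def prod_eq_iff)
  next
    case False
    moreover have "v i = undefined" using v False unfolding in_chset by blast
    ultimately show ?thesis by (simp only: chain_of_def restrict_def if_False)
  qed
qed

lemma parity_of_chain_of:
  assumes "i \<in> M" "snd (chain_of F x i) \<noteq> 0" "x \<in> P"
  shows "parity fst i F \<longleftrightarrow> snd (chain_of F x i) < 0"
proof -
  have "0 \<le> sqrt (1 - (x i)\<^sup>2)" using P_square_le_1 assms by simp
  then show ?thesis using assms by (auto simp: chain_of_def split: if_splits)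
qed

lemma in_Sx: "x \<in> P \<Longrightarrow> (i, b) \<in> Sx x \<longleftrightarrow> i \<in> M \<and> x i = val b"
  unfolding Sx_def by (auto simp: facets_def mir_iff)

text \<open>Near \<open>v\<close>, only the coordinates with \<open>y\<^sub>i = 0\<close> can change their sign, and the section
  through a given chamber crosses exactly the mirrors of these coordinates.\<close>

lemma cover_map_pmap: "cover_map U (chains m \<alpha>) pmap"
  unfolding cover_map_def
proof (intro conjI ballI)
  show "continuous_map U (chains m \<alpha>) pmap" by (rule continuous_map_pmap)
  show "Hausdorff_space U" by (rule Hausdorff_U)
  fix e assume "e \<in> topspace U"
  then obtain F x where e: "e = pt F x" "F \<in> W" "x \<in> P" by (auto simp: topspace_U topspace_X)
  let ?T = "Sx x"
  have "inj_on pmap (star F ?T)"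
  proof (rule inj_onI)
    fix a b assume "a \<in> star F ?T" "b \<in> star F ?T" and eq: "pmap a = pmap b"
    then obtain G y H z where a: "a = pt G y" "G \<in> coset F ?T" "y \<in> P" "Sx y \<subseteq> ?T"
      and b: "b = pt H z" "H \<in> coset F ?T" "z \<in> P" "Sx z \<subseteq> ?T"
      by (auto simp: star_def topspace_X)
    have GH: "G \<in> W" "H \<in> W" using a b coset_in_W[OF spherical_Sx e(2)] by auto
    then have ch: "chain_of G y = chain_of H z" using eq a b pmap_pt by simp
    then have yz: "y = z" using foldc_chain_of a b by metis
    have "H \<in> coset G ?T" using coset_eq[OF spherical_Sx e(2) a(2)] b by simp
    then obtain A where A: "A \<subseteq> ?T" "H = aset A G" by (auto simp: coset_def)
    have par: "parity fst i H \<longleftrightarrow> (parity fst i G \<noteq> (i \<in> fst ` A))" for i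
      unfolding A(2) using spherical_subset[OF spherical_Sx A(1)] inj_on_subset[OF inj_on_fst_Sx A(1)] GH(1)
      by (rule parity_aset)
    \<comment> \<open>A toggled coordinate has opposite signs in two equal chains, so its second
      coordinate is 0 and \<open>y\<close> lies on a mirror there. It is the mirror recorded in
      \<open>A\<close> because \<open>Sx y \<subseteq> Sx x\<close>.\<close>
    have "A \<subseteq> Sx y"
    proof
      fix s assume s: "s \<in> A"
      obtain i c where ic: "s = (i, c)" by (cases s)
      have sT: "(i, c) \<in> Sx x" using s A ic by blast
      then have i: "i \<in> M" "x i = val c" using in_Sx[OF e(3)] by auto
      have "parity fst i H \<noteq> parity fst i G" using par s ic by force
      moreover have "snd (chain_of G y i) = snd (chain_of H y i)" using ch yz by simp
      ultimately have "sqrt (1 - (y i)\<^sup>2) = 0" using i(1) by (auto simp: chain_of_def split: if_splits)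
      then have "(y i)\<^sup>2 = 1" using P_square_le_1[OF a(3) i(1)] by simp
      then obtain d where "y i = val d" using that unfolding val_def by (metis power2_eq_1_iff)
      then have "(i, d) \<in> Sx y" using in_Sx[OF a(3)] i by simp
      moreover from this have "(i, d) \<in> Sx x" using a by blast
      then have "d = c" using in_Sx[OF e(3)] i by (auto simp: val_def split: if_splits)
      ultimately show "s \<in> Sx y" using ic by simp
    qed
    then have "H \<in> coset G (Sx y)" using A by (auto simp: coset_def)
    then show "a = b" using a b yz pt_eq_iff[OF GH] by simp
  qed
  moreover have "e \<in> star F ?T" using pt_in_star[OF spherical_Sx e(2,2)] e coset_self by (simp add: topspace_X)
  ultimately show "\<exists>N. openin U N \<and> e \<in> N \<and> inj_on pmap N"
    using openin_star[OF spherical_Sx e(2)] by blast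
next
  fix v assume "v \<in> topspace (chains m \<alpha>)"
  then have v: "v \<in> chset" by (simp add: chset_def)
  define T where "T = Sx (foldc v)"
  have spT: "spherical T" unfolding T_def by (rule spherical_Sx)
  have inT: "(i, b) \<in> T \<longleftrightarrow> i \<in> M \<and> fst (v i) = val b" for i b
    unfolding T_def using in_Sx[OF foldc_in_P[OF v]] by (auto simp: foldc_def)
  \<comment> \<open>Keeps the sign of every nonzero second coordinate; where that coordinate is
    zero, \<open>w\<close> stays off the opposite mirror, so that no mirrors outside
    \<open>T\<close> appear.\<close>
  define cnd where "cnd w i \<longleftrightarrow> (if snd (v i) = 0 then fst (v i) * fst (w i) > - 1 else snd (v i) * snd (w i) > 0)"
    for w :: "nat \<Rightarrow> real \<times> real" and i
  define V where "V = {w \<in> chset. \<forall>i\<in>M. cnd w i}"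
  have oV: "openin (chains m \<alpha>) V"
  proof -
    have "openin (chains m \<alpha>) {w \<in> chset. cnd w i}" if i: "i \<in> M" for i
    proof (cases "snd (v i) = 0")
      case True
      have "continuous_map (chains m \<alpha>) euclideanreal (\<lambda>w. fst (v i) * fst (w i))"
        using continuous_map_chains_coord(1)[OF i] by (intro continuous_map_real_mult_left)
      from openin_continuous_map_preimage[OF this, of "{-1<..}"] True show ?thesis by (simp add: chset_def cnd_def)
    next
      case False
      then show ?thesis using openin_chains_coord[OF i, of "snd (v i)"] by (simp add: cnd_def)
    qed
    moreover have "1 \<in> M" using m3 by simp
    then have "V = (\<Inter>i\<in>M. {w \<in> chset. cnd w i})" unfolding V_def by blast
    moreover have "finite M" "M \<noteq> {}" using m3 by auto
    ultimately show ?thesis by (simp only:) (intro openin_INT2, auto)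
  qed
  have vV: "v \<in> V"
  proof -
    have "- 1 < fst (v i) * fst (v i)" for i
      using zero_le_square[of "fst (v i)"] by linarith
    then have "cnd v i" if "i \<in> M" for i
      by (auto simp: cnd_def zero_less_mult_iff neq_iff)
    then show ?thesis using v by (simp add: V_def)
  qed
  have SxV: "Sx (foldc w) \<subseteq> T" if w: "w \<in> V" for w
  proof
    fix s assume s: "s \<in> Sx (foldc w)"
    obtain i b where ib: "s = (i, b)" by (cases s)
    have wc: "w \<in> chset" using w by (simp add: V_def)
    have i: "i \<in> M" "fst (w i) = val b" using s ib in_Sx[OF foldc_in_P[OF wc]] by (auto simp: foldc_def)
    then have "(snd (w i))\<^sup>2 = 0" using chset_circle[OF wc i(1)] by (auto simp: val_def split: if_splits)
    then have w0: "snd (w i) = 0" by simp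
    have c: "cnd w i" using w i by (simp add: V_def)
    then have v0: "snd (v i) = 0" "fst (v i) * fst (w i) > -1" using w0 by (auto simp: cnd_def split: if_splits)
    then have "(fst (v i))\<^sup>2 = 1" using chset_circle[OF v i(1)] by simp
    then have "fst (v i) = 1 \<or> fst (v i) = -1" by (simp add: power2_eq_1_iff)
    then have "fst (v i) = val b" using v0(2) i(2) by (auto simp: val_def split: if_splits)
    then show "s \<in> T" using inT i ib by simp
  qed
  show "\<exists>V. openin (chains m \<alpha>) V \<and> v \<in> V \<and>
        (\<forall>e\<in>topspace U. pmap e \<in> V \<longrightarrow>
           (\<exists>\<sigma>. continuous_map (subtopology (chains m \<alpha>) V) U \<sigma> \<and> (\<forall>z\<in>V. pmap (\<sigma> z) = z) \<and> \<sigma> (pmap e) = e))"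
  proof (intro exI[of _ V] conjI ballI impI oV vV)
    fix e assume "e \<in> topspace U" and eV: "pmap e \<in> V"
    then obtain F x where e: "e = pt F x" "F \<in> W" "x \<in> P" by (auto simp: topspace_U topspace_X)
    have pe: "pmap e = chain_of F x" using pmap_pt e by simp
    define sg :: "nat \<Rightarrow> real" where "sg i = (if parity fst i F then -1 else 1)" for i
    define A where "A w = {s \<in> T. sg (fst s) * snd (w (fst s)) < 0}" for w :: "nat \<Rightarrow> real \<times> real"
    define \<sigma> where "\<sigma> w = pt (aset (A w) F) (foldc w)" for w
    \<comment> \<open>\<open>A w\<close> lists the mirrors to cross from \<open>F\<close> so that
      the signs fit \<open>w\<close>, and it jumps with \<open>w\<close>. On the closed piece
      \<open>VA B\<close> the fixed set \<open>B\<close> can replace it: where they differ the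
      second coordinate is 0, and the point of \<open>U\<close> is the same.\<close>
    define VA where "VA B = {w \<in> V. \<forall>s\<in>T. (if s \<in> B then - sg (fst s) else sg (fst s)) * snd (w (fst s)) \<ge> 0}" for B
    have AT: "A w \<subseteq> T" for w by (auto simp: A_def)
    have FW: "aset B F \<in> W" if "B \<subseteq> T" for B using aset_in_W[OF spherical_subset[OF spT that] e(2)] .
    have par: "parity fst i (aset B F) \<longleftrightarrow> (parity fst i F \<noteq> (i \<in> fst ` B))" if B: "B \<subseteq> T" for B i
      using spherical_subset[OF spT B] inj_on_subset[OF inj_on_fst_Sx B[unfolded T_def]] e(2) by (rule parity_aset)
    have Mset: "i \<in> M" if "(i, b) \<in> T" for i b using that inT by simp
    have eq: "\<sigma> w = pt (aset B F) (foldc w)" if B: "B \<subseteq> T" and w: "w \<in> VA B" for w B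
    proof -
      have wV: "w \<in> V" "w \<in> chset" using w by (auto simp: VA_def V_def)
      have "s \<in> Sx (foldc w)" if s: "s \<in> (A w - B) \<union> (B - A w)" for s
      proof -
        have sT: "s \<in> T" using s AT B by blast
        obtain i b where ib: "s = (i, b)" by (cases s)
        have "snd (w i) = 0"
          using s w sT unfolding VA_def A_def ib sg_def by (fastforce split: if_splits)
        moreover have i: "i \<in> M" using sT ib Mset by simp
        ultimately have "(fst (w i))\<^sup>2 = 1" using chset_circle[OF wV(2), of i] by simp
        then have "\<exists>c. fst (w i) = val c" unfolding val_def by (metis power2_eq_1_iff)
        then obtain c where c: "fst (w i) = val c" by blast
        then have "(i, c) \<in> Sx (foldc w)" using in_Sx[OF foldc_in_P[OF wV(2)]] i by (simp add: foldc_def)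
        moreover from this have "(i, c) \<in> T" using SxV[OF wV(1)] by blast
        then have "c = b" using sT ib inT by (auto simp: val_def split: if_splits)
        ultimately show ?thesis using ib by simp
      qed
      then have sub: "(A w - B) \<union> (B - A w) \<subseteq> Sx (foldc w)" by blast
      let ?D = "(A w - B) \<union> (B - A w)"
      have DT: "?D \<subseteq> T" using AT B by blast
      have "(A w - ?D) \<union> (?D - A w) = B" by blast
      then have "aset ?D (aset (A w) F) = aset B F" using aset_aset[OF spT AT DT e(2)] by simp
      then have "aset B F \<in> coset (aset (A w) F) (Sx (foldc w))" using sub unfolding coset_def by (metis (mono_tags, lifting) mem_Collect_eq)
      then show ?thesis unfolding \<sigma>_def using pt_eq_iff[OF FW[OF AT] FW[OF B]] by simp
    qed
    have cf: "continuous_map (chains m \<alpha>) X foldc"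
      using continuous_map_fold by (simp add: foldc_def[abs_def])
    have cont: "continuous_map (subtopology (chains m \<alpha>) V) U \<sigma>"
    proof (rule pasting_lemma_closed[where I = "Pow T" and T = VA and f = "\<lambda>B w. pt (aset B F) (foldc w)"])
      show "finite (Pow T)" using spherical_finite[OF spT] by simp
    next
      fix B assume "B \<in> Pow T"
      then have B: "B \<subseteq> T" by simp
      have "closedin (chains m \<alpha>) {w \<in> chset. c * snd (w i) \<ge> 0}" if i: "i \<in> M" for c i
      proof -
        have "continuous_map (chains m \<alpha>) euclideanreal (\<lambda>w. c * snd (w i))"
          using continuous_map_chains_coord(2)[OF i] by (intro continuous_map_real_mult_left)
        from closedin_continuous_map_preimage[OF this, of "{0..}"] show ?thesis by (simp add: chset_def)
      qed
      note cl = this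
      define gs where "gs s = (if s \<in> B then - sg (fst s) else sg (fst s))" for s
      have VA_eq: "VA B = {w \<in> V. \<forall>s\<in>T. gs s * snd (w (fst s)) \<ge> 0}" by (simp only: VA_def gs_def)
      have c: "closedin (chains m \<alpha>) {w \<in> chset. gs s * snd (w (fst s)) \<ge> 0}" if "s \<in> T" for s
        using that Mset[of "fst s" "snd s"] by (intro cl) simp
      have "closedin (chains m \<alpha>) (\<Inter> (insert (topspace (chains m \<alpha>)) ((\<lambda>s. {w \<in> chset. gs s * snd (w (fst s)) \<ge> 0}) ` T)))"
        using c by (intro closedin_Inter) auto
      moreover have "VA B = (\<Inter> (insert (topspace (chains m \<alpha>)) ((\<lambda>s. {w \<in> chset. gs s * snd (w (fst s)) \<ge> 0}) ` T))) \<inter> V"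
        unfolding VA_eq by (auto simp: V_def chset_def[symmetric])
      ultimately show "closedin (subtopology (chains m \<alpha>) V) (VA B)"
        unfolding closedin_subtopology by blast
      have "continuous_map (chains m \<alpha>) U (pt (aset B F) \<circ> foldc)"
        using cf continuous_map_pt[OF FW[OF B]] by (rule continuous_map_compose)
      then show "continuous_map (subtopology (subtopology (chains m \<alpha>) V) (VA B)) U (\<lambda>w. pt (aset B F) (foldc w))"
        by (intro continuous_map_from_subtopology) (simp add: o_def)
    next
      fix B C w assume "B \<in> Pow T" "C \<in> Pow T" "w \<in> topspace (subtopology (chains m \<alpha>) V) \<inter> VA B \<inter> VA C"
      then show "pt (aset B F) (foldc w) = pt (aset C F) (foldc w)" using eq[of B w] eq[of C w] by simp
    next
      fix w assume "w \<in> topspace (subtopology (chains m \<alpha>) V)"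
      then have w: "w \<in> V" by simp
      have "w \<in> VA (A w)" using w by (auto simp: VA_def A_def not_less)
      then show "\<exists>B. B \<in> Pow T \<and> w \<in> VA B \<and> \<sigma> w = pt (aset B F) (foldc w)"
        using AT by (intro exI[of _ "A w"]) (simp add: \<sigma>_def)
    qed
    have sec: "pmap (\<sigma> w) = w" if w: "w \<in> V" for w
    proof -
      have wc: "w \<in> chset" using w by (simp add: V_def)
      have "pmap (\<sigma> w) = chain_of (aset (A w) F) (foldc w)" unfolding \<sigma>_def using pmap_pt[OF FW[OF AT]] .
      also have "\<dots> = w"
      proof (rule chain_of_foldc[OF wc])
        fix i assume i: "i \<in> M" "snd (w i) \<noteq> 0"
        show "parity fst i (aset (A w) F) \<longleftrightarrow> snd (w i) < 0"
        proof (cases "snd (v i) = 0")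
          case True
          then have "(fst (v i))\<^sup>2 = 1" using chset_circle[OF v i(1)] by simp
          then have "\<exists>c. fst (v i) = val c" unfolding val_def by (metis power2_eq_1_iff)
          then obtain c where "(i, c) \<in> T" using inT i by blast
          then have "i \<in> fst ` A w \<longleftrightarrow> sg i * snd (w i) < 0" by (force simp: A_def)
          then show ?thesis using par[OF AT] i by (auto simp: sg_def)
        next
          case False
          have "(i, c) \<notin> T" for c
          proof
            assume "(i, c) \<in> T"
            then have "(fst (v i))\<^sup>2 = 1" using inT by (simp add: val_def)
            then show False using chset_circle[OF v i(1)] False by simp
          qed
          then have "i \<notin> fst ` A w" using AT by force
          moreover have "snd (v i) * snd (w i) > 0" "snd (v i) * snd (chain_of F x i) > 0"
            using w eV False i unfolding V_def cnd_def pe by auto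
          moreover have "parity fst i F \<longleftrightarrow> snd (chain_of F x i) < 0"
            using calculation(3) i(1) e(3) by (intro parity_of_chain_of) auto
          ultimately show ?thesis using par[OF AT, of i w] by (auto simp: zero_less_mult_iff)
        qed
      qed
      finally show ?thesis .
    qed
    have se: "\<sigma> (pmap e) = e"
    proof -
      have "A (chain_of F x) = {}"
      proof -
        have "\<not> sg i * snd (chain_of F x i) < 0" if "i \<in> M" for i
          using that P_square_le_1[OF e(3) that] by (auto simp: sg_def chain_of_def)
        then show ?thesis using Mset by (force simp: A_def)
      qed
      then show ?thesis unfolding pe \<sigma>_def using foldc_chain_of[OF e(3)] e(1) by simp
    qed
    show "\<exists>\<sigma>. continuous_map (subtopology (chains m \<alpha>) V) U \<sigma> \<and> (\<forall>z\<in>V. pmap (\<sigma> z) = z) \<and> \<sigma> (pmap e) = e"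
      using cont sec se by blast
  qed
qed

end

section \<open>Asphericity under the flag condition\<close>

text \<open>The constant map is itself a pointed map, so a single class means that every pointed map
  is homotopic to it.\<close>

lemma is_singleton_homotopy_group_set_iff:
  assumes "x \<in> topspace X"
  shows "is_singleton (homotopy_group_set n X x) \<longleftrightarrow>
    (\<forall>f\<in>pointed_sphere_maps n X x. homotopic_with (\<lambda>h. h sphere_base = x) (nsphere n) X f (\<lambda>_. x))"
proof -
  let ?A = "pointed_sphere_maps n X x" and ?r = "pointed_homotopy n X x"
  have c: "(\<lambda>_. x) \<in> ?A" using assms by (simp add: pointed_sphere_maps_def)
  have r: "(f, \<lambda>_. x) \<in> ?r \<longleftrightarrow> homotopic_with (\<lambda>h. h sphere_base = x) (nsphere n) X f (\<lambda>_. x)" for f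
    by (simp add: pointed_homotopy_def)
  show ?thesis
  proof
    assume "is_singleton (homotopy_group_set n X x)"
    then obtain C where C: "?A // ?r = {C}" by (auto simp: homotopy_group_set_def is_singleton_def)
    have "(f, \<lambda>_. x) \<in> ?r" if f: "f \<in> ?A" for f
    proof -
      have "?r `` {f} = C" "?r `` {\<lambda>_. x} = C" using C quotientI[OF f, of ?r] quotientI[OF c, of ?r] by auto
      then show ?thesis using eq_equiv_class[OF _ equiv_pointed_homotopy c] by metis
    qed
    then show "\<forall>f\<in>?A. homotopic_with (\<lambda>h. h sphere_base = x) (nsphere n) X f (\<lambda>_. x)"
      unfolding r by (rule ballI)
  next
    assume h: "\<forall>f\<in>?A. homotopic_with (\<lambda>h. h sphere_base = x) (nsphere n) X f (\<lambda>_. x)"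
    have "?A // ?r = {?r `` {\<lambda>_. x}}"
    proof
      show "?A // ?r \<subseteq> {?r `` {\<lambda>_. x}}"
      proof
        fix C assume "C \<in> ?A // ?r"
        then obtain f where f: "f \<in> ?A" "C = ?r `` {f}" by (rule quotientE)
        have "(f, \<lambda>_. x) \<in> ?r" unfolding r by (rule bspec[OF h f(1)])
        then have "?r `` {f} = ?r `` {\<lambda>_. x}" by (rule equiv_class_eq[OF equiv_pointed_homotopy])
        then show "C \<in> {?r `` {\<lambda>_. x}}" using f(2) by simp
      qed
      show "{?r `` {\<lambda>_. x}} \<subseteq> ?A // ?r" using quotientI[OF c, of ?r] by simp
    qed
    then show "is_singleton (homotopy_group_set n X x)" by (simp add: homotopy_group_set_def)
  qed
qed

context lengths
begin

text \<open>A coordinate without facets has no face \<open>x i = 1\<close>, so \<open>{i}\<close> is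
  long and carries at least half of the total length; two of them together with the positive
  \<open>\<alpha> m\<close> would exceed it.\<close>

lemma missing_color_unique:
  assumes "i \<in> M - fst ` facets" "j \<in> M - fst ` facets"
  shows "i = j"
proof (rule ccontr)
  assume ne: "i \<noteq> j"
  have *: "\<not> short m \<alpha> {i}" if i: "i \<in> M - fst ` facets" for i
  proof
    assume s: "short m \<alpha> {i}"
    have "{i} \<subseteq> M" "short m \<alpha> (insert m {})" using i short_m by auto
    then obtain x where "x \<in> P" "x i = 1" using face_nonempty[of "{i}" "{}"] s by auto
    then have "x \<in> mir (i, True)" by (simp add: mir_iff val_def)
    then have "(i, True) \<in> facets" using i unfolding facets_def by auto
    then show False using i by force
  qed
  have M: "i \<in> M" "j \<in> M" using assms by auto
  then have "sum \<alpha> {1..m} \<le> 2 * \<alpha> i" "sum \<alpha> {1..m} \<le> 2 * \<alpha> j"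
    using *[OF assms(1)] *[OF assms(2)] by (auto simp: short_iff)
  moreover have "sum \<alpha> {i, j, m} \<le> sum \<alpha> {1..m}"
  proof (rule sum_mono2)
    show "{i, j, m} \<subseteq> {1..m}" using M m3 by auto
    show "0 \<le> \<alpha> b" if "b \<in> {1..m} - {i, j, m}" for b using that pos[of b] by simp
  qed simp
  moreover have "sum \<alpha> {i, j, m} = \<alpha> i + \<alpha> j + \<alpha> m"
    using ne M m_notin_M by (auto simp: sum.insert_if)
  moreover have "0 < \<alpha> m" using pos m3 by simp
  ultimately show False by linarith
qed

lemma exists_parity:
  assumes "finite B" "B \<subseteq> fst ` facets"
  shows "\<exists>F\<in>W. \<forall>i. parity fst i F \<longleftrightarrow> i \<in> B"
  using assms
proof (induction B)
  case empty
  then show ?case using unit_in_W by (intro bexI[of _ unit]) auto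
next
  case (insert i B)
  then obtain F where F: "F \<in> W" "\<And>j. parity fst j F \<longleftrightarrow> j \<in> B" by auto
  obtain s where s: "s \<in> facets" "fst s = i" using insert by auto
  have "parity fst j (act s F) \<longleftrightarrow> j \<in> insert i B" for j
    unfolding parity_act[OF F(1) s(1)] F(2) using insert(2) s(2) by auto
  then show ?case using act_closed_invol(1)[OF F(1) s(1)] by blast
qed

text \<open>Parities are arbitrary at coordinates with a facet and even elsewhere. At most one
  coordinate is of the second kind, and a reflection, invisible in the chain space, makes its second
  coordinate nonnegative.\<close>

lemma qmap_pmap_surj:
  assumes "x \<in> topspace (chain_space m \<alpha>)"
  obtains u where "u \<in> topspace U" "qmap (pmap u) = x"
proof -
  obtain v where v: "v \<in> chset" "x = qmap v" using assms by (auto simp: topspace_chain_space)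
  have "\<exists>w\<in>chset. qmap w = x \<and> (\<forall>i\<in>M - fst ` facets. snd (w i) \<ge> 0)"
  proof (cases "\<forall>i\<in>M - fst ` facets. snd (v i) \<ge> 0")
    case True
    then show ?thesis using v by blast
  next
    case False
    then obtain i where i: "i \<in> M - fst ` facets" "snd (v i) < 0" by force
    have "snd (reflect m v j) \<ge> 0" if "j \<in> M - fst ` facets" for j
    proof -
      have "j = i" using missing_color_unique that i(1) by blast
      then show ?thesis using i by (simp add: reflect_apply)
    qed
    moreover have "qmap (reflect m v) = x" using v qmap_eq_iff reflect_chset by metis
    ultimately show ?thesis using reflect_chset v by blast
  qed
  then obtain w where w: "w \<in> chset" "qmap w = x" "\<And>i. i \<in> M - fst ` facets \<Longrightarrow> snd (w i) \<ge> 0" by blast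
  let ?B = "{i \<in> fst ` facets. snd (w i) < 0}"
  have "finite ?B" using finS by simp
  then obtain F where F: "F \<in> W" "\<And>i. parity fst i F \<longleftrightarrow> i \<in> ?B" using exists_parity[of ?B] by auto
  have "chain_of F (foldc w) = w"
  proof (rule chain_of_foldc[OF w(1)])
    fix i assume "i \<in> M" "snd (w i) \<noteq> 0"
    then show "parity fst i F \<longleftrightarrow> snd (w i) < 0" using F(2)[of i] w(3)[of i] by (cases "i \<in> fst ` facets") auto
  qed
  then have "qmap (pmap (pt F (foldc w))) = x" using pmap_pt[OF F(1)] w by simp
  moreover have "pt F (foldc w) \<in> topspace U" using F(1) foldc_in_P[OF w(1)] by (auto simp: topspace_U topspace_X)
  ultimately show ?thesis using that by blast
qed

lemma flag_extend:
  assumes "flag" "metrizable_space Z" "compact_space Z" "closedin Z A" "continuous_map (subtopology Z A) U f"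
  obtains g where "continuous_map Z U g" "\<And>a. a \<in> A \<Longrightarrow> g a = f a"
  using extensor_U[OF assms(2,3) extensor_spherical[OF assms(2,1)] assms(4,5)] by blast

lemma continuous_map_qp: "continuous_map U (chain_space m \<alpha>) (qmap \<circ> pmap)"
  using continuous_map_pmap quotient_imp_continuous_map[OF quotient_map_qmap] by (rule continuous_map_compose)

text \<open>A map on the two ends of the interval extends to a path in \<open>U\<close>, which is
  then projected.\<close>

lemma path_connected_chain_space:
  assumes fl: flag
  shows "path_connected_space (chain_space m \<alpha>)"
  unfolding path_connected_space_def
proof (intro ballI)
  fix x y assume xy: "x \<in> topspace (chain_space m \<alpha>)" "y \<in> topspace (chain_space m \<alpha>)"
  obtain a where a: "a \<in> topspace U" "qmap (pmap a) = x" using qmap_pmap_surj[OF xy(1)] .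
  obtain b where b: "b \<in> topspace U" "qmap (pmap b) = y" using qmap_pmap_surj[OF xy(2)] .
  let ?Z = "top_of_set {0..1::real}"
  have cl: "closedin ?Z {0}" "closedin ?Z {1}" by (auto intro!: closed_subset)
  have "continuous_map (subtopology ?Z ({0} \<union> {1})) U (\<lambda>t. if t \<in> {0} then a else b)"
    by (rule continuous_map_paste_closed[OF cl]) (use a b in auto)
  moreover have "closedin ?Z ({0} \<union> {1})" using cl by (rule closedin_Un)
  ultimately obtain g where g: "continuous_map ?Z U g" "\<And>t. t \<in> {0} \<union> {1} \<Longrightarrow> g t = (if t \<in> {0} then a else b)"
    using flag_extend[OF fl, of ?Z "{0} \<union> {1}"] by (auto simp: metrizable_space_subtopology metrizable_space_euclidean compact_space_subtopology)
  have "pathin (chain_space m \<alpha>) (qmap \<circ> pmap \<circ> g)"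
    unfolding pathin_def using continuous_map_compose[OF g(1) continuous_map_qp] by (simp add: o_assoc)
  moreover have "(qmap \<circ> pmap \<circ> g) 0 = x" "(qmap \<circ> pmap \<circ> g) 1 = y" using g(2)[of 0] g(2)[of 1] a b by auto
  ultimately show "\<exists>g. pathin (chain_space m \<alpha>) g \<and> g 0 = x \<and> g 1 = y" by blast
qed

text \<open>After lifting to \<open>U\<close>, a pointed null homotopy is an extension from a closed
  subset of the cylinder: the lift on the bottom, and its value at the base point on the top and on
  the segment over the base point.\<close>

lemma flag_null_homotopic:
  assumes fl: flag and n: "n \<ge> 2" and f: "continuous_map (nsphere n) (chain_space m \<alpha>) f"
  shows "homotopic_with (\<lambda>h. h sphere_base = f sphere_base) (nsphere n) (chain_space m \<alpha>) f (\<lambda>_. f sphere_base)"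
proof -
  \<comment> \<open>The pole at which lifts of spheres are prescribed; it differs from
    \<open>sphere_base\<close>, the point that the homotopy keeps fixed.\<close>
  let ?z = "\<lambda>i. if i = n then 1 else (0::real)"
  let ?b = sphere_base
  let ?I = "top_of_set {0..1::real}"
  let ?Z = "prod_topology ?I (nsphere n)"
  have zS: "?z \<in> topspace (nsphere n)" by (simp add: topspace_nsphere if_distrib[of "\<lambda>x. x\<^sup>2"] cong: if_cong)
  have bS: "?b \<in> topspace (nsphere n)" using in_topspace_nsphere by (simp add: sphere_base_def)
  have "f ?z \<in> topspace (chain_space m \<alpha>)" using f zS by (auto simp: continuous_map_def)
  then obtain u where u: "u \<in> topspace U" "qmap (pmap u) = f ?z" using qmap_pmap_surj by blast
  have pu: "pmap u \<in> topspace (chains m \<alpha>)" using continuous_map_pmap u by (auto simp: continuous_map_def)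
  obtain g1 where g1: "continuous_map (nsphere n) (chains m \<alpha>) g1" "\<And>z. z \<in> topspace (nsphere n) \<Longrightarrow> qmap (g1 z) = f z" "g1 ?z = pmap u"
    using cover_map_lift_nsphere[where p = qmap and f = f, OF cover_map_qmap n f pu u(2)] by blast
  obtain g where g: "continuous_map (nsphere n) U g" "\<And>z. z \<in> topspace (nsphere n) \<Longrightarrow> pmap (g z) = g1 z"
    using cover_map_lift_nsphere[where p = pmap and f = g1, OF cover_map_pmap n g1(1) u(1) g1(3)[symmetric]] by blast
  have gf: "qmap (pmap (g z)) = f z" if "z \<in> topspace (nsphere n)" for z using g(2) g1(2) that by simp
  have gb: "g ?b \<in> topspace U" using g(1) bS by (auto simp: continuous_map_def)
  let ?A1 = "{0} \<times> topspace (nsphere n)"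
  let ?A2 = "{1} \<times> topspace (nsphere n) \<union> {0..1} \<times> {?b}"
  have cl01: "closedin ?I {0}" "closedin ?I {1}" by (auto intro!: closed_subset)
  have clb: "closedin (nsphere n) {?b}"
    using Hausdorff_imp_t1_space[OF Hausdorff_space_nsphere] bS by (simp add: t1_space_closedin_singleton)
  have clI: "closedin ?I {0..1}" using closedin_topspace[of ?I] by simp
  have cl1: "closedin ?Z ?A1" using cl01 by (simp add: closedin_prod_Times_iff)
  have cl2: "closedin ?Z ?A2" using cl01 clb clI by (intro closedin_Un) (simp_all add: closedin_prod_Times_iff)
  have c1: "continuous_map (subtopology ?Z ?A1) U (g \<circ> snd)"
    by (intro continuous_map_from_subtopology continuous_map_compose[OF continuous_map_snd g(1)])
  have c2: "continuous_map (subtopology ?Z ?A2) U (\<lambda>_. g ?b)" using gb by simp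
  have cA: "continuous_map (subtopology ?Z (?A1 \<union> ?A2)) U (\<lambda>w. if w \<in> ?A1 then (g \<circ> snd) w else g ?b)"
    by (rule continuous_map_paste_closed[OF cl1 cl2 c1 c2]) auto
  have Z: "metrizable_space ?Z" "compact_space ?Z"
    by (simp_all add: metrizable_space_prod_topology metrizable_space_nsphere metrizable_space_subtopology metrizable_space_euclidean
        compact_space_prod_topology compact_space_nsphere compact_space_subtopology)
  obtain h where h: "continuous_map ?Z U h" "\<And>w. w \<in> ?A1 \<union> ?A2 \<Longrightarrow> h w = (if w \<in> ?A1 then (g \<circ> snd) w else g ?b)"
    using flag_extend[OF fl Z closedin_Un[OF cl1 cl2] cA] by blast
  have H: "continuous_map ?Z (chain_space m \<alpha>) (qmap \<circ> pmap \<circ> h)"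
    using continuous_map_compose[OF h(1) continuous_map_qp] by (simp add: o_assoc)
  show ?thesis
  proof (subst homotopic_with)
    show "(h ?b = f ?b) = (k ?b = f ?b)" if "\<And>x. x \<in> topspace (nsphere n) \<Longrightarrow> h x = k x" for h k
      using that[OF bS] by simp
  next
    show "\<exists>h. continuous_map ?Z (chain_space m \<alpha>) h \<and> (\<forall>x\<in>topspace (nsphere n). h (0, x) = f x) \<and>
        (\<forall>x\<in>topspace (nsphere n). h (1, x) = f ?b) \<and> (\<forall>t\<in>{0..1}. h (t, ?b) = f ?b)"
    proof (intro exI[of _ "qmap \<circ> pmap \<circ> h"] conjI ballI H)
    fix z assume z: "z \<in> topspace (nsphere n)"
    show "(qmap \<circ> pmap \<circ> h) (0, z) = f z" using h(2)[of "(0, z)"] gf[OF z] z by simp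
    show "(qmap \<circ> pmap \<circ> h) (1, z) = f ?b" using h(2)[of "(1, z)"] gf[OF bS] z by simp
  next
    fix t :: real assume "t \<in> {0..1}"
    then show "(qmap \<circ> pmap \<circ> h) (t, ?b) = f ?b" using h(2)[of "(t, ?b)"] gf[OF bS] bS by auto
    qed
  qed
qed

theorem flag_imp_aspherical:
  assumes fl: flag
  shows "aspherical (chain_space m \<alpha>)"
  unfolding aspherical_def
proof (intro conjI allI impI ballI)
  show "path_connected_space (chain_space m \<alpha>)" using path_connected_chain_space[OF fl] .
  fix n :: nat and x assume n: "2 \<le> n" and x: "x \<in> topspace (chain_space m \<alpha>)"
  show "is_singleton (homotopy_group_set n (chain_space m \<alpha>) x)"
    unfolding is_singleton_homotopy_group_set_iff[OF x]
    using flag_null_homotopic[OF fl n] by (auto simp: pointed_sphere_maps_def)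
qed

end

section \<open>Missing faces\<close>

lemma continuous_map_normalize:
  assumes "\<And>i. i \<le> n \<Longrightarrow> continuous_map Z euclideanreal (\<lambda>z. f z i)"
    and "\<And>z. z \<in> topspace Z \<Longrightarrow> \<exists>i\<le>n. f z i \<noteq> 0"
  shows "continuous_map Z (nsphere n) (\<lambda>z i. if i \<le> n then f z i / sqrt (\<Sum>j\<le>n. (f z j)\<^sup>2) else 0)"
proof -
  have pos: "0 < (\<Sum>j\<le>n. (f z j)\<^sup>2)" if z: "z \<in> topspace Z" for z
  proof -
    obtain i where "i \<le> n" "f z i \<noteq> 0" using assms(2)[OF z] by blast
    then show ?thesis by (intro sum_pos2[of _ i]) auto
  qed
  show ?thesis
    unfolding nsphere continuous_map_in_subtopology continuous_map_componentwise_UNIV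
  proof (intro conjI allI)
    fix k
    have s: "continuous_map Z euclideanreal (\<lambda>z. sqrt (\<Sum>j\<le>n. (f z j)\<^sup>2))"
      using assms(1) by (intro continuous_map_sqrt continuous_map_sum continuous_map_real_pow) auto
    show "continuous_map Z euclideanreal (\<lambda>z. if k \<le> n then f z k / sqrt (\<Sum>j\<le>n. (f z j)\<^sup>2) else 0)"
    proof (cases "k \<le> n")
      case True
      have "sqrt (\<Sum>j\<le>n. (f z j)\<^sup>2) \<noteq> 0" if "z \<in> topspace Z" for z using pos[OF that] by simp
      then show ?thesis using True assms(1) s by (simp add: continuous_map_real_divide)
    qed simp
  next
    have "(\<Sum>i\<le>n. (f z i / sqrt (\<Sum>j\<le>n. (f z j)\<^sup>2))\<^sup>2) = 1" if "z \<in> topspace Z" for z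
    proof -
      have "(\<Sum>i\<le>n. (f z i / sqrt (\<Sum>j\<le>n. (f z j)\<^sup>2))\<^sup>2) = (\<Sum>i\<le>n. (f z i)\<^sup>2) / (\<Sum>j\<le>n. (f z j)\<^sup>2)"
        using pos[OF that] by (simp add: power_divide flip: sum_divide_distrib)
      then show ?thesis using pos[OF that] by simp
    qed
    then show "(\<lambda>z i. if i \<le> n then f z i / sqrt (\<Sum>j\<le>n. (f z j)\<^sup>2) else 0) \<in> topspace Z \<rightarrow> {x. (\<Sum>i\<le>n. (x i)\<^sup>2) = 1 \<and> (\<forall>i>n. x i = 0)}"
      by auto
  qed
qed

text \<open>On the circle this is the principal argument itself, not half of it:
  \<open>snd z / (1 + fst z)\<close> is the tangent of half the angle. It is continuous away from
  \<open>fst z = -1\<close>.\<close>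

definition half_angle :: "real \<times> real \<Rightarrow> real" where
  "half_angle z = 2 * arctan (snd z / (1 + fst z))"

definition expi :: "real \<Rightarrow> real \<times> real" where
  "expi t = (cos t, sin t)"

lemma expi_half_angle:
  assumes "(fst z)\<^sup>2 + (snd z)\<^sup>2 = 1" "fst z \<noteq> -1"
  shows "expi (half_angle z) = z"
proof -
  define s where "s = snd z / (1 + fst z)"
  have n: "1 + fst z \<noteq> 0" using assms(2) by auto
  have y2: "(snd z)\<^sup>2 = (1 + fst z) * (1 - fst z)" using assms(1) by (simp add: power2_eq_square algebra_simps)
  have s2: "s\<^sup>2 = (1 - fst z) / (1 + fst z)"
  proof -
    have "s\<^sup>2 = (1 + fst z) * (1 - fst z) / (1 + fst z)\<^sup>2" by (simp add: s_def power_divide y2)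
    then show ?thesis using n by (simp add: power2_eq_square)
  qed
  have one: "1 + s\<^sup>2 = 2 / (1 + fst z)" unfolding s2 using n by (simp add: field_simps)
  have pos: "1 + s\<^sup>2 > 0" by (simp add: add_pos_nonneg)
  have "cos (2 * arctan s) = 2 * (cos (arctan s))\<^sup>2 - 1" by (rule cos_double_cos)
  also have "(cos (arctan s))\<^sup>2 = 1 / (1 + s\<^sup>2)" using pos by (simp add: cos_arctan power_divide)
  finally have c: "cos (2 * arctan s) = fst z" unfolding one using n by (simp add: field_simps)
  have "sin (2 * arctan s) = 2 * sin (arctan s) * cos (arctan s)" by (rule sin_double)
  also have "\<dots> = 2 * s / (1 + s\<^sup>2)" using pos by (simp add: sin_arctan cos_arctan)
  also have "\<dots> = snd z" unfolding one using n by (simp add: s_def)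
  finally have "sin (2 * arctan s) = snd z" .
  then show ?thesis using c by (simp add: expi_def half_angle_def s_def[symmetric] prod_eq_iff)
qed

lemma half_angle_expi:
  assumes "- pi < t" "t < pi"
  shows "half_angle (expi t) = t"
proof -
  have c: "cos (t / 2) > 0" using assms by (intro cos_gt_zero_pi) auto
  have "sin t = 2 * sin (t/2) * cos (t/2)" "cos t = 2 * (cos (t/2))\<^sup>2 - 1"
    using sin_double[of "t/2"] cos_double_cos[of "t/2"] by auto
  then have "sin t / (1 + cos t) = tan (t/2)" using c by (simp add: tan_def power2_eq_square)
  then show ?thesis using assms arctan_tan[of "t/2"] by (simp add: half_angle_def expi_def)
qed

lemma expi_circle: "(fst (expi t))\<^sup>2 + (snd (expi t))\<^sup>2 = 1"
  by (simp add: expi_def)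

text \<open>Rotation by \<open>-a\<close>, so that \<open>rot t0\<close> brings the point of angle
  \<open>t0\<close> to angle 0.\<close>

definition rot :: "real \<Rightarrow> real \<times> real \<Rightarrow> real \<times> real" where
  "rot a z = (cos a * fst z + sin a * snd z, cos a * snd z - sin a * fst z)"

lemma rot_expi: "rot a (expi t) = expi (t - a)"
  by (simp add: rot_def expi_def cos_diff sin_diff algebra_simps)

lemma expi_add_rot: "rot (- a) (expi t) = expi (a + t)"
  by (simp add: rot_expi add.commute)

lemma rot_circle: "(fst (rot a z))\<^sup>2 + (snd (rot a z))\<^sup>2 = (fst z)\<^sup>2 + (snd z)\<^sup>2"
proof -
  have "(c * x + s * y)\<^sup>2 + (c * y - s * x)\<^sup>2 = (s\<^sup>2 + c\<^sup>2) * (x\<^sup>2 + y\<^sup>2)" for c s x y :: real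
    by (simp add: power2_eq_square algebra_simps)
  from this[where c = "cos a" and s = "sin a" and x = "fst z" and y = "snd z"]
  show ?thesis by (simp add: rot_def)
qed

lemma rot_rot: "rot (- a) (rot a z) = z"
proof -
  have "c * (c * x + s * y) - s * (c * y - s * x) = (s\<^sup>2 + c\<^sup>2) * x"
    "c * (c * y - s * x) + s * (c * x + s * y) = (s\<^sup>2 + c\<^sup>2) * y" for c s x y :: real
    by (simp_all add: power2_eq_square algebra_simps)
  from this[where c = "cos a" and s = "sin a" and x = "fst z" and y = "snd z"]
  have "cos a * (cos a * fst z + sin a * snd z) - sin a * (cos a * snd z - sin a * fst z) = fst z"
    "cos a * (cos a * snd z - sin a * fst z) + sin a * (cos a * fst z + sin a * snd z) = snd z"
    by simp_all
  then show ?thesis by (simp add: rot_def prod_eq_iff)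
qed

abbreviation circle :: "(real \<times> real) topology" where
  "circle \<equiv> subtopology euclidean {z. (fst z)\<^sup>2 + (snd z)\<^sup>2 = 1}"

text \<open>Off the antipode of \<open>z0\<close> the principal argument relative to
  \<open>z0\<close> is continuous; adding a suitable constant gives a section through any prescribed
  \<open>e\<close>.\<close>

lemma cover_map_expi: "cover_map euclideanreal circle expi"
  unfolding cover_map_def
proof (intro conjI ballI)
  show "continuous_map euclideanreal circle expi"
    using expi_circle by (auto simp: continuous_map_in_subtopology expi_def intro!: continuous_intros)
  show "Hausdorff_space euclideanreal" by simp
  fix e :: real
  have "inj_on expi {e - pi/2<..<e + pi/2}"
  proof (rule inj_onI)
    fix s t assume st: "s \<in> {e - pi/2<..<e + pi/2}" "t \<in> {e - pi/2<..<e + pi/2}" "expi s = expi t"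
    then have "expi (s - e) = expi (t - e)" using rot_expi by metis
    then have "half_angle (expi (s - e)) = half_angle (expi (t - e))" by simp
    moreover have "half_angle (expi (s - e)) = s - e" using st pi_gt_zero by (intro half_angle_expi) auto
    moreover have "half_angle (expi (t - e)) = t - e" using st pi_gt_zero by (intro half_angle_expi) auto
    ultimately show "s = t" by simp
  qed
  then show "\<exists>N. openin euclideanreal N \<and> e \<in> N \<and> inj_on expi N"
    by (intro exI[of _ "{e - pi/2<..<e + pi/2}"]) auto
next
  fix z0 assume "z0 \<in> topspace circle"
  then have "(fst z0)\<^sup>2 + (snd z0)\<^sup>2 = 1" by simp
  then obtain t0 where t0: "z0 = expi t0" using sincos_total_2pi[of "fst z0" "snd z0"] by (metis expi_def prod.collapse)
  let ?V = "{z. (fst z)\<^sup>2 + (snd z)\<^sup>2 = 1 \<and> fst (rot t0 z) \<noteq> -1}"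
  have crot: "continuous_on UNIV (rot a)" for a unfolding rot_def by (intro continuous_intros)
  have oV: "openin circle ?V"
  proof -
    have "open {z. fst (rot t0 z) \<noteq> -1}"
    proof -
      have "open ((\<lambda>z. fst (rot t0 z)) -` (- {-1}))"
        using crot by (intro open_vimage continuous_on_fst) auto
      then show ?thesis by (simp add: vimage_def)
    qed
    then have "openin circle ({z. (fst z)\<^sup>2 + (snd z)\<^sup>2 = 1} \<inter> {z. fst (rot t0 z) \<noteq> -1})" by (rule openin_open_Int)
    then show ?thesis by (simp add: Collect_conj_eq)
  qed
  have "\<exists>\<sigma>. continuous_map (subtopology circle ?V) euclideanreal \<sigma> \<and> (\<forall>z\<in>?V. expi (\<sigma> z) = z) \<and> \<sigma> (expi e) = e"
    if eV: "expi e \<in> ?V" for e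
  proof -
    \<comment> \<open>The principal angle of \<open>e\<close> relative to \<open>t0\<close>; then
      \<open>e - d\<close> is an angle of \<open>z0\<close>, and it is the constant that makes the
      section pass through \<open>e\<close>.\<close>
    define d where "d = half_angle (expi (e - t0))"
    have ne: "fst (expi (e - t0)) \<noteq> -1" using eV by (simp add: rot_expi)
    have "expi d = expi (e - t0)" unfolding d_def using expi_circle ne by (rule expi_half_angle)
    then have e': "expi (e - d) = expi t0"
    proof -
      have "expi (e - d) = rot (- e) (expi (- d))" by (simp add: rot_expi)
      also have "expi (- d) = expi (t0 - e)"
        using \<open>expi d = expi (e - t0)\<close> cos_minus[of "e - t0"] sin_minus[of "e - t0"] by (simp add: expi_def)
      also have "rot (- e) (expi (t0 - e)) = expi t0" by (simp add: rot_expi)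
      finally show ?thesis .
    qed
    define \<sigma> where "\<sigma> z = e - d + half_angle (rot t0 z)" for z
    have "expi (\<sigma> z) = z" if z: "z \<in> ?V" for z
    proof -
      have "expi (half_angle (rot t0 z)) = rot t0 z" using z rot_circle by (intro expi_half_angle) auto
      then have "expi (\<sigma> z) = rot (- (e - d)) (rot t0 z)" unfolding \<sigma>_def using expi_add_rot by metis
      moreover have "cos (- (e - d)) = cos (- t0)" "sin (- (e - d)) = sin (- t0)"
        using e' unfolding cos_minus sin_minus by (simp_all add: expi_def)
      ultimately have "expi (\<sigma> z) = rot (- t0) (rot t0 z)" by (simp only: rot_def[of "- (e - d)"] rot_def[of "- t0"])
      then show ?thesis by (simp only: rot_rot)
    qed
    moreover have "\<sigma> (expi e) = e" by (simp add: \<sigma>_def rot_expi d_def)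
    moreover have "continuous_map (subtopology circle ?V) euclideanreal \<sigma>"
    proof -
      have "continuous_on ?V \<sigma>"
        unfolding \<sigma>_def half_angle_def
        using continuous_on_subset[OF crot] by (intro continuous_intros) auto
      moreover have "subtopology circle ?V = top_of_set ?V" by (simp add: subtopology_subtopology Collect_conj_eq Int_absorb1 Int_assoc)
      ultimately show ?thesis by simp
    qed
    ultimately show ?thesis by blast
  qed
  moreover have "z0 \<in> ?V" by (simp add: t0 expi_circle rot_expi) (simp add: expi_def)
  ultimately show "\<exists>V. openin circle V \<and> z0 \<in> V \<and> (\<forall>e\<in>topspace euclideanreal. expi e \<in> V \<longrightarrow>
      (\<exists>\<sigma>. continuous_map (subtopology circle V) euclideanreal \<sigma> \<and> (\<forall>z\<in>V. expi (\<sigma> z) = z) \<and> \<sigma> (expi e) = e))"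
    using oV by blast
qed

text \<open>At time 1 the lift stays in one fibre, and uniqueness of lifts over the connected
  \<open>Z\<close> makes it constant.\<close>

lemma cover_map_lift_end_const:
  assumes p: "cover_map E X p" and Z: "connected_space Z"
    and G: "continuous_map (prod_topology (top_of_set {0..1::real}) Z) E G"
    and c: "\<And>z. z \<in> topspace Z \<Longrightarrow> p (G (1, z)) = c" and z: "z \<in> topspace Z" "z' \<in> topspace Z"
  shows "G (1, z) = G (1, z')"
proof (rule cover_map_lift_unique[OF p Z, of "\<lambda>z. G (1, z)" "\<lambda>_. G (1, z')" z' z])
  have "continuous_map Z (prod_topology (top_of_set {0..1::real}) Z) (\<lambda>z. (1, z))"
    by (simp add: continuous_map_pairwise o_def)
  from continuous_map_compose[OF this G] show c1: "continuous_map Z E (\<lambda>z. G (1, z))" by (simp add: o_def)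
  show "continuous_map Z E (\<lambda>_. G (1, z'))" using c1 z by (auto simp: continuous_map_def)
qed (use c z in auto)

section \<open>The essential sphere around a missing face\<close>

context lengths
begin

text \<open>The coordinates in \<open>I\<close> sweep out a sphere around the corner \<open>v\<^sub>i = (\<sigma>, 0)\<close> of the torus,
  which no chain can reach. After passing to angles this sphere surrounds the origin.\<close>

lemma not_aspherical_of_missing_face:
  fixes \<sigma> :: real
  assumes I: "I \<subseteq> M" "card I \<ge> 3" and \<sigma>: "\<sigma> \<in> {-1, 1}"
    and c: "c = \<sigma> * \<alpha> m + sum \<alpha> (M - I)" "sum \<alpha> I > c" "\<And>i. i \<in> I \<Longrightarrow> sum \<alpha> I - 2 * \<alpha> i < c"
  shows "\<not> aspherical (chain_space m \<alpha>)"
proof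
  assume asph: "aspherical (chain_space m \<alpha>)"
  have finI: "finite I" using I(1) by (rule finite_subset) simp
  define n where "n = card I - 1"
  have n: "n \<ge> 2" "card I = Suc n" using I(2) by (auto simp: n_def)
  obtain e where e: "bij_betw e {..n} I"
    using ex_bij_betw_nat_finite[OF finI] n(2) by (auto simp: lessThan_Suc_atMost atLeast0LessThan)
  define d where "d = the_inv_into {..n} e"
  have ed: "e (d j) = j" "d j \<le> n" if "j \<in> I" for j
    using e that f_the_inv_into_f_bij_betw[OF e] the_inv_into_into[of e "{..n}" j "{..n}"] by (auto simp: d_def bij_betw_def)
  have de: "d (e i) = i" "e i \<in> I" if "i \<le> n" for i
    using e that the_inv_into_f_f[of e "{..n}" i] by (auto simp: d_def bij_betw_def)
  have \<alpha>I: "0 < \<alpha> j" if "j \<in> I" for j using posM I(1) that by blast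
  have \<sigma>2: "\<sigma> * \<sigma> = 1" using \<sigma> by auto
  \<comment> \<open>The required distance from the corner: with \<open>-\<sigma>\<close> outside
    \<open>I\<close>, the chain equation says that the sum of
    \<open>\<alpha> j * (1 - \<sigma> * x j)\<close> over \<open>I\<close> equals \<open>B\<close>.
    The last assumption gives \<open>B < 2 * \<alpha> i\<close>, so no coordinate in
    \<open>I\<close> ever reaches \<open>-\<sigma>\<close>.\<close>
  define B where "B = sum \<alpha> I - c"
  have B: "0 < B" "\<And>i. i \<in> I \<Longrightarrow> B < 2 * \<alpha> i" using c(2,3) by (auto simp: B_def) (smt (verit) c(3))
  define N where "N u = (\<Sum>j\<in>I. \<alpha> j * (u (d j))\<^sup>2)" for u :: "nat \<Rightarrow> real"
  \<comment> \<open>Rescales the squares of the coordinates of \<open>u\<close> so that the terms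
    \<open>\<alpha> j * a u j\<close> add up to \<open>B\<close>.\<close>
  define t where "t u = B / N u" for u
  define a where "a u j = t u * (u (d j))\<^sup>2" for u j
  let ?S = "topspace (nsphere n)"
  have nz: "\<exists>i\<le>n. u i \<noteq> 0" if "u \<in> ?S" for u
  proof (rule ccontr)
    assume "\<not> (\<exists>i\<le>n. u i \<noteq> 0)"
    then have "(\<Sum>i\<le>n. (u i)\<^sup>2) = 0" by simp
    then show False using that by (simp add: topspace_nsphere)
  qed
  have N: "0 < N u" if u: "u \<in> ?S" for u
  proof -
    obtain i where "i \<le> n" "u i \<noteq> 0" using nz[OF u] by blast
    then have "0 < \<alpha> (e i) * (u (d (e i)))\<^sup>2" "e i \<in> I" using de \<alpha>I by auto
    then show ?thesis unfolding N_def using finI \<alpha>I by (intro sum_pos2[of _ "e i"]) (auto intro!: mult_nonneg_nonneg[OF less_imp_le[OF \<alpha>I]])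
  qed
  have t: "0 < t u" if "u \<in> ?S" for u using B(1) N[OF that] by (simp add: t_def)
  have a: "0 \<le> a u j" "a u j < 2" if u: "u \<in> ?S" and j: "j \<in> I" for u j
  proof -
    show "0 \<le> a u j" using t[OF u] by (simp add: a_def)
    have "\<alpha> j * (u (d j))\<^sup>2 \<le> N u"
      unfolding N_def using finI j \<alpha>I by (intro member_le_sum) (auto intro!: mult_nonneg_nonneg[OF less_imp_le[OF \<alpha>I]])
    then have "\<alpha> j * a u j \<le> B"
      using N[OF u] B(1) by (simp add: a_def t_def field_simps mult_left_mono)
    also have "B < \<alpha> j * 2" using B(2)[OF j] by simp
    finally show "a u j < 2" using \<alpha>I[OF j] by simp
  qed
  \<comment> \<open>The square of the second coordinate must be \<open>a u j * (2 - a u j)\<close>;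
    taking \<open>u (d j)\<close> out of the root keeps its sign and makes the choice of root
    continuous.\<close>
  define f where "f u = (\<lambda>j\<in>M. if j \<in> I then (\<sigma> * (1 - a u j), u (d j) * sqrt (t u * (2 - a u j))) else (- \<sigma>, 0))" for u
  have fI: "f u j = (\<sigma> * (1 - a u j), u (d j) * sqrt (t u * (2 - a u j)))" if "j \<in> I" for u j
    using that I(1) by (auto simp: f_def)
  have fM: "f u j = (- \<sigma>, 0)" if "j \<in> M - I" for u j using that by (auto simp: f_def)
  have fch: "f u \<in> chset" if u: "u \<in> ?S" for u
    unfolding in_chset
  proof (intro conjI ballI allI impI)
    fix j assume j: "j \<in> M"
    show "(fst (f u j))\<^sup>2 + (snd (f u j))\<^sup>2 = 1"
    proof (cases "j \<in> I")
      case True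
      have "(snd (f u j))\<^sup>2 = (u (d j))\<^sup>2 * (t u * (2 - a u j))"
        using t[OF u] a[OF u True] by (simp add: fI[OF True] power_mult_distrib)
      also have "\<dots> = a u j * (2 - a u j)" by (simp add: a_def)
      finally have "(snd (f u j))\<^sup>2 = a u j * (2 - a u j)" .
      moreover have "(fst (f u j))\<^sup>2 = (1 - a u j)\<^sup>2" using \<sigma> by (auto simp: fI[OF True] power_mult_distrib)
      ultimately show ?thesis by (simp add: power2_eq_square algebra_simps)
    next
      case False
      then show ?thesis using fM[of j u] j \<sigma> by auto
    qed
  next
    fix j assume "j \<notin> M" then show "f u j = undefined" unfolding f_def by (simp only: restrict_def if_False)
  next
    have "(\<Sum>j\<in>M. \<alpha> j * fst (f u j)) = (\<Sum>j\<in>I. \<alpha> j * fst (f u j)) + (\<Sum>j\<in>M - I. \<alpha> j * fst (f u j))"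
      using sum_M_split[OF I(1), of "{}"] by simp
    also have "(\<Sum>j\<in>M - I. \<alpha> j * fst (f u j)) = - \<sigma> * sum \<alpha> (M - I)"
      unfolding sum_distrib_left by (intro sum.cong) (auto simp: fM)
    also have "(\<Sum>j\<in>I. \<alpha> j * fst (f u j)) = (\<Sum>j\<in>I. \<sigma> * (\<alpha> j - t u * (\<alpha> j * (u (d j))\<^sup>2)))"
      by (intro sum.cong) (auto simp: fI a_def algebra_simps)
    also have "\<dots> = \<sigma> * (sum \<alpha> I - t u * N u)"
      by (simp add: sum_subtractf N_def flip: sum_distrib_left)
    also have "t u * N u = B" using N[OF u] by (simp add: t_def)
    finally have "(\<Sum>j\<in>M. \<alpha> j * fst (f u j)) = \<sigma> * (c - sum \<alpha> (M - I))" by (simp add: B_def algebra_simps)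
    then show "(\<Sum>j\<in>M. \<alpha> j * fst (f u j)) = \<alpha> m" using \<sigma>2 c(1) by (simp add: mult.assoc[symmetric])
  qed
  have cu: "continuous_map (nsphere n) euclideanreal (\<lambda>u. u i)" for i by (rule continuous_map_nsphere_projection)
  have ct: "continuous_map (nsphere n) euclideanreal t"
    unfolding t_def
  proof (rule continuous_map_real_divide)
    show "continuous_map (nsphere n) euclideanreal N"
      unfolding N_def using finI cu by (intro continuous_map_sum continuous_map_real_mult continuous_map_real_pow) auto
    show "N u \<noteq> 0" if "u \<in> ?S" for u using N[OF that] by simp
  qed simp
  have ca: "continuous_map (nsphere n) euclideanreal (\<lambda>u. a u j)" for j
    unfolding a_def using ct cu by (intro continuous_map_real_mult continuous_map_real_pow)
  have cf: "continuous_map (nsphere n) (chains m \<alpha>) f"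
  proof (rule continuous_map_into_chains[OF fch])
    fix j assume j: "j \<in> M"
    show "continuous_map (nsphere n) euclideanreal (\<lambda>u. fst (f u j))"
      using j ca[of j] by (cases "j \<in> I") (simp_all add: fI fM continuous_map_real_mult continuous_map_diff)
    have "continuous_map (nsphere n) euclideanreal (\<lambda>u. u (d j) * sqrt (t u * (2 - a u j)))"
      using ca[of j] ct cu by (intro continuous_map_real_mult continuous_map_sqrt continuous_map_diff) auto
    then show "continuous_map (nsphere n) euclideanreal (\<lambda>u. snd (f u j))"
      using j by (cases "j \<in> I") (simp_all add: fI fM)
  qed
  let ?b = sphere_base
  let ?I = "top_of_set {0..1::real}"
  let ?Z = "prod_topology ?I (nsphere n)"
  have bS: "?b \<in> ?S" using in_topspace_nsphere by (simp add: sphere_base_def)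
  define x0 where "x0 = qmap (f ?b)"
  have x0: "x0 \<in> topspace (chain_space m \<alpha>)" using fch[OF bS] by (simp add: x0_def topspace_chain_space)
  have "continuous_map (nsphere n) (chain_space m \<alpha>) (qmap \<circ> f)"
    using cf quotient_imp_continuous_map[OF quotient_map_qmap] by (rule continuous_map_compose)
  then have "qmap \<circ> f \<in> pointed_sphere_maps n (chain_space m \<alpha>) x0" by (simp add: pointed_sphere_maps_def x0_def)
  moreover have "is_singleton (homotopy_group_set n (chain_space m \<alpha>) x0)" using asph n(1) x0 by (simp add: aspherical_def)
  ultimately have "homotopic_with (\<lambda>h. h ?b = x0) (nsphere n) (chain_space m \<alpha>) (qmap \<circ> f) (\<lambda>_. x0)"
    using is_singleton_homotopy_group_set_iff[OF x0] by blast
  then obtain H where H: "continuous_map ?Z (chain_space m \<alpha>) H" "\<And>u. H (0, u) = qmap (f u)" "\<And>u. H (1, u) = x0"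
    unfolding homotopic_with_def by auto
  obtain G where G: "continuous_map ?Z (chains m \<alpha>) G"
      "\<And>s u. s \<in> {0..1} \<Longrightarrow> u \<in> ?S \<Longrightarrow> qmap (G (s, u)) = H (s, u)"
      "\<And>u. u \<in> ?S \<Longrightarrow> G (0, u) = f u"
    by (rule cover_map_lift_homotopy[OF cover_map_qmap H(1) cf]) (use H(2) in auto)
  have conn: "connected_space (nsphere n)" using connected_space_nsphere[of "n - 1"] n(1) by simp
  have G1: "G (1, u) = G (1, ?b)" if "u \<in> ?S" for u
    by (rule cover_map_lift_end_const[OF cover_map_qmap conn G(1) _ that bS, of x0]) (use G(2)[of 1] H(3) in simp)
  have Gch: "G w \<in> chset" if "w \<in> topspace ?Z" for w
    using G(1) that by (auto simp: continuous_map_def chset_def)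
  \<comment> \<open>Multiplying by \<open>\<sigma>\<close> puts the corner at angle 0 for either
    sign.\<close>
  define K where "K j w = (\<sigma> * fst (G w j), snd (G w j))" for j w
  have ang: "\<exists>\<Theta>. continuous_map ?Z euclideanreal \<Theta> \<and>
      (\<forall>s\<in>{0..1}. \<forall>u\<in>?S. expi (\<Theta> (s, u)) = K j (s, u)) \<and> (\<forall>u\<in>?S. \<Theta> (0, u) = half_angle (K j (0, u)))"
    if j: "j \<in> I" for j
  proof -
    have jM: "j \<in> M" using j I(1) by blast
    have "continuous_map ?Z euclideanreal (\<lambda>w. fst (G w j))" "continuous_map ?Z euclideanreal (\<lambda>w. snd (G w j))"
      using continuous_map_compose[OF G(1) continuous_map_chains_coord(1)[OF jM]]
        continuous_map_compose[OF G(1) continuous_map_chains_coord(2)[OF jM]] by (simp_all add: o_def)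
    then have "continuous_map ?Z (prod_topology euclideanreal euclideanreal) (K j)"
      unfolding continuous_map_pairwise by (simp add: K_def o_def continuous_map_real_mult_left)
    moreover have "(fst (K j w))\<^sup>2 + (snd (K j w))\<^sup>2 = 1" if "w \<in> topspace ?Z" for w
      using chset_circle[OF Gch[OF that] jM] \<sigma> by (auto simp: K_def power_mult_distrib)
    ultimately have cK: "continuous_map ?Z circle (K j)" by (auto simp: continuous_map_in_subtopology)
    have K0: "K j (0, u) = (1 - a u j, u (d j) * sqrt (t u * (2 - a u j)))" if "u \<in> ?S" for u
      using G(3)[OF that] \<sigma>2 by (simp add: K_def fI[OF j] mult.assoc[symmetric])
    have ne: "fst (K j (0, u)) \<noteq> -1" if "u \<in> ?S" for u using K0[OF that] a(2)[OF that j] by simp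
    have c0: "continuous_map (nsphere n) ?Z (\<lambda>u. (0, u))" by (simp add: continuous_map_pairwise o_def)
    have cK0: "continuous_map (nsphere n) euclideanreal (\<lambda>u. fst (K j (0, u)))" "continuous_map (nsphere n) euclideanreal (\<lambda>u. snd (K j (0, u)))"
      using continuous_map_compose[OF c0 \<open>continuous_map ?Z (prod_topology euclideanreal euclideanreal) (K j)\<close>]
      unfolding continuous_map_pairwise by (simp_all add: o_def)
    have cg: "continuous_map (nsphere n) euclideanreal (\<lambda>u. half_angle (K j (0, u)))"
    proof -
      have "continuous_map (nsphere n) euclideanreal (\<lambda>u. snd (K j (0, u)) / (1 + fst (K j (0, u))))"
        using cK0 ne by (intro continuous_map_real_divide continuous_map_add) (auto simp: add_eq_0_iff)
      from continuous_map_compose[OF this, of euclideanreal arctan]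
      have "continuous_map (nsphere n) euclideanreal (\<lambda>u. arctan (snd (K j (0, u)) / (1 + fst (K j (0, u)))))"
        by (simp add: o_def continuous_on_arctan)
      then show ?thesis unfolding half_angle_def by (intro continuous_map_real_mult_left)
    qed
    have "expi (half_angle (K j (0, u))) = K j (0, u)" if "u \<in> ?S" for u
      using ne[OF that] \<open>\<And>w. w \<in> topspace ?Z \<Longrightarrow> (fst (K j w))\<^sup>2 + (snd (K j w))\<^sup>2 = 1\<close>[of "(0, u)"] that
      by (intro expi_half_angle) auto
    then obtain \<Theta> where "continuous_map ?Z euclideanreal \<Theta>" "\<And>s u. s \<in> {0..1} \<Longrightarrow> u \<in> ?S \<Longrightarrow> expi (\<Theta> (s, u)) = K j (s, u)"
       "\<And>u. u \<in> ?S \<Longrightarrow> \<Theta> (0, u) = half_angle (K j (0, u))"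
      using cover_map_lift_homotopy[OF cover_map_expi cK cg] by blast
    then show ?thesis by blast
  qed
  then obtain \<Theta> where \<Theta>: "\<And>j. j \<in> I \<Longrightarrow> continuous_map ?Z euclideanreal (\<Theta> j)"
      "\<And>j s u. j \<in> I \<Longrightarrow> s \<in> {0..1} \<Longrightarrow> u \<in> ?S \<Longrightarrow> expi (\<Theta> j (s, u)) = K j (s, u)"
      "\<And>j u. j \<in> I \<Longrightarrow> u \<in> ?S \<Longrightarrow> \<Theta> j (0, u) = half_angle (K j (0, u))"
    by metis
  have \<Theta>1: "\<Theta> j (1, u) = \<Theta> j (1, ?b)" if "j \<in> I" "u \<in> ?S" for j u
    by (rule cover_map_lift_end_const[OF cover_map_expi conn \<Theta>(1)[OF that(1)] _ that(2) bS, of "K j (1, ?b)"])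
       (use \<Theta>(2)[OF that(1), of 1] G1 in \<open>simp add: K_def\<close>)
  \<comment> \<open>If all angles vanished, the coordinates in \<open>I\<close> would form the
    missing corner \<open>x j = \<sigma>\<close>, and the linear equation would contradict
    \<open>sum \<alpha> I > c\<close>.\<close>
  have \<Theta>nz: "\<exists>i\<le>n. \<Theta> (e i) w \<noteq> 0" if w: "w \<in> topspace ?Z" for w
  proof (rule ccontr)
    assume nn: "\<not> (\<exists>i\<le>n. \<Theta> (e i) w \<noteq> 0)"
    obtain s u where su: "w = (s, u)" "s \<in> {0..1}" "u \<in> ?S" using w by auto
    have "\<sigma> * fst (G w j) = 1" if "j \<in> I" for j
    proof -
      have "\<Theta> j w = 0" using nn ed[OF that] by metis
      then have "K j w = expi 0" using \<Theta>(2)[OF that su(2,3)] su(1) by simp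
      then show ?thesis by (simp add: K_def expi_def)
    qed
    then have "(\<Sum>j\<in>I. \<alpha> j * (\<sigma> * fst (G w j))) = sum \<alpha> I" by (intro sum.cong) auto
    moreover have "(\<Sum>j\<in>M - I. \<alpha> j * (\<sigma> * fst (G w j))) \<ge> (\<Sum>j\<in>M - I. - \<alpha> j)"
    proof (rule sum_mono)
      fix j assume "j \<in> M - I"
      then have "\<bar>fst (G w j)\<bar> \<le> 1" "0 < \<alpha> j" using chset_abs_le_1[OF Gch[OF w]] posM by auto
      then have "- 1 \<le> \<sigma> * fst (G w j)" using \<sigma> by (auto simp: abs_le_iff)
      then have "\<alpha> j * (- 1) \<le> \<alpha> j * (\<sigma> * fst (G w j))" using \<open>0 < \<alpha> j\<close> by (intro mult_left_mono) auto
      then show "- \<alpha> j \<le> \<alpha> j * (\<sigma> * fst (G w j))" by simp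
    qed
    moreover have "(\<Sum>j\<in>M. \<alpha> j * (\<sigma> * fst (G w j))) = \<sigma> * \<alpha> m"
    proof -
      have "(\<Sum>j\<in>M. \<alpha> j * (\<sigma> * fst (G w j))) = \<sigma> * (\<Sum>j\<in>M. \<alpha> j * fst (G w j))"
        by (simp add: sum_distrib_left mult.left_commute)
      then show ?thesis using Gch[OF w] unfolding in_chset by simp
    qed
    ultimately show False using c(1,2) sum_M_split[OF I(1), of "{}" "\<lambda>j. \<alpha> j * (\<sigma> * fst (G w j))"]
      by (simp add: sum_negf)
  qed
  define nrm where "nrm v = (\<lambda>i. if i \<le> n then v i / sqrt (\<Sum>j\<le>n. (v j)\<^sup>2) else 0)" for v :: "nat \<Rightarrow> real"
  \<comment> \<open>The straight line from \<open>u\<close> to the initial angles; it avoids the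
    origin because angle and coordinate have the same sign wherever
    \<open>u i \<noteq> 0\<close>.\<close>
  define h0 where "h0 w i = (1 - fst w) * snd w i + fst w * \<Theta> (e i) (0, snd w)" for w :: "real \<times> (nat \<Rightarrow> real)" and i
  have sgn: "\<Theta> (e i) (0, u) * u i > 0" if "i \<le> n" "u \<in> ?S" "u i \<noteq> 0" for i u
  proof -
    have eI: "e i \<in> I" using de that by simp
    have K0: "K (e i) (0, u) = (1 - a u (e i), u i * sqrt (t u * (2 - a u (e i))))"
      using G(3)[OF that(2)] \<sigma>2 de that by (simp add: K_def fI[OF eI] mult.assoc[symmetric])
    define q where "q = sqrt (t u * (2 - a u (e i))) / (2 - a u (e i))"
    have q: "q > 0" using t[OF that(2)] a(2)[OF that(2) eI] by (simp add: q_def)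
    have "\<Theta> (e i) (0, u) = 2 * arctan (u i * q)"
      using \<Theta>(3)[OF eI that(2)] K0 by (simp add: half_angle_def q_def)
    then show ?thesis using q that(3) by (cases "u i > 0") (auto simp: zero_less_mult_iff mult_less_0_iff not_less)
  qed
  have h0nz: "\<exists>i\<le>n. h0 w i \<noteq> 0" if w: "w \<in> topspace ?Z" for w
  proof -
    obtain s u where su: "w = (s, u)" "s \<in> {0..1}" "u \<in> ?S" using w by auto
    obtain i where i: "i \<le> n" "u i \<noteq> 0" using nz[OF su(3)] by blast
    have p: "0 < u i * u i" "0 < \<Theta> (e i) (0, u) * u i" using i sgn[OF i(1) su(3) i(2)] by (auto simp: zero_less_mult_iff)
    have "h0 w i * u i = (1 - s) * (u i * u i) + s * (\<Theta> (e i) (0, u) * u i)"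
      by (simp add: h0_def su algebra_simps)
    also have "\<dots> > 0"
    proof (cases "s = 0")
      case False
      then have "0 < s * (\<Theta> (e i) (0, u) * u i)" "0 \<le> (1 - s) * (u i * u i)" using su(2) p by auto
      then show ?thesis by linarith
    qed (use p in simp)
    finally show ?thesis using i by auto
  qed
  have \<Theta>e: "continuous_map ?Z euclideanreal (\<Theta> (e i))" if "i \<le> n" for i using \<Theta>(1) de that by blast
  have h1: "homotopic_with (\<lambda>x. True) (nsphere n) (nsphere n) id (\<lambda>u. nrm (\<lambda>i. \<Theta> (e i) (0, u)))"
  proof (subst homotopic_with, simp, intro exI[of _ "\<lambda>w. nrm (h0 w)"] conjI ballI TrueI)
    show "continuous_map ?Z (nsphere n) (\<lambda>w. nrm (h0 w))"
      unfolding nrm_def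
    proof (rule continuous_map_normalize[OF _ h0nz])
      fix i assume i: "i \<le> n"
      have "continuous_map ?Z euclideanreal fst"
        by (rule continuous_map_into_fulltopology, rule continuous_map_fst)
      moreover have "continuous_map ?Z euclideanreal (\<lambda>w. snd w i)"
        using continuous_map_compose[OF continuous_map_snd cu] by (simp add: o_def)
      moreover have "continuous_map ?Z euclideanreal (\<lambda>w. \<Theta> (e i) (0, snd w))"
      proof -
        have "continuous_map ?Z ?Z (\<lambda>w. (0, snd w))" by (simp add: continuous_map_pairwise o_def continuous_map_snd)
        from continuous_map_compose[OF this \<Theta>e[OF i]] show ?thesis by (simp add: o_def)
      qed
      ultimately show "continuous_map ?Z euclideanreal (\<lambda>w. h0 w i)"
        unfolding h0_def by (intro continuous_map_add continuous_map_real_mult continuous_map_diff) auto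
    qed
    fix u assume u: "u \<in> ?S"
    then have "(\<Sum>j\<le>n. (u j)\<^sup>2) = 1" "\<And>i. i > n \<Longrightarrow> u i = 0" by (auto simp: topspace_nsphere)
    then show "nrm (h0 (0, u)) = id u" by (auto simp: nrm_def h0_def fun_eq_iff)
    show "nrm (h0 (1, u)) = nrm (\<lambda>i. \<Theta> (e i) (0, u))" by (simp add: h0_def[abs_def])
  qed
  have h2: "homotopic_with (\<lambda>x. True) (nsphere n) (nsphere n) (\<lambda>u. nrm (\<lambda>i. \<Theta> (e i) (0, u))) (\<lambda>u. nrm (\<lambda>i. \<Theta> (e i) (1, ?b)))"
  proof (subst homotopic_with, simp, intro exI[of _ "\<lambda>w. nrm (\<lambda>i. \<Theta> (e i) w)"] conjI ballI TrueI)
    show "continuous_map ?Z (nsphere n) (\<lambda>w. nrm (\<lambda>i. \<Theta> (e i) w))"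
      unfolding nrm_def by (rule continuous_map_normalize[OF \<Theta>e \<Theta>nz])
    fix u assume u: "u \<in> ?S"
    show "nrm (\<lambda>i. \<Theta> (e i) (0, u)) = nrm (\<lambda>i. \<Theta> (e i) (0, u))" ..
    have "\<Theta> (e i) (1, u) = \<Theta> (e i) (1, ?b)" if "i \<le> n" for i using \<Theta>1[OF de(2)[OF that] u] .
    then show "nrm (\<lambda>i. \<Theta> (e i) (1, u)) = nrm (\<lambda>i. \<Theta> (e i) (1, ?b))" by (auto simp: nrm_def fun_eq_iff)
  qed
  \<comment> \<open>The identity is homotopic to the normalized initial angles, and these to a
    constant along the lifted null homotopy.\<close>
  have "contractible_space (nsphere n)"
    unfolding contractible_space_def using homotopic_with_trans[OF h1 h2] by blast
  then show False using non_contractible_space_nsphere by blast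
qed

lemma minimal_subset:
  assumes "finite I" "Q I"
  shows "\<exists>J. J \<subseteq> I \<and> Q J \<and> (\<forall>i\<in>J. \<not> Q (J - {i}))"
  using assms
proof (induction "card I" arbitrary: I rule: less_induct)
  case less
  show ?case
  proof (cases "\<exists>i\<in>I. Q (I - {i})")
    case True
    then obtain i where i: "i \<in> I" "Q (I - {i})" by blast
    have "card (I - {i}) < card I" "finite (I - {i})" using card_Diff1_less[OF less(2) i(1)] less(2) by simp_all
    from less(1)[OF this i(2)] obtain J where "J \<subseteq> I - {i}" "Q J" "\<forall>i\<in>J. \<not> Q (J - {i})"
      by (elim exE conjE)
    then show ?thesis by (intro exI[of _ J]) auto
  next
    case False
    then show ?thesis using less(3) by (intro exI[of _ I]) simp
  qed
qed

text \<open>A minimal counterexample to the flag condition has at least three elements, since a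
  smaller one would be its own witness \<open>H\<close>. Being long gives
  \<open>sum \<alpha> J > c\<close>, and minimality gives the bound for each \<open>i\<close>. The
  sign \<open>\<sigma>\<close> is 1 for subsets of \<open>M\<close> and -1 for sets completed by
  \<open>m\<close>.\<close>

theorem aspherical_imp_flag:
  assumes "aspherical (chain_space m \<alpha>)"
  shows flag
proof (rule ccontr)
  assume "\<not> flag"
  from this[unfolded flag_def de_Morgan_conj not_all not_imp not_ex] show False
  proof (elim disjE exE conjE)
    fix I assume 1: "I \<subseteq> M" "\<not> short m \<alpha> I" "\<forall>H. \<not> H \<subseteq> I \<or> \<not> card H \<le> 2 \<or> \<not> \<not> short m \<alpha> H"
    have "finite I" using 1(1) by (rule finite_subset) simp
    from minimal_subset[where Q = "\<lambda>I. \<not> short m \<alpha> I", OF this 1(2)]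
    obtain J where J: "J \<subseteq> I" "\<not> short m \<alpha> J" and J': "\<forall>i\<in>J. \<not> \<not> short m \<alpha> (J - {i})"
      by (elim exE conjE)
    have JM: "J \<subseteq> M" using J(1) 1(1) by (rule order_trans)
    have finJ: "finite J" using JM by (rule finite_subset) simp
    have "\<not> card J \<le> 2" using 1(3)[THEN spec, of J] J(1,2) by simp
    then have card: "card J \<ge> 3" by simp
    have sM: "sum \<alpha> M = sum \<alpha> J + sum \<alpha> (M - J)" using sum_M_split[OF JM, of "{}"] by simp
    have T: "sum \<alpha> {1..m} = \<alpha> m + sum \<alpha> M" using sum_total by simp
    have sub: "J \<subseteq> {1..m}" using JM M_subset by (rule order_trans)
    have "\<not> aspherical (chain_space m \<alpha>)"
    proof (rule not_aspherical_of_missing_face[where \<sigma> = "1", OF JM card _ refl])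
      show "(1::real) \<in> {-1, 1}" by simp
      have "\<not> 2 * sum \<alpha> J < sum \<alpha> {1..m}" using J(2) sub by (simp add: short_iff)
      then show "1 * \<alpha> m + sum \<alpha> (M - J) < sum \<alpha> J" using generic_sum[OF sub] sM T by simp
      show "sum \<alpha> J - 2 * \<alpha> i < 1 * \<alpha> m + sum \<alpha> (M - J)" if i: "i \<in> J" for i
      proof -
        have "2 * sum \<alpha> (J - {i}) < sum \<alpha> {1..m}" using J'[rule_format, OF i] unfolding short_iff by simp
        moreover have "sum \<alpha> J = \<alpha> i + sum \<alpha> (J - {i})" using finJ i by (rule sum.remove)
        ultimately show ?thesis using sM T by linarith
      qed
    qed
    then show False using assms by blast
  next
    fix I assume 2: "I \<subseteq> M" "\<not> short m \<alpha> (insert m I)"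
      "\<forall>H. \<not> H \<subseteq> I \<or> \<not> card H \<le> 2 \<or> \<not> \<not> short m \<alpha> (insert m H)"
    have "finite I" using 2(1) by (rule finite_subset) simp
    from minimal_subset[where Q = "\<lambda>I. \<not> short m \<alpha> (insert m I)", OF this 2(2)]
    obtain J where J: "J \<subseteq> I" "\<not> short m \<alpha> (insert m J)" and J': "\<forall>i\<in>J. \<not> \<not> short m \<alpha> (insert m (J - {i}))"
      by (elim exE conjE)
    have JM: "J \<subseteq> M" using J(1) 2(1) by (rule order_trans)
    have finJ: "finite J" using JM by (rule finite_subset) simp
    have "\<not> card J \<le> 2" using 2(3)[THEN spec, of J] J(1,2) by simp
    then have card: "card J \<ge> 3" by simp
    have sM: "sum \<alpha> M = sum \<alpha> J + sum \<alpha> (M - J)" using sum_M_split[OF JM, of "{}"] by simp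
    have T: "sum \<alpha> {1..m} = \<alpha> m + sum \<alpha> M" using sum_total by simp
    have sub: "insert m J \<subseteq> {1..m}" using order_trans[OF JM M_subset] m3 by simp
    have mJ: "m \<notin> J" using JM m_notin_M by blast
    have "\<not> aspherical (chain_space m \<alpha>)"
    proof (rule not_aspherical_of_missing_face[where \<sigma> = "-1", OF JM card _ refl])
      show "(-1::real) \<in> {-1, 1}" by simp
      have "\<not> 2 * sum \<alpha> (insert m J) < sum \<alpha> {1..m}" using J(2) sub by (simp only: short_iff) simp
      moreover have "sum \<alpha> (insert m J) = \<alpha> m + sum \<alpha> J" using finJ mJ by simp
      ultimately show "- 1 * \<alpha> m + sum \<alpha> (M - J) < sum \<alpha> J" using generic_sum[OF sub] sM T by simp
      show "sum \<alpha> J - 2 * \<alpha> i < - 1 * \<alpha> m + sum \<alpha> (M - J)" if i: "i \<in> J" for i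
      proof -
        have "2 * sum \<alpha> (insert m (J - {i})) < sum \<alpha> {1..m}" using J'[rule_format, OF i] unfolding short_iff by simp
        moreover have "sum \<alpha> (insert m (J - {i})) = \<alpha> m + sum \<alpha> (J - {i})" using finJ mJ by simp
        moreover have "sum \<alpha> J = \<alpha> i + sum \<alpha> (J - {i})" using finJ i by (rule sum.remove)
        ultimately show ?thesis using sM T by linarith
      qed
    qed
    then show False using assms by blast
  qed
qed

end

theorem theorem1p3:
  fixes m :: nat and \<alpha> :: "nat \<Rightarrow> real"
  assumes "m \<ge> 3"
    and "length_vector m \<alpha>"
    and "generic m \<alpha>"
    and "mono_on {1..m-1} \<alpha>"
    and "\<alpha> m < (\<Sum>i=1..m-1. \<alpha> i)"
  shows "aspherical (chain_space m \<alpha>) \<longleftrightarrow>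
     short_code m \<alpha> = {{1..m-3} \<union> {m}} \<or>
     short_code m \<alpha> = {{1..m-2} \<union> {m}} \<or>
     short_code m \<alpha> = {{1..m-4} \<union> {m-2, m}} \<or>
     short_code m \<alpha> = {{1..m-4} \<union> {m-1, m}}"
proof -
  interpret lengths m \<alpha> by unfold_locales (fact assms)+
  show ?thesis
    unfolding short_code_iff_flag by (rule iffI[OF aspherical_imp_flag flag_imp_aspherical])
qed

end
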